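(* Suppose $E_0\in\mathbb{R}$ is such that there exist $C>0$ and $\alpha>0$ with $E_0\in P(\alpha,C,N)$ for all sufficiently large $N$. For each such $N$ let $A(N)$ be a subset of $P(\alpha,C,N)$ containing $E_0$, such that $\operatorname{diam}(A(N))\to 0$ as $N\to\infty$. Let $p>0$. Let $f\in L^2(\mathbb{R})$ be compactly supported and satisfy $\langle u,f\rangle\neq0$ for at least one solution $u$ of $-u''+(V-E_0)u=0$. Then there exists $\widetilde C>0$ such that for all $T$ large enough, $$M_f(T,p)\ \ge\ \widetilde C\,|B(T)|\,T^{\frac{p-3\alpha}{1+\alpha}},$$ where $B(T)$ is the $1/T$-neighborhood of $A\big(T^{\frac1{1+\alpha}}\big)$.
   Context: $V:\mathbb{R}\to\mathbb{R}$ is measurable with $\sup_{x\in\mathbb{R}}\int_x^{x+1}|V(t)|\,dt<\infty$. $H$ denotes the selfadjoint operator on $L^2(\mathbb{R})$ associated to $\varphi\mapsto-\varphi''+V\varphi$. For $f\in L^2(\mathbb{R})$, $T>0$, $p>0$, $$M_f(T,p)=\frac2T\int_0^\infty e^{-2t/T}\,\big\||X|^{p/2}e^{-itH}f\big\|^2\,dt,$$ where $(X\varphi)(x)=x\varphi(x)$ (the norm is $+\infty$ if the vector is not in the domain of $|X|^{p/2}$). For $z\in\mathbb{C}$ consider solutions of $-u''+(V-z)u=0$. The transfer matrix $M(x,y,z)$ is the unique $2\times2$ matrix with $M(x,y,z)(u(y),u'(y))^t=(u(x),u'(x))^t$ for every solution $u$. For $\alpha>0$, $C>0$ and (real) $N>1$,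 $$P(\alpha,C,N)=\{E\in\mathbb{R}:\ \|M(x,y,E)\|\le CN^\alpha\ \text{for all }-N\le x,y\le N\}.$$ For locally bounded measurable $g$ and compactly supported $f\in L^2$, $\langle g,f\rangle=\int g(t)\overline{f(t)}\,dt$. $|\cdot|$ of a set is Lebesgue measure; the $1/T$-neighborhood of $A\subset\mathbb{R}$ is the set of real numbers at distance less than $1/T$ from $A$. *)

theory Defs
  imports "HOL-Analysis.Analysis"
begin

text \<open>Elements of the Hilbert space are represented by functions; all notions below
  depend only on the classes modulo equality almost everywhere.\<close>

definition l2_norm_sq :: "(real \<Rightarrow> complex) \<Rightarrow> ennreal" where
  "l2_norm_sq f = (\<integral>\<^sup>+ x. ennreal ((norm (f x))\<^sup>2) \<partial>lebesgue)"

definition L2 :: "(real \<Rightarrow> complex) set" where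
  "L2 = {f \<in> borel_measurable lebesgue. l2_norm_sq f < \<infinity>}"

definition L2_inner :: "(real \<Rightarrow> complex) \<Rightarrow> (real \<Rightarrow> complex) \<Rightarrow> complex" where
  "L2_inner g f = (LINT t|lebesgue. g t * cnj (f t))"

text \<open>An almost everywhere class has compact support iff it vanishes almost everywhere
  outside some bounded interval.\<close>

definition compactly_supported :: "(real \<Rightarrow> complex) \<Rightarrow> bool" where
  "compactly_supported f \<longleftrightarrow> (\<exists>R. AE x in lebesgue. \<bar>x\<bar> > R \<longrightarrow> f x = 0)"

definition uniformly_locally_integrable :: "(real \<Rightarrow> real) \<Rightarrow> bool" where
  "uniformly_locally_integrable V \<longleftrightarrow>
     V \<in> borel_measurable lebesgue \<and>
     (SUP x. \<integral>\<^sup>+ t\<in>{x..x+1}. ennreal \<bar>V t\<bar> \<partial>lebesgue) < \<infinity>"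

text \<open>By the fundamental theorem of calculus for the Lebesgue integral, the following says that
  \<open>g\<close> is locally absolutely continuous and that its derivative is \<open>h\<close> almost everywhere.\<close>

definition has_ac_derivative :: "(real \<Rightarrow> complex) \<Rightarrow> (real \<Rightarrow> complex) \<Rightarrow> bool" where
  "has_ac_derivative g h \<longleftrightarrow>
     (\<forall>a b. a \<le> b \<longrightarrow>
        h absolutely_integrable_on {a..b} \<and> (h has_integral (g b - g a)) {a..b})"

text \<open>The equation \<open>- \<phi>'' + V \<phi> = \<psi>\<close> in the Caratheodory sense: \<open>\<phi>\<close> is differentiable, \<open>\<phi>'\<close> is
  locally absolutely continuous, and the equation holds almost everywhere.\<close>

definition schroedinger_eq ::
  "(real \<Rightarrow> real) \<Rightarrow> (real \<Rightarrow> complex) \<Rightarrow> (real \<Rightarrow> complex) \<Rightarrow> bool" where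
  "schroedinger_eq V \<phi> \<psi> \<longleftrightarrow>
     (\<forall>x. \<phi> differentiable (at x)) \<and>
     (\<exists>\<phi>2. has_ac_derivative (\<lambda>x. vector_derivative \<phi> (at x)) \<phi>2 \<and>
       (AE x in lebesgue. - \<phi>2 x + complex_of_real (V x) * \<phi> x = \<psi> x))"

text \<open>The graph of the operator \<open>H\<close>, on its maximal domain. For uniformly locally integrable \<open>V\<close>
  both endpoints are in the limit point case, so this operator is selfadjoint; it is the only
  selfadjoint operator given by the differential expression.\<close>

definition schroedinger_op ::
  "(real \<Rightarrow> real) \<Rightarrow> (real \<Rightarrow> complex) \<Rightarrow> (real \<Rightarrow> complex) \<Rightarrow> bool" where
  "schroedinger_op V \<phi> \<psi> \<longleftrightarrow>
     \<phi> \<in> L2 \<and> \<psi> \<in> L2 \<and>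
     (\<exists>\<phi>0. (AE x in lebesgue. \<phi>0 x = \<phi> x) \<and> schroedinger_eq V \<phi>0 \<psi>)"

text \<open>A strongly continuous one-parameter unitary group \<open>U\<close> whose generator is exactly \<open>- i H\<close>,
  where \<open>H\<close> is given by its graph. Surjectivity of \<open>U t\<close> follows from the group law.\<close>

definition unitary_group_generated_by ::
  "((real \<Rightarrow> complex) \<Rightarrow> (real \<Rightarrow> complex) \<Rightarrow> bool) \<Rightarrow>
   (real \<Rightarrow> (real \<Rightarrow> complex) \<Rightarrow> (real \<Rightarrow> complex)) \<Rightarrow> bool" where
  "unitary_group_generated_by H U \<longleftrightarrow>
     (\<forall>t. \<forall>f\<in>L2. U t f \<in> L2 \<and> l2_norm_sq (U t f) = l2_norm_sq f) \<and>
     (\<forall>t. \<forall>f\<in>L2. \<forall>g\<in>L2. \<forall>a b. AE x in lebesgue.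
        U t (\<lambda>y. a * f y + b * g y) x = a * U t f x + b * U t g x) \<and>
     (\<forall>f\<in>L2. AE x in lebesgue. U 0 f x = f x) \<and>
     (\<forall>s t. \<forall>f\<in>L2. AE x in lebesgue. U (s + t) f x = U s (U t f) x) \<and>
     (\<forall>f\<in>L2. ((\<lambda>t. l2_norm_sq (\<lambda>x. U t f x - f x)) \<longlongrightarrow> 0) (at 0)) \<and>
     (\<forall>\<phi>\<in>L2. \<forall>\<psi>\<in>L2. H \<phi> \<psi> \<longleftrightarrow>
        ((\<lambda>t. l2_norm_sq (\<lambda>x. (U t \<phi> x - \<phi> x) / complex_of_real t + \<i> * \<psi> x)) \<longlongrightarrow> 0) (at 0))"

text \<open>\<open>evolution V t f\<close> is \<open>exp (- i t H) f\<close>. By Stone's theorem, for selfadjoint \<open>H\<close> such a group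
  exists and it is unique up to equality almost everywhere, so the choice of representatives
  is immaterial.\<close>

definition evolution ::
  "(real \<Rightarrow> real) \<Rightarrow> real \<Rightarrow> (real \<Rightarrow> complex) \<Rightarrow> (real \<Rightarrow> complex)" where
  "evolution V = (SOME U. unitary_group_generated_by (schroedinger_op V) U)"

definition time_averaged_moment ::
  "(real \<Rightarrow> real) \<Rightarrow> (real \<Rightarrow> complex) \<Rightarrow> real \<Rightarrow> real \<Rightarrow> ennreal" where
  "time_averaged_moment V f T p =
     ennreal (2 / T) *
     (\<integral>\<^sup>+ t\<in>{0..}. ennreal (exp (- 2 * t / T)) *
        l2_norm_sq (\<lambda>x. complex_of_real (\<bar>x\<bar> powr (p / 2)) * evolution V t f x) \<partial>lebesgue)"

definition solution :: "(real \<Rightarrow> real) \<Rightarrow> complex \<Rightarrow> (real \<Rightarrow> complex) \<Rightarrow> bool" where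
  "solution V z u \<longleftrightarrow> schroedinger_eq V u (\<lambda>x. z * u x)"

definition cauchy_data :: "(real \<Rightarrow> complex) \<Rightarrow> real \<Rightarrow> complex ^ 2" where
  "cauchy_data u x = vector [u x, vector_derivative u (at x)]"

definition transfer_matrix ::
  "(real \<Rightarrow> real) \<Rightarrow> real \<Rightarrow> real \<Rightarrow> complex \<Rightarrow> complex ^ 2 ^ 2" where
  "transfer_matrix V x y z =
     (THE M. \<forall>u. solution V z u \<longrightarrow> M *v cauchy_data u y = cauchy_data u x)"

text \<open>The norm of a transfer matrix is the operator norm for the Euclidean norm of the plane
  (the type class norm of a matrix would be the Hilbert-Schmidt norm).\<close>

definition P_set :: "(real \<Rightarrow> real) \<Rightarrow> real \<Rightarrow> real \<Rightarrow> real \<Rightarrow> real set" where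
  "P_set V \<alpha> C N =
     {E. \<forall>x\<in>{-N..N}. \<forall>y\<in>{-N..N}.
        onorm ((*v) (transfer_matrix V x y (complex_of_real E))) \<le> C * N powr \<alpha>}"

text \<open>The diameter with values in \<open>[0, \<infinity>]\<close>; unlike the real-valued \<open>diameter\<close> it is meaningful for
  unbounded sets.\<close>

definition ediameter :: "real set \<Rightarrow> ennreal" where
  "ediameter S = (SUP x\<in>S. SUP y\<in>S. ennreal (dist x y))"

definition neighborhood :: "real \<Rightarrow> real set \<Rightarrow> real set" where
  "neighborhood r S = (\<Union>a\<in>S. ball a r)"

end

theory Submission
  imports Defs
begin

text \<open>For \<open>z = E + i/T\<close> the resolvent is \<open>i \<integral>\<^sub>0\<^sup>\<infinity> e\<^bsup>izt\<^esup> e\<^bsup>-itH\<^esup> f dt\<close>, so a Bessel inequality bounds the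
  time average of \<open>e\<^bsup>-itH\<^esup> f\<close> on a region \<open>S\<close> from below by the integral over \<open>E \<in> B(T)\<close> of the mass on \<open>S\<close> of
  \<open>u = (H - z)\<^sup>-\<^sup>1 f\<close>. Green's formula with the solution at \<open>E\<^sub>0\<close> that is not orthogonal to \<open>f\<close> shows that the
  Cauchy data of \<open>u\<close> at one end of the support of \<open>f\<close> stay away from \<open>0\<close>. With \<open>N = T\<^bsup>1/(1+\<alpha>)\<^esup>\<close> and a
  small \<open>\<kappa>\<close>, the distance \<open>2/T\<close> from \<open>z\<close> to \<open>A(N)\<close> is a harmless perturbation up to \<open>\<bar>x\<bar> \<le> \<kappa>N\<close>, so these data
  decay at most like \<open>N\<^bsup>-\<alpha>\<^esup>\<close> and the mass of \<open>u\<close> on \<open>\<kappa>N/2 \<le> \<bar>x\<bar> \<le> \<kappa>N\<close> is at least a constant times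
  \<open>N\<^bsup>1-2\<alpha>\<^esup>\<close>. Since \<open>evolution\<close> is given by a choice operator, the self-adjointness of \<open>H\<close> and Stone's
  theorem are part of the proof; the group is the limit of the groups of the Yosida approximations.\<close>



subsection \<open>The algebra of bounded operators\<close>

text \<open>The exponent comes from a balance. Comparing \<open>z\<close> with an energy of A(N)
  over a length \<kappa>N costs a relative error of order N^\<alpha> * (1/T) * N, which stays
  bounded exactly when N^(1+\<alpha>) is at most of order T. The factor 1/T of the time average, the
  weight N^p on the shell and the mass N^(1-2\<alpha>) then multiply to N^(p-3\<alpha>) =
  T^((p-3\<alpha>)/(1+\<alpha>)).

  Non-orthogonality to f is known at E0 only. It reaches all energies of B(T) because Green's
  formula on the fixed support of f tolerates a small fixed change of energy, and diam A(N) tends to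
  0. So all energies lie in one window of length 2 pi.

  V is merely integrable on unit intervals, so u'' has no pointwise or L2 bound. Wherever mass and
  Cauchy data have to be compared (boundary terms at infinity, compactness of the Dirichlet data,
  mass on the shell), it is done by one estimate that involves only the L1 norm of V on a unit
  interval.\<close>

typedef (overloaded) 'a endo = "UNIV :: ('a::real_normed_vector \<Rightarrow>\<^sub>L 'a) set"
  morphisms blinfun_of_endo Endo ..

setup_lifting type_definition_endo

instantiation endo :: (real_normed_vector) real_normed_vector
begin
lift_definition norm_endo :: "'a endo \<Rightarrow> real" is norm .
lift_definition minus_endo :: "'a endo \<Rightarrow> 'a endo \<Rightarrow> 'a endo" is "(-)" .
lift_definition plus_endo :: "'a endo \<Rightarrow> 'a endo \<Rightarrow> 'a endo" is "(+)" .
lift_definition uminus_endo :: "'a endo \<Rightarrow> 'a endo" is uminus .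
lift_definition zero_endo :: "'a endo" is 0 .
lift_definition scaleR_endo :: "real \<Rightarrow> 'a endo \<Rightarrow> 'a endo" is "(*\<^sub>R)" .
definition dist_endo :: "'a endo \<Rightarrow> 'a endo \<Rightarrow> real" where "dist_endo a b = norm (a - b)"
definition sgn_endo :: "'a endo \<Rightarrow> 'a endo" where "sgn_endo x = scaleR (inverse (norm x)) x"
definition [code del]:
  "(uniformity :: ('a endo \<times> 'a endo) filter) = (INF e\<in>{0 <..}. principal {(x, y). dist x y < e})"
definition open_endo :: "'a endo set \<Rightarrow> bool" where
  [code del]: "open_endo S = (\<forall>x\<in>S. \<forall>\<^sub>F (x', y) in uniformity. x' = x \<longrightarrow> y \<in> S)"
instance
  by standard (unfold dist_endo_def sgn_endo_def open_endo_def uniformity_endo_def,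
      (transfer; simp add: algebra_simps norm_triangle_ineq)+)
end

text \<open>Composition as product turns bounded operators into a normed algebra, so that the power
  series \<open>exp\<close> and its calculus apply to bounded generators.
  \<open>perfect_space\<close> rules out the zero space, on which 0 = 1.\<close>

instantiation endo :: ("{real_normed_vector, perfect_space}") real_normed_algebra_1
begin
lift_definition times_endo :: "'a endo \<Rightarrow> 'a endo \<Rightarrow> 'a endo" is "(o\<^sub>L)" .
lift_definition one_endo :: "'a endo" is id_blinfun .
instance
proof
  fix a b c :: "'a endo" and r :: real
  show "a * b * c = a * (b * c)" by transfer (simp add: blinfun_eqI)
  show "(a + b) * c = a * c + b * c" by transfer (simp add: blinfun_eqI blinfun.add_left)
  show "a * (b + c) = a * b + a * c"
    by transfer (simp add: blinfun_eqI blinfun.add_left blinfun.add_right)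
  show "r *\<^sub>R a * b = r *\<^sub>R (a * b)" by transfer (simp add: blinfun_eqI blinfun.scaleR_left)
  show "a * r *\<^sub>R b = r *\<^sub>R (a * b)"
    by transfer (simp add: blinfun_eqI blinfun.scaleR_left blinfun.scaleR_right)
  show "1 * a = a" "a * 1 = a" by (transfer, simp add: blinfun_eqI)+
  show "(0 :: 'a endo) \<noteq> 1"
    by transfer (metis norm_blinfun_id norm_zero zero_neq_one)
  show "norm (a * b) \<le> norm a * norm b" by transfer (rule norm_blinfun_compose)
  show "norm (1 :: 'a endo) = 1" by transfer (rule norm_blinfun_id)
qed
end

instance endo :: (banach) banach
proof
  fix X :: "nat \<Rightarrow> 'a endo" assume "Cauchy X"
  then have "Cauchy (\<lambda>n. blinfun_of_endo (X n))"
    unfolding Cauchy_def dist_norm by transfer (simp add: dist_norm)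
  then obtain L where "(\<lambda>n. blinfun_of_endo (X n)) \<longlonglongrightarrow> L"
    using Cauchy_convergent_iff convergent_def by blast
  then have "X \<longlonglongrightarrow> Endo L"
    unfolding tendsto_iff dist_norm
    by (simp add: norm_endo.rep_eq minus_endo.rep_eq Endo_inverse)
  then show "convergent X" by (auto simp: convergent_def)
qed

definition endo_apply :: "'a::real_normed_vector endo \<Rightarrow> 'a \<Rightarrow> 'a" where
  "endo_apply a = blinfun_apply (blinfun_of_endo a)"

lemma bounded_bilinear_endo_apply: "bounded_bilinear endo_apply"
proof
  show "\<exists>K. \<forall>a b. norm (endo_apply a b) \<le> norm a * norm b * K"
    by (rule exI[of _ 1]) (simp add: endo_apply_def norm_endo.rep_eq norm_blinfun)
qed (simp_all add: endo_apply_def plus_endo.rep_eq scaleR_endo.rep_eq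
      blinfun.add_left blinfun.add_right blinfun.scaleR_left blinfun.scaleR_right)

interpretation endo_apply: bounded_bilinear endo_apply
  by (rule bounded_bilinear_endo_apply)

lemma endo_apply_times [simp]: "endo_apply (a * b) x = endo_apply a (endo_apply b x)"
  by (simp add: endo_apply_def times_endo.rep_eq)

lemma endo_apply_one [simp]: "endo_apply 1 x = x"
  by (simp add: endo_apply_def one_endo.rep_eq)

lemma endo_eqI: "(\<And>x. endo_apply a x = endo_apply b x) \<Longrightarrow> a = b"
  by (metis blinfun_eqI blinfun_of_endo_inverse endo_apply_def)

definition endo_of :: "('a::real_normed_vector \<Rightarrow> 'a) \<Rightarrow> 'a endo" where
  "endo_of f = Endo (Blinfun f)"

lemma endo_apply_endo_of: "bounded_linear f \<Longrightarrow> endo_apply (endo_of f) = f"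
  by (simp add: endo_apply_def endo_of_def Endo_inverse bounded_linear_Blinfun_apply)

lemma exp_commute_endo:
  fixes a b :: "'a::{banach, perfect_space} endo"
  assumes "a * b = b * a"
  shows "a * exp b = exp b * a"
proof -
  have pow: "a * b ^ n = b ^ n * a" for n
    by (induction n) (simp_all add: mult.assoc, metis assms mult.assoc)
  have "a * exp b = (\<Sum>n. a * (b ^ n /\<^sub>R fact n))"
    unfolding exp_def by (rule suminf_mult[symmetric]) (rule summable_exp_generic)
  also have "\<dots> = (\<Sum>n. (b ^ n /\<^sub>R fact n) * a)"
    by (simp add: pow)
  also have "\<dots> = exp b * a"
    unfolding exp_def by (rule suminf_mult2[symmetric]) (rule summable_exp_generic)
  finally show ?thesis .
qed

lemma exp_endo_apply_has_vector_derivative: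
  fixes a :: "'a::{banach, perfect_space} endo"
  shows "((\<lambda>t. endo_apply (exp (t *\<^sub>R a)) x) has_vector_derivative
           endo_apply (exp (t *\<^sub>R a)) (endo_apply a x)) (at t within S)"
  using bounded_linear.has_vector_derivative[OF endo_apply.bounded_linear_left
      exp_scaleR_has_vector_derivative_right]
  by fastforce

text \<open>The squared norm of the orbit \<open>w\<close> has derivative
  \<open>2 * inner (endo_apply a (w t)) (w t)\<close>, which is zero.\<close>

lemma exp_skew_isometry:
  fixes a :: "'a::{real_inner, banach, perfect_space} endo"
  assumes skew: "\<And>x. inner (endo_apply a x) x = 0"
  shows "norm (endo_apply (exp (t *\<^sub>R a)) x) = norm x"
proof -
  define w where "w t = endo_apply (exp (t *\<^sub>R a)) x" for t
  have comm: "endo_apply (exp (t *\<^sub>R a)) (endo_apply a x) = endo_apply a (w t)" for t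
    unfolding w_def by (simp add: exp_times_scaleR_commute flip: endo_apply_times)
  have "((\<lambda>t. inner (w t) (w t)) has_real_derivative 0) (at t)" for t
  proof -
    have w': "(w has_vector_derivative endo_apply a (w t)) (at t)"
      using exp_endo_apply_has_vector_derivative[of a x t UNIV] by (simp add: comm w_def[abs_def])
    have "((\<lambda>t. inner (w t) (w t)) has_vector_derivative
        inner (w t) (endo_apply a (w t)) + inner (endo_apply a (w t)) (w t)) (at t)"
      by (rule bounded_bilinear.has_vector_derivative[OF bounded_bilinear_inner w' w'])
    then show ?thesis
      by (simp add: skew inner_commute[of "w t" "endo_apply a (w t)"] has_real_derivative_iff_has_vector_derivative)
  qed
  then have "inner (w t) (w t) = inner (w 0) (w 0)"
    using DERIV_isconst_all by blast
  then show ?thesis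
    by (simp add: w_def norm_eq_sqrt_inner)
qed

lemma norm_add_diff_le:
  fixes a b c :: "'a::real_normed_vector"
  shows "norm (a + b - c) \<le> norm a + norm b + norm c"
  using norm_triangle_ineq4[of "a + b" c] norm_triangle_ineq[of a b] by linarith

lemma divide_add_one_mult_le:
  fixes a k :: real
  shows "0 \<le> a \<Longrightarrow> 0 \<le> k \<Longrightarrow> a / (k + 1) * k \<le> a"
  by (simp add: divide_le_eq mult_left_mono)

subsection \<open>Orthogonal complements\<close>

text \<open>Nearest-point projection: a minimizing sequence for the distance from \<open>g\<close>
  converges by the parallelogram law, and \<open>g\<close> minus its limit is orthogonal to
  \<open>M\<close>. \<open>M\<close> is just a subspace because it will be the domain of an
  unbounded operator; the limit lies in its closure.\<close>

lemma exists_orthogonal_vector: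
  fixes M :: "'a::{real_inner, complete_space} set"
  assumes sub: "subspace M" and g: "g \<notin> closure M"
  shows "\<exists>h. h \<noteq> 0 \<and> (\<forall>m\<in>M. inner h m = 0)"
proof -
  have ne: "M \<noteq> {}" using subspace_0[OF sub] by auto
  define d where "d = infdist g M"
  have d: "d \<le> dist g m" if "m \<in> M" for m
    using infdist_le[OF that] by (simp add: d_def)
  have "0 \<le> d" by (simp add: d_def infdist_nonneg)
  have "\<exists>m\<in>M. dist g m < d + 1 / real (Suc n)" for n
  proof (rule ccontr)
    assume "\<not> ?thesis"
    then have "d + 1 / real (Suc n) \<le> infdist g M"
      unfolding infdist_notempty[OF ne] by (intro cINF_greatest[OF ne]) (auto simp: not_less)
    then have "1 / real (Suc n) \<le> 0" by (simp add: d_def)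
    then show False by simp
  qed
  then obtain m where mM: "\<And>n. m n \<in> M" and md: "\<And>n. dist g (m n) < d + 1 / real (Suc n)"
    by metis
  \<comment> \<open>Parallelogram law: the midpoint of \<open>m i\<close> and \<open>m j\<close>
    lies in \<open>M\<close>, so it is at distance at least \<open>d\<close> from \<open>g\<close>,
    while both points are within \<open>d + e\<close>.\<close>
  have par: "(norm (m i - m j))\<^sup>2 \<le> (2 * d + 1) * 4 / real (Suc N)" if "i \<ge> N" "j \<ge> N" for i j N
  proof -
    define e where "e = 1 / real (Suc N)"
    have e: "0 < e" "e \<le> 1" by (auto simp: e_def)
    have "norm (g - m i) \<le> d + e" "norm (g - m j) \<le> d + e"
    proof -
      have "1 / real (Suc k) \<le> e" if "k \<ge> N" for k
        unfolding e_def using that by (intro divide_left_mono) auto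
      then show "norm (g - m i) \<le> d + e" "norm (g - m j) \<le> d + e"
        using md[of i] md[of j] that unfolding dist_norm by (smt (verit, best))+
    qed
    moreover have mid: "(1/2) *\<^sub>R (m i + m j) \<in> M"
      by (intro subspace_scale subspace_add sub mM)
    have "norm (g - (1/2) *\<^sub>R (m i + m j)) \<ge> d"
      using d[OF mid] by (simp add: dist_norm)
    moreover have "(norm (m i - m j))\<^sup>2 = 2 * (norm (g - m i))\<^sup>2 + 2 * (norm (g - m j))\<^sup>2
        - 4 * (norm (g - (1/2) *\<^sub>R (m i + m j)))\<^sup>2"
      by (simp add: power2_norm_eq_inner inner_diff_left inner_diff_right inner_add_left
          inner_add_right inner_commute algebra_simps)
    moreover have "(norm (g - m i))\<^sup>2 \<le> (d + e)\<^sup>2" "(norm (g - m j))\<^sup>2 \<le> (d + e)\<^sup>2"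
      using calculation by (auto intro!: power_mono)
    moreover have "d\<^sup>2 \<le> (norm (g - (1/2) *\<^sub>R (m i + m j)))\<^sup>2"
      using calculation \<open>0 \<le> d\<close> by (auto intro!: power_mono)
    ultimately have "(norm (m i - m j))\<^sup>2 \<le> 4 * (d + e)\<^sup>2 - 4 * d\<^sup>2" by linarith
    also have "\<dots> = (2 * d + e) * 4 * e" by (simp add: power2_eq_square algebra_simps)
    also have "\<dots> \<le> (2 * d + 1) * 4 * e" using e by (intro mult_right_mono) auto
    finally show ?thesis by (simp add: e_def)
  qed
  have "Cauchy m"
  proof (rule metric_CauchyI)
    fix r :: real assume r: "0 < r"
    obtain N :: nat where N: "(2 * d + 1) * 4 / r\<^sup>2 < real N" using reals_Archimedean2 by blast
    have "dist (m i) (m j) < r" if "i \<ge> N" "j \<ge> N" for i j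
    proof -
      have "(2 * d + 1) * 4 / real (Suc N) < r\<^sup>2"
        using N r by (simp add: field_simps) (smt (verit) mult_nonneg_nonneg zero_le_power2)
      then have "(norm (m i - m j))\<^sup>2 < r\<^sup>2" using par[OF that] by linarith
      then show ?thesis using r power_less_imp_less_base by (force simp: dist_norm)
    qed
    then show "\<exists>N. \<forall>i\<ge>N. \<forall>j\<ge>N. dist (m i) (m j) < r" by blast
  qed
  then obtain l where l: "m \<longlonglongrightarrow> l" using Cauchy_convergent_iff convergent_def by blast
  have "l \<in> closure M" unfolding closure_sequential using l mM by blast
  define h where "h = g - l"
  have h0: "h \<noteq> 0" using g \<open>l \<in> closure M\<close> by (auto simp: h_def)
  have nh: "norm h \<le> d"
  proof -
    have "(\<lambda>n. dist g (m n)) \<longlonglongrightarrow> dist g l" by (intro tendsto_intros l)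
    moreover have "(\<lambda>n. d + 1 / real (Suc n)) \<longlonglongrightarrow> d + 0"
      using LIMSEQ_inverse_real_of_nat by (intro tendsto_intros) (simp add: inverse_eq_divide)
    ultimately have "dist g l \<le> d + 0"
      by (rule LIMSEQ_le) (use md in \<open>auto intro!: exI[of _ 0] less_imp_le\<close>)
    then show ?thesis by (simp add: h_def dist_norm)
  qed
  have "inner h v = 0" if v: "v \<in> M" for v
  proof (rule ccontr)
    assume nz: "inner h v \<noteq> 0"
    then have v0: "norm v > 0" by auto
    have ge: "d \<le> norm (h - t *\<^sub>R v)" for t
    proof (rule LIMSEQ_le_const)
      show "(\<lambda>n. norm (g - (m n + t *\<^sub>R v))) \<longlonglongrightarrow> norm (h - t *\<^sub>R v)"
        unfolding h_def by (rule tendsto_eq_intros l refl | simp add: algebra_simps)+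
      show "\<exists>N. \<forall>n\<ge>N. d \<le> norm (g - (m n + t *\<^sub>R v))"
        using d subspace_add[OF sub mM subspace_scale[OF sub v]] by (metis dist_norm)
    qed
    \<comment> \<open>The coefficient of the projection of \<open>h\<close> on \<open>v\<close>,
      which minimizes \<open>norm (h - t *\<^sub>R v)\<close>.\<close>
    define t where "t = inner h v / (norm v)\<^sup>2"
    have "d\<^sup>2 \<le> (norm (h - t *\<^sub>R v))\<^sup>2" using ge \<open>0 \<le> d\<close> by (intro power_mono) auto
    also have "\<dots> = (norm h)\<^sup>2 - 2 * t * inner h v + t\<^sup>2 * (norm v)\<^sup>2"
      unfolding power2_norm_eq_inner
      by (simp add: inner_diff_left inner_diff_right inner_commute power2_eq_square algebra_simps)
    also have "\<dots> = (norm h)\<^sup>2 - (inner h v)\<^sup>2 / (norm v)\<^sup>2"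
      using v0 by (simp add: t_def power2_eq_square)
    also have "\<dots> < (norm h)\<^sup>2" using nz v0 by simp
    also have "\<dots> \<le> d\<^sup>2" using nh by (intro power_mono) auto
    finally show False by simp
  qed
  then show ?thesis using h0 by blast
qed

subsection \<open>Skew-adjoint operators generate orthogonal groups\<close>

text \<open>An operator is given by its graph. A real Hilbert space suffices: for a complex one, the real
  part of the inner product is used, and multiplication by \<open>\<i>\<close> is an operator commuting with \<open>D\<close>.\<close>

locale skew_adjoint =
  fixes D :: "'a::{real_inner, banach, perfect_space} \<Rightarrow> 'a \<Rightarrow> bool"
  assumes D_add: "D x x' \<Longrightarrow> D y y' \<Longrightarrow> D (x + y) (x' + y')"
    and D_scale: "D x x' \<Longrightarrow> D (c *\<^sub>R x) (c *\<^sub>R x')"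
    and skew: "D x x' \<Longrightarrow> inner x' x = 0"
    and single: "D 0 y \<Longrightarrow> y = 0"
    and surj: "c \<noteq> 0 \<Longrightarrow> \<exists>x x'. D x x' \<and> x - c *\<^sub>R x' = g"
begin

section \<open>Polarization and density of the domain\<close>

lemma D_diff: "D x x' \<Longrightarrow> D y y' \<Longrightarrow> D (x - y) (x' - y')"
  using D_add[of x x' "(-1) *\<^sub>R y" "(-1) *\<^sub>R y'"] D_scale[of y y' "-1"] by simp

lemma skew2: "D x x' \<Longrightarrow> D y y' \<Longrightarrow> inner x' y = - inner x y'"
  using skew[of "x + y" "x' + y'"] skew[of x x'] skew[of y y'] D_add[of x x' y y']
  by (simp add: inner_add_left inner_add_right inner_commute)

lemma subspace_domain: "subspace {x. \<exists>x'. D x x'}"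
proof (rule subspaceI)
  obtain x x' where "D x x'" using surj[of 1 0] by auto
  from D_scale[OF this, of 0] show "0 \<in> {x. \<exists>x'. D x x'}" by auto
qed (use D_add D_scale in blast)+

text \<open>Write a vector \<open>h\<close> orthogonal to the domain as \<open>x - x'\<close> with
  \<open>D x x'\<close>. Pairing with \<open>x\<close> gives \<open>x = 0\<close>, because both
  \<open>h\<close> and \<open>x'\<close> are orthogonal to \<open>x\<close>; then
  \<open>x' = 0\<close> by single-valuedness. Density thus follows from the range condition
  \<open>surj\<close>.\<close>

lemma dense_domain: "closure {x. \<exists>x'. D x x'} = UNIV"
proof (rule ccontr)
  assume "closure {x. \<exists>x'. D x x'} \<noteq> UNIV"
  then obtain g where "g \<notin> closure {x. \<exists>x'. D x x'}" by blast
  from exists_orthogonal_vector[OF subspace_domain this]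
  obtain h where h: "h \<noteq> 0" "\<And>m m'. D m m' \<Longrightarrow> inner h m = 0" by blast
  obtain x x' where x: "D x x'" "x - 1 *\<^sub>R x' = h" using surj[of 1 h] by auto
  have "inner x x = inner h x + inner x' x"
    unfolding x(2)[symmetric] by (simp add: inner_diff_left)
  then have "x = 0" using h(2)[OF x(1)] skew[OF x(1)] by simp
  then have "x' = 0" using x(1) single by simp
  then show False using x(2) h(1) \<open>x = 0\<close> by simp
qed

lemma approx_domain:
  assumes "e > 0" shows "\<exists>x x'. D x x' \<and> norm (g - x) < e"
proof -
  have "g \<in> closure {x. \<exists>x'. D x x'}" by (simp add: dense_domain)
  then obtain x where "x \<in> {x. \<exists>x'. D x x'}" "dist x g < e"
    using assms closure_approachable by blast
  then show ?thesis by (auto simp: dist_norm norm_minus_commute)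
qed

section \<open>Resolvents normalized as (1 - c D)^-1, so that they are contractions tending to the
  identity as c tends to 0\<close>

definition resolvent :: "real \<Rightarrow> 'a \<Rightarrow> 'a" where
  "resolvent c g = (SOME x. \<exists>x'. D x x' \<and> x - c *\<^sub>R x' = g)"

lemma resolvent_D: "c \<noteq> 0 \<Longrightarrow> D (resolvent c g) ((resolvent c g - g) /\<^sub>R c)"
proof -
  assume c: "c \<noteq> 0"
  obtain x' where x': "D (resolvent c g) x'" "resolvent c g - c *\<^sub>R x' = g"
    using someI_ex[OF surj[OF c, of g]] unfolding resolvent_def by blast
  have "(resolvent c g - g) /\<^sub>R c = x'" using c by (subst x'(2)[symmetric]) simp
  then show ?thesis using x' by simp
qed

text \<open>Pairing \<open>x - c *\<^sub>R x'\<close> with \<open>x\<close> leaves the square of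
  \<open>norm x\<close>. This yields both injectivity of 1 - c D and the contraction bound.\<close>

lemma norm_le_of_range: "D x x' \<Longrightarrow> norm x \<le> norm (x - c *\<^sub>R x')"
proof -
  assume x: "D x x'"
  have "norm x * norm x = inner (x - c *\<^sub>R x') x"
    using skew[OF x] by (simp add: inner_diff_left norm_eq_sqrt_inner)
  also have "\<dots> \<le> norm (x - c *\<^sub>R x') * norm x"
    by (rule norm_cauchy_schwarz)
  finally show ?thesis by (cases "norm x = 0") (auto simp: mult_le_cancel_right)
qed

lemma resolvent_eqI: "c \<noteq> 0 \<Longrightarrow> D x x' \<Longrightarrow> x - c *\<^sub>R x' = g \<Longrightarrow> resolvent c g = x"
proof -
  assume c: "c \<noteq> 0" and x: "D x x'" "x - c *\<^sub>R x' = g"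
  have "norm (resolvent c g - x)
      \<le> norm ((resolvent c g - x) - c *\<^sub>R ((resolvent c g - g) /\<^sub>R c - x'))"
    by (intro norm_le_of_range D_diff resolvent_D x c)
  also have "(resolvent c g - x) - c *\<^sub>R ((resolvent c g - g) /\<^sub>R c - x') = 0"
    using c x(2) by (simp add: scaleR_diff_right algebra_simps)
  finally show ?thesis by simp
qed

lemma norm_resolvent_le: "c \<noteq> 0 \<Longrightarrow> norm (resolvent c g) \<le> norm g"
  using norm_le_of_range[OF resolvent_D, of c g c] by simp

lemma bounded_linear_resolvent: "c \<noteq> 0 \<Longrightarrow> bounded_linear (resolvent c)"
proof (rule bounded_linear_intro[where K = 1])
  assume c: "c \<noteq> 0"
  fix x y and r :: real
  show "resolvent c (x + y) = resolvent c x + resolvent c y"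
    by (rule resolvent_eqI[OF c D_add[OF resolvent_D[OF c, of x] resolvent_D[OF c, of y]]])
      (use c in \<open>simp add: scaleR_diff_right scaleR_add_right\<close>)
  show "resolvent c (r *\<^sub>R x) = r *\<^sub>R resolvent c x"
    by (rule resolvent_eqI[OF c D_scale[OF resolvent_D[OF c, of x], of r]])
      (use c in \<open>simp add: scaleR_diff_right mult.left_commute[of c]\<close>)
  show "norm (resolvent c x) \<le> norm x * 1" using norm_resolvent_le[OF c] by simp
qed

lemma resolvent_commute_D:
  assumes c: "c \<noteq> 0" and x: "D x x'"
  shows "D (resolvent c x) (resolvent c x')"
proof -
  let ?y = "(resolvent c x - x) /\<^sub>R c"
  have "D ?y (((resolvent c x - x) /\<^sub>R c - x') /\<^sub>R c)"
    by (intro D_scale D_diff resolvent_D c x)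
  then have "resolvent c x' = ?y"
    by (rule resolvent_eqI[OF c]) (use c in simp)
  then show ?thesis using resolvent_D[OF c, of x] by simp
qed

lemma resolvent_commute:
  assumes "c \<noteq> 0" "d \<noteq> 0"
  shows "resolvent c (resolvent d g) = resolvent d (resolvent c g)"
proof -
  interpret bounded_linear "resolvent c" by (rule bounded_linear_resolvent) fact
  show ?thesis
    by (rule resolvent_eqI[OF assms(2) resolvent_commute_D[OF assms(1) resolvent_D[OF assms(2)]],
          symmetric])
      (use assms in \<open>simp add: diff scaleR\<close>)
qed

text \<open>Skewness of \<open>D\<close> turns \<open>c\<close> into \<open>- c\<close> under the
  adjoint; this is what makes the difference of resolvents in \<open>yosida\<close> exactly
  skew.\<close>

lemma inner_resolvent:
  assumes c: "c \<noteq> 0" shows "inner (resolvent c f) g = inner f (resolvent (- c) g)"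
proof -
  let ?x = "resolvent c f" and ?y = "resolvent (- c) g"
  have sk: "inner ((?x - f) /\<^sub>R c) ?y = - inner ?x ((?y - g) /\<^sub>R (- c))"
    by (rule skew2[OF resolvent_D resolvent_D]) (use c in auto)
  have "inner (?x - f) ?y = inner ?x (?y - g)"
    using sk c unfolding inner_scaleR_left inner_scaleR_right by (simp add: field_simps)
  then show ?thesis by (simp add: inner_diff_left inner_diff_right)
qed

text \<open>On the domain \<open>resolvent c x - x\<close> equals \<open>c\<close> times a resolvent
  of \<open>x'\<close>, hence is of order \<open>c\<close>. Density and the contraction bound extend
  the convergence to all \<open>g\<close>.\<close>

lemma resolvent_tendsto: "(\<lambda>n. resolvent (s / real (Suc n)) g) \<longlonglongrightarrow> g" if s: "s \<noteq> 0"
proof (rule LIMSEQ_I)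
  fix e :: real assume e: "e > 0"
  then obtain x x' where x: "D x x'" "norm (g - x) < e / 3" using approx_domain[of "e/3" g] by auto
  obtain N :: nat where N: "\<bar>s\<bar> * norm x' / (e / 3) < real N" using reals_Archimedean2 by blast
  have "norm (resolvent (s / real (Suc n)) g - g) < e" if n: "n \<ge> N" for n
  proof -
    define c where "c = s / real (Suc n)"
    have c: "c \<noteq> 0" using s by (simp add: c_def)
    interpret bounded_linear "resolvent c" by (rule bounded_linear_resolvent) fact
    have "D (resolvent c x) (resolvent c x')" using resolvent_commute_D c x(1) by blast
    have "(resolvent c x - x) /\<^sub>R c = resolvent c x'"
      using resolvent_D[OF c, of x] resolvent_commute_D[OF c x(1)] single
        D_diff[of "resolvent c x" _ "resolvent c x"] by (metis eq_iff_diff_eq_0)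
    then have "resolvent c x - x = c *\<^sub>R resolvent c x'" using c by (metis divideR_right)
    then have 1: "norm (resolvent c x - x) \<le> \<bar>c\<bar> * norm x'"
      using norm_resolvent_le[OF c, of x'] by (simp add: mult_left_mono)
    have "\<bar>s\<bar> * norm x' < real N * (e / 3)" using N e by (simp add: field_simps)
    also have "\<dots> \<le> real (Suc n) * (e / 3)" using n e by (intro mult_right_mono) auto
    finally have 2: "\<bar>c\<bar> * norm x' < e / 3" by (simp add: c_def field_simps)
    have "resolvent c g - g = resolvent c (g - x) + (resolvent c x - x) - (g - x)" by (simp add: diff)
    then have "norm (resolvent c g - g) \<le> norm (resolvent c (g - x)) + norm (resolvent c x - x) + norm (g - x)"
      by (metis norm_add_diff_le)
    then show ?thesis
      using 1 2 x(2) norm_resolvent_le[OF c, of "g - x"] unfolding c_def[symmetric] by linarith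
  qed
  then show "\<exists>N. \<forall>n\<ge>N. norm (resolvent (s / real (Suc n)) g - g) < e" by blast
qed

text \<open>The bounded skew operator \<open>A (1 - A\<^sup>2/n\<^sup>2)\<^sup>-\<^sup>1\<close> approximating the generator \<open>A\<close>.\<close>

definition yosida :: "nat \<Rightarrow> 'a endo" where
  "yosida n = (real (Suc n) / 2) *\<^sub>R
     (endo_of (resolvent (1 / real (Suc n))) - endo_of (resolvent (-1 / real (Suc n))))"

text \<open>Partial fractions: with k = Suc n, A (1 - A^2/k^2)^-1 = (k/2) ((1 - A/k)^-1 - (1 +
  A/k)^-1). The symmetric form keeps the approximation skew, so its group is isometric for both
  signs of time.\<close>

lemma yosida_apply: "endo_apply (yosida n) g =
    (real (Suc n) / 2) *\<^sub>R (resolvent (1 / real (Suc n)) g - resolvent (-1 / real (Suc n)) g)"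
  unfolding yosida_def
  by (simp add: endo_apply.scaleR_left endo_apply.diff_left endo_apply_endo_of
      bounded_linear_resolvent del: of_nat_Suc)

lemma yosida_skew: "inner (endo_apply (yosida n) g) g = 0"
  using inner_resolvent[of "1 / real (Suc n)" g g]
  by (simp add: yosida_apply inner_diff_left inner_diff_right inner_commute del: of_nat_Suc)

lemma endo_of_commute:
  assumes "bounded_linear f" "bounded_linear g" "\<And>x. f (g x) = g (f x)"
  shows "endo_of f * endo_of g = endo_of g * endo_of f"
  by (rule endo_eqI) (simp add: endo_apply_endo_of assms)

lemma yosida_commute: "yosida m * yosida n = yosida n * yosida m"
proof -
  have "endo_of (resolvent c) * endo_of (resolvent d) = endo_of (resolvent d) * endo_of (resolvent c)"
    if "c \<noteq> 0" "d \<noteq> 0" for c d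
    by (rule endo_of_commute) (auto intro!: bounded_linear_resolvent resolvent_commute that)
  then show ?thesis
    unfolding yosida_def by (simp add: algebra_simps del: of_nat_Suc)
qed

text \<open>On the domain, \<open>resolvent c\<close> differs from the identity by \<open>c\<close>
  times the resolvent of \<open>x'\<close>, so the large factor \<open>Suc n\<close> cancels.
  Convergence to \<open>x'\<close> and the bound by \<open>norm x'\<close> can be read off from the
  resulting average.\<close>

lemma yosida_D:
  assumes "D x x'"
  shows "endo_apply (yosida n) x =
    (1/2) *\<^sub>R (resolvent (1 / real (Suc n)) x' + resolvent (-1 / real (Suc n)) x')"
proof -
  have eq: "resolvent c x = x + c *\<^sub>R resolvent c x'" if c: "c \<noteq> 0" for c
  proof -
    have "(resolvent c x - x) /\<^sub>R c = resolvent c x'"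
      using resolvent_D[OF c, of x] resolvent_commute_D[OF c assms] single
        D_diff[of "resolvent c x" _ "resolvent c x"] by (metis eq_iff_diff_eq_0)
    then show ?thesis using c by (metis divideR_right add.commute diff_add_cancel)
  qed
  show ?thesis
    unfolding yosida_apply using eq[of "1 / real (Suc n)"] eq[of "-1 / real (Suc n)"]
    by (simp add: scaleR_add_right scaleR_diff_right del: of_nat_Suc)
qed

lemma yosida_tendsto: "D x x' \<Longrightarrow> (\<lambda>n. endo_apply (yosida n) x) \<longlonglongrightarrow> x'"
proof -
  assume "D x x'"
  have "(\<lambda>n. (1/2) *\<^sub>R (resolvent (1 / real (Suc n)) x' + resolvent (-1 / real (Suc n)) x'))
      \<longlonglongrightarrow> (1/2) *\<^sub>R (x' + x')"
    by (intro tendsto_intros resolvent_tendsto) auto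
  then show ?thesis using \<open>D x x'\<close> by (simp add: yosida_D flip: scaleR_2)
qed

lemma norm_yosida_le: "D x x' \<Longrightarrow> norm (endo_apply (yosida n) x) \<le> norm x'"
proof -
  assume x: "D x x'"
  have "norm (resolvent (1 / real (Suc n)) x' + resolvent (-1 / real (Suc n)) x') \<le> norm x' + norm x'"
    by (intro norm_triangle_mono norm_resolvent_le) auto
  then show ?thesis by (simp add: yosida_D[OF x])
qed

section \<open>The isometric approximating groups and their limit\<close>

definition approx :: "nat \<Rightarrow> real \<Rightarrow> 'a \<Rightarrow> 'a" where
  "approx n t = endo_apply (exp (t *\<^sub>R yosida n))"

lemma linear_approx: "linear (approx n t)"
  unfolding approx_def by (rule bounded_linear.linear[OF endo_apply.bounded_linear_right])

lemma norm_approx [simp]: "norm (approx n t x) = norm x"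
  unfolding approx_def by (rule exp_skew_isometry) (rule yosida_skew)

lemma approx_0 [simp]: "approx n 0 x = x"
  by (simp add: approx_def)

lemma approx_add: "approx n (s + t) x = approx n s (approx n t x)"
  unfolding approx_def
  by (simp add: scaleR_add_left exp_add_commuting flip: endo_apply_times)

lemma approx_deriv: "((\<lambda>t. approx n t x) has_vector_derivative approx n t (endo_apply (yosida n) x)) (at t within S)"
  unfolding approx_def by (rule exp_endo_apply_has_vector_derivative)

lemma yosida_approx_commute:
  "endo_apply (yosida m) (approx n t x) = approx n t (endo_apply (yosida m) x)"
  unfolding approx_def endo_apply_times[symmetric]
  by (subst exp_commute_endo) (simp_all add: yosida_commute)

text \<open>Interpolate by \<open>v s = approx n (- s) (approx m s x)\<close>. As the bounded
  generators commute, the derivative of \<open>v\<close> is their difference at \<open>x\<close>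
  moved by isometries, so its norm is constant; the mean value inequality does the rest.\<close>

lemma approx_diff_le:
  "norm (approx n t x - approx m t x) \<le> \<bar>t\<bar> * norm (endo_apply (yosida n) x - endo_apply (yosida m) x)"
proof -
  define v where "v s = approx n (- s) (approx m s x)" for s
  have v': "(v has_vector_derivative approx n (-s) (approx m s (endo_apply (yosida m) x - endo_apply (yosida n) x)))
      (at s)" for s
  proof -
    let ?E = "\<lambda>s. exp ((- s) *\<^sub>R yosida n)"
    have "(?E has_vector_derivative (- 1) *\<^sub>R (exp ((- s) *\<^sub>R yosida n) * yosida n)) (at s)"
    proof (rule vector_diff_chain_at[of uminus "-1" s "\<lambda>t. exp (t *\<^sub>R yosida n)", unfolded o_def])
      show "(uminus has_vector_derivative - 1) (at s)"
        by (auto intro!: derivative_eq_intros simp flip: has_real_derivative_iff_has_vector_derivative)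
    qed (rule exp_scaleR_has_vector_derivative_right)
    from bounded_bilinear.has_vector_derivative[OF bounded_bilinear_endo_apply this
        approx_deriv[of m x s UNIV]]
    have "(v has_vector_derivative
        approx n (-s) (approx m s (endo_apply (yosida m) x)) +
        endo_apply ((- 1) *\<^sub>R (exp ((- s) *\<^sub>R yosida n) * yosida n)) (approx m s x)) (at s)"
      unfolding v_def approx_def by simp
    moreover have "endo_apply ((- 1) *\<^sub>R (exp ((- s) *\<^sub>R yosida n) * yosida n)) (approx m s x) =
        - approx n (-s) (approx m s (endo_apply (yosida n) x))"
      by (simp add: endo_apply.minus_left yosida_approx_commute approx_def[of n])
    ultimately show ?thesis
      by (simp add: linear_diff[OF linear_approx])
  qed
  have "norm (v t - v 0) \<le> norm (endo_apply (yosida m) x - endo_apply (yosida n) x) * norm (t - 0)"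
    by (rule differentiable_bound[of UNIV v "\<lambda>s r. r *\<^sub>R approx n (-s) (approx m s (endo_apply (yosida m) x - endo_apply (yosida n) x))"])
      (use v' in \<open>auto simp: has_vector_derivative_def intro!: onorm_le\<close>)
  moreover have "v t - v 0 = approx n (- t) (approx m t x - approx n t x)"
    by (simp add: v_def linear_diff[OF linear_approx] flip: approx_add)
  ultimately show ?thesis by (simp add: norm_minus_commute mult.commute)
qed

text \<open>On the domain the sequence is Cauchy by \<open>approx_diff_le\<close>, since
  \<open>yosida n\<close> converges there; isometry and density carry this to every
  \<open>x\<close>.\<close>

lemma convergent_approx: "convergent (\<lambda>n. approx n t x)"
proof -
  have "Cauchy (\<lambda>n. approx n t x)"
  proof (rule metric_CauchyI)
    fix e :: real assume e: "e > 0"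
    then obtain y y' where y: "D y y'" "norm (x - y) < e / 3" using approx_domain[of "e/3" x] by auto
    have "Cauchy (\<lambda>n. endo_apply (yosida n) y)"
      using yosida_tendsto[OF y(1)] by (rule LIMSEQ_imp_Cauchy)
    then obtain N where N: "\<And>m n. m \<ge> N \<Longrightarrow> n \<ge> N \<Longrightarrow>
        norm (endo_apply (yosida m) y - endo_apply (yosida n) y) < e / 3 / (\<bar>t\<bar> + 1)"
      using e CauchyD[of "\<lambda>n. endo_apply (yosida n) y" "e / 3 / (\<bar>t\<bar> + 1)"] by force
    have "dist (approx m t x) (approx n t x) < e" if "m \<ge> N" "n \<ge> N" for m n
    proof -
      have "norm (approx m t y - approx n t y) \<le> \<bar>t\<bar> * (e / 3 / (\<bar>t\<bar> + 1))"
        using approx_diff_le[of m t y n] N[OF that]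
        by (smt (verit, best) mult_left_mono abs_ge_zero)
      also have "\<dots> = e / 3 / (\<bar>t\<bar> + 1) * \<bar>t\<bar>" by simp
      also have "\<dots> \<le> e  / 3" using e by (intro divide_add_one_mult_le) auto
      finally have 1: "norm (approx m t y - approx n t y) \<le> e / 3" .
      have "approx m t x - approx n t x =
          approx m t (x - y) + (approx m t y - approx n t y) - approx n t (x - y)"
        by (simp add: linear_diff[OF linear_approx])
      then have "norm (approx m t x - approx n t x) \<le>
          norm (x - y) + norm (approx m t y - approx n t y) + norm (x - y)"
        by (metis norm_approx norm_add_diff_le)
      then show ?thesis using 1 y(2) by (simp add: dist_norm)
    qed
    then show "\<exists>N. \<forall>m\<ge>N. \<forall>n\<ge>N. dist (approx m t x) (approx n t x) < e" by blast
  qed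
  then show ?thesis by (simp add: Cauchy_convergent_iff)
qed

definition flow :: "real \<Rightarrow> 'a \<Rightarrow> 'a" where
  "flow t x = lim (\<lambda>n. approx n t x)"

lemma approx_tendsto: "(\<lambda>n. approx n t x) \<longlonglongrightarrow> flow t x"
  using convergent_approx convergent_LIMSEQ_iff flow_def by metis

lemma norm_flow [simp]: "norm (flow t x) = norm x"
  using LIMSEQ_unique[OF tendsto_norm[OF approx_tendsto]] by fastforce

lemma flow_0 [simp]: "flow 0 x = x"
  using LIMSEQ_unique[OF approx_tendsto[of 0 x]] by fastforce

lemma linear_flow: "linear (flow t)"
proof (rule linearI)
  fix x y and c :: real
  have "(\<lambda>n. approx n t x + approx n t y) \<longlonglongrightarrow> flow t x + flow t y"
    by (intro tendsto_add approx_tendsto)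
  then show "flow t (x + y) = flow t x + flow t y"
    using LIMSEQ_unique approx_tendsto[of t "x + y"] by (simp add: linear_add[OF linear_approx])
  have "(\<lambda>n. c *\<^sub>R approx n t x) \<longlonglongrightarrow> c *\<^sub>R flow t x"
    by (intro tendsto_intros approx_tendsto)
  then show "flow t (c *\<^sub>R x) = c *\<^sub>R flow t x"
    using LIMSEQ_unique approx_tendsto[of t "c *\<^sub>R x"] by (simp add: linear_scale[OF linear_approx])
qed

text \<open>In \<open>approx n s (approx n t x)\<close> the inner argument may be replaced by its
  limit, because \<open>approx n s\<close> is an isometry for every \<open>n\<close>.\<close>

lemma flow_add: "flow (s + t) x = flow s (flow t x)"
proof -
  have "(\<lambda>n. approx n s (approx n t x - flow t x)) \<longlonglongrightarrow> 0"
    by (rule tendsto_norm_zero_cancel) (use LIM_zero[OF approx_tendsto[of t x]] in \<open>simp add: tendsto_norm_zero\<close>)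
  from tendsto_add[OF this approx_tendsto[of s "flow t x"]]
  have "(\<lambda>n. approx n (s + t) x) \<longlonglongrightarrow> flow s (flow t x)"
    by (simp add: linear_diff[OF linear_approx] approx_add)
  then show ?thesis using approx_tendsto LIMSEQ_unique by blast
qed

section \<open>Continuity and generator of the limit group\<close>

lemma norm_approx_diff_initial: "D x x' \<Longrightarrow> norm (approx n t x - x) \<le> \<bar>t\<bar> * norm x'"
proof -
  assume x: "D x x'"
  have "norm (approx n t x - approx n 0 x) \<le> norm x' * norm (t - 0)"
  proof (rule differentiable_bound[of UNIV])
    fix s
    show "((\<lambda>t. approx n t x) has_derivative (\<lambda>r. r *\<^sub>R approx n s (endo_apply (yosida n) x))) (at s)"
      using approx_deriv[of n x s UNIV] by (simp add: has_vector_derivative_def)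
    show "onorm (\<lambda>r. r *\<^sub>R approx n s (endo_apply (yosida n) x)) \<le> norm x'"
      using norm_yosida_le[OF x, of n] by (intro onorm_le) (simp add: mult.commute mult_left_mono)
  qed auto
  then show ?thesis by (simp add: mult.commute)
qed

lemma norm_flow_diff_initial: "D x x' \<Longrightarrow> norm (flow t x - x) \<le> \<bar>t\<bar> * norm x'"
  by (rule LIMSEQ_le_const2[OF tendsto_norm[OF tendsto_diff[OF approx_tendsto tendsto_const]]])
    (auto intro: norm_approx_diff_initial)

lemma flow_tendsto_initial: "((\<lambda>t. flow t x) \<longlongrightarrow> x) (at 0)"
proof (rule LIM_I)
  fix e :: real assume e: "e > 0"
  then obtain y y' where y: "D y y'" "norm (x - y) < e / 3" using approx_domain[of "e/3" x] by auto
  have "norm (flow t x - x) < e" if "norm (t - 0) < e / 3 / (norm y' + 1)" for t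
  proof -
    have "\<bar>t\<bar> * norm y' \<le> (e / 3 / (norm y' + 1)) * norm y'"
      using that by (intro mult_right_mono) auto
    also have "\<dots> \<le> e / 3" using e by (intro divide_add_one_mult_le) auto
    finally have 1: "norm (flow t y - y) \<le> e / 3" using norm_flow_diff_initial[OF y(1), of t] by simp
    have "flow t x - x = flow t (x - y) + (flow t y - y) - (x - y)"
      by (simp add: linear_diff[OF linear_flow])
    then have "norm (flow t x - x) \<le> norm (x - y) + norm (flow t y - y) + norm (x - y)"
      by (metis norm_flow norm_add_diff_le)
    then show ?thesis using 1 y(2) by simp
  qed
  then show "\<exists>s>0. \<forall>t. t \<noteq> 0 \<and> norm (t - 0) < s \<longrightarrow> norm (flow t x - x) < e"
    using e by (intro exI[of _ "e / 3 / (norm y' + 1)"]) (auto intro!: divide_pos_pos add_nonneg_pos)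
qed

text \<open>The derivative of \<open>approx n s x - s *\<^sub>R x'\<close> is small for large
  \<open>n\<close> and small \<open>s\<close>. Since \<open>x'\<close> may lie outside the domain,
  its variation under the group is controlled through a nearby domain vector \<open>y\<close>,
  uniformly in \<open>n\<close>. The mean value inequality and the limit in \<open>n\<close> give
  \<open>key\<close>.\<close>

lemma D_imp_generator:
  assumes x: "D x x'"
  shows "((\<lambda>t. (flow t x - x) /\<^sub>R t) \<longlongrightarrow> x') (at 0)"
proof (rule LIM_I)
  fix e :: real assume e: "e > 0"
  then obtain y y' where y: "D y y'" "norm (x' - y) < e / 4" using approx_domain[of "e/4" x'] by auto
  have key: "norm (flow t x - x - t *\<^sub>R x') \<le> (2 * norm (x' - y) + \<bar>t\<bar> * norm y') * \<bar>t\<bar>" for t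
  proof -
    have bd: "norm (approx n s (endo_apply (yosida n) x) - x') \<le>
        norm (endo_apply (yosida n) x - x') + (2 * norm (x' - y) + \<bar>s\<bar> * norm y')" for n s
    proof -
      have "approx n s (endo_apply (yosida n) x) - x' =
          approx n s (endo_apply (yosida n) x - x') + (approx n s (x' - y) + ((approx n s y - y) - (x' - y)))"
        by (simp add: linear_diff[OF linear_approx])
      also have "norm \<dots> \<le> norm (endo_apply (yosida n) x - x') +
          (norm (x' - y) + (\<bar>s\<bar> * norm y' + norm (x' - y)))"
      proof -
        have tri: "norm (a + (b + (c - d))) \<le> norm a + (norm b + (norm c + norm d))" for a b c d :: 'a
          using norm_triangle_ineq[of a "b + (c - d)"] norm_triangle_ineq[of b "c - d"]
            norm_triangle_ineq4[of c d] by linarith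
        show ?thesis
          using tri[of "approx n s (endo_apply (yosida n) x - x')" "approx n s (x' - y)" "approx n s y - y" "x' - y"]
            norm_approx_diff_initial[OF y(1), of n s] unfolding norm_approx by linarith
      qed
      finally show ?thesis by simp
    qed
    have "norm (approx n t x - x - t *\<^sub>R x') \<le>
        (norm (endo_apply (yosida n) x - x') + (2 * norm (x' - y) + \<bar>t\<bar> * norm y')) * \<bar>t\<bar>" for n
    proof -
      let ?B = "norm (endo_apply (yosida n) x - x') + (2 * norm (x' - y) + \<bar>t\<bar> * norm y')"
      let ?g = "\<lambda>s. approx n s x - s *\<^sub>R x'"
      have der: "(?g has_derivative (\<lambda>r. r *\<^sub>R (approx n s (endo_apply (yosida n) x) - x')))
          (at s within {- \<bar>t\<bar>..\<bar>t\<bar>})" for s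
      proof -
        have "(?g has_vector_derivative approx n s (endo_apply (yosida n) x) - 1 *\<^sub>R x')
            (at s within {- \<bar>t\<bar>..\<bar>t\<bar>})"
          by (intro has_vector_derivative_diff approx_deriv)
            (auto intro!: derivative_eq_intros)
        then show ?thesis by (simp add: has_vector_derivative_def)
      qed
      have "norm (?g t - ?g 0) \<le> ?B * norm (t - 0)"
      proof (rule differentiable_bound[OF _ der])
        fix s assume s: "s \<in> {- \<bar>t\<bar>..\<bar>t\<bar>}"
        have "norm (approx n s (endo_apply (yosida n) x) - x') \<le> ?B"
          using bd[of n s] s
          by (smt (verit) atLeastAtMost_iff mult_right_mono norm_ge_zero)
        then show "onorm (\<lambda>r. r *\<^sub>R (approx n s (endo_apply (yosida n) x) - x')) \<le> ?B"
          by (intro onorm_le) (simp add: mult.commute mult_left_mono)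
      qed auto
      then show ?thesis by (simp add: algebra_simps)
    qed
    then have "norm (flow t x - x - t *\<^sub>R x') \<le>
        (norm (x' - x') + (2 * norm (x' - y) + \<bar>t\<bar> * norm y')) * \<bar>t\<bar>"
      by (intro LIMSEQ_le[of "\<lambda>n. norm (approx n t x - x - t *\<^sub>R x')" _
        "\<lambda>n. (norm (endo_apply (yosida n) x - x') + (2 * norm (x' - y) + \<bar>t\<bar> * norm y')) * \<bar>t\<bar>"]
          tendsto_intros approx_tendsto yosida_tendsto x) auto
    then show ?thesis by simp
  qed
  have "norm ((flow t x - x) /\<^sub>R t - x') < e"
    if t: "t \<noteq> 0" "norm (t - 0) < e / 4 / (norm y' + 1)" for t
  proof -
    have "\<bar>t\<bar> * norm y' \<le> (e / 4 / (norm y' + 1)) * norm y'"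
      using t by (intro mult_right_mono) auto
    also have "\<dots> \<le> e / 4" using e by (intro divide_add_one_mult_le) auto
    finally have "2 * norm (x' - y) + \<bar>t\<bar> * norm y' < e" using y(2) e by linarith
    have "(flow t x - x) /\<^sub>R t - x' = (flow t x - x - t *\<^sub>R x') /\<^sub>R t"
      using t by (simp add: scaleR_diff_right)
    then have "norm ((flow t x - x) /\<^sub>R t - x') = norm (flow t x - x - t *\<^sub>R x') / \<bar>t\<bar>"
      by (simp only: norm_scaleR) (simp add: divide_inverse mult.commute)
    also have "\<dots> \<le> 2 * norm (x' - y) + \<bar>t\<bar> * norm y'"
      using key[of t] t by (simp add: field_simps)
    finally show ?thesis using \<open>2 * norm (x' - y) + \<bar>t\<bar> * norm y' < e\<close> by simp
  qed
  then show "\<exists>s>0. \<forall>t. t \<noteq> 0 \<and> norm (t - 0) < s \<longrightarrow> norm ((flow t x - x) /\<^sub>R t - x') < e"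
    using e by (intro exI[of _ "e / 4 / (norm y' + 1)"]) (auto intro!: divide_pos_pos add_nonneg_pos)
qed

text \<open>Differentiate the constant squared norm of \<open>flow t x\<close> at 0; the quadratic
  remainder vanishes by continuity of the flow.\<close>

lemma generator_skew:
  assumes "((\<lambda>t. (flow t x - x) /\<^sub>R t) \<longlongrightarrow> y) (at 0)"
  shows "inner y x = 0"
proof -
  have "((\<lambda>t. 2 * inner ((flow t x - x) /\<^sub>R t) x + inner ((flow t x - x) /\<^sub>R t) (flow t x - x))
      \<longlongrightarrow> 2 * inner y x + inner y (x - x)) (at 0)"
    by (intro tendsto_intros assms flow_tendsto_initial)
  moreover have "2 * inner ((flow t x - x) /\<^sub>R t) x + inner ((flow t x - x) /\<^sub>R t) (flow t x - x) = 0" for t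
  proof -
    have "inner (flow t x) (flow t x) = inner x x"
      using norm_flow[of t x] by (simp add: norm_eq_sqrt_inner)
    then have "2 * inner (flow t x - x) x + inner (flow t x - x) (flow t x - x) = 0"
      by (simp add: inner_diff_left inner_diff_right inner_commute)
    then have "inverse t * (2 * inner (flow t x - x) x + inner (flow t x - x) (flow t x - x)) = 0"
      by simp
    then show ?thesis unfolding inner_scaleR_left by (simp add: distrib_left mult.left_commute)
  qed
  ultimately show ?thesis by (simp add: tendsto_const_iff)
qed

text \<open>The generator is a skew extension of \<open>D\<close>, and \<open>D\<close> has no
  proper one: 1 - D is already onto, so some \<open>y\<close> in its domain has the same image under
  1 minus the generator as \<open>x\<close>, and skewness applied to \<open>x - y\<close> forces
  \<open>x = y\<close>.\<close>

lemma generator_iff: "((\<lambda>t. (flow t x - x) /\<^sub>R t) \<longlongrightarrow> x') (at 0) \<longleftrightarrow> D x x'"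
proof
  assume lim: "((\<lambda>t. (flow t x - x) /\<^sub>R t) \<longlongrightarrow> x') (at 0)"
  obtain y y' where y: "D y y'" "y - 1 *\<^sub>R y' = x - x'" using surj[of 1 "x - x'"] by auto
  have "((\<lambda>t. (flow t x - x) /\<^sub>R t - (flow t y - y) /\<^sub>R t) \<longlongrightarrow> x' - y') (at 0)"
    by (intro tendsto_diff lim D_imp_generator y)
  then have "((\<lambda>t. (flow t (x - y) - (x - y)) /\<^sub>R t) \<longlongrightarrow> x' - y') (at 0)"
    by (simp add: linear_diff[OF linear_flow] scaleR_diff_right algebra_simps)
  then have "inner (x' - y') (x - y) = 0" by (rule generator_skew)
  moreover have "x' - y' = x - y" using y(2) by (simp add: algebra_simps)
  ultimately have "x = y" "x' = y'" by auto
  then show "D x x'" using y by simp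
qed (rule D_imp_generator)

text \<open>\<open>L\<close> commutes with the resolvents, hence with the Yosida approximations,
  their exponentials and the limit. Applied to multiplication by a complex scalar it makes the flow
  complex linear.\<close>

lemma flow_commute:
  assumes L: "bounded_linear L" and LD: "\<And>x x'. D x x' \<Longrightarrow> D (L x) (L x')"
  shows "flow t (L x) = L (flow t x)"
proof -
  interpret L: bounded_linear L by fact
  have "endo_of (resolvent c) * endo_of L = endo_of L * endo_of (resolvent c)" if c: "c \<noteq> 0" for c
  proof (rule endo_of_commute)
    show "resolvent c (L x) = L (resolvent c x)" for x
      by (rule resolvent_eqI[OF c LD[OF resolvent_D[OF c]]]) (use c in \<open>simp add: L.scaleR L.diff\<close>)
  qed (rule L bounded_linear_resolvent[OF c])+
  then have "endo_of L * yosida n = yosida n * endo_of L" for n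
    unfolding yosida_def by (simp add: algebra_simps del: of_nat_Suc)
  then have "endo_of L * exp (t *\<^sub>R yosida n) = exp (t *\<^sub>R yosida n) * endo_of L" for n
    by (intro exp_commute_endo) simp
  then have "approx n t (L x) = L (approx n t x)" for n
    by (metis approx_def endo_apply_times endo_apply_endo_of[OF L])
  then have "(\<lambda>n. approx n t (L x)) \<longlonglongrightarrow> L (flow t x)"
    using L.tendsto[OF approx_tendsto] by simp
  then show ?thesis using approx_tendsto LIMSEQ_unique by blast
qed

end


subsection \<open>The Hilbert space of square integrable functions\<close>

lemma L2_iff: "f \<in> L2 \<longleftrightarrow> f \<in> borel_measurable lebesgue \<and> integrable lebesgue (\<lambda>x. (norm (f x))\<^sup>2)"
proof -
  have "integrable lebesgue (\<lambda>x. (norm (f x))\<^sup>2) \<longleftrightarrow> l2_norm_sq f < \<infinity>"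
    if "f \<in> borel_measurable lebesgue"
    using that unfolding l2_norm_sq_def integrable_iff_bounded by (simp add: real_norm_def)
  then show ?thesis by (auto simp: L2_def)
qed

lemma L2_measurable [measurable_dest]: "f \<in> L2 \<Longrightarrow> f \<in> borel_measurable lebesgue"
  by (simp add: L2_iff)

lemma L2_integrable: "f \<in> L2 \<Longrightarrow> integrable lebesgue (\<lambda>x. (norm (f x))\<^sup>2)"
  by (simp add: L2_iff)

lemma l2_norm_sq_L2: "f \<in> L2 \<Longrightarrow> l2_norm_sq f = ennreal (LINT x|lebesgue. (norm (f x))\<^sup>2)"
  unfolding l2_norm_sq_def by (rule nn_integral_eq_integral) (auto intro: L2_integrable)

lemma L2_AE_cong:
  assumes "f \<in> L2" "g \<in> borel_measurable lebesgue" "AE x in lebesgue. f x = g x"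
  shows "g \<in> L2"
proof -
  have "integrable lebesgue (\<lambda>x. (norm (g x))\<^sup>2) \<longleftrightarrow> integrable lebesgue (\<lambda>x. (norm (f x))\<^sup>2)"
    using assms by (intro integrable_cong_AE) (auto simp: L2_measurable)
  then show ?thesis using assms by (simp add: L2_iff)
qed

lemma Re_mult_cnj_self: "Re (z * cnj z) = (norm z)\<^sup>2"
  unfolding cmod_power2 by (simp add: power2_eq_square)

lemma norm_add_square_le:
  fixes a b :: "'a::real_normed_vector"
  shows "(norm (a + b))\<^sup>2 \<le> 2 * (norm a)\<^sup>2 + 2 * (norm b)\<^sup>2"
proof -
  have "(norm (a + b))\<^sup>2 \<le> (norm a + norm b)\<^sup>2"
    by (intro power_mono norm_triangle_ineq) auto
  also have "\<dots> \<le> 2 * (norm a)\<^sup>2 + 2 * (norm b)\<^sup>2"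
    using sum_squares_bound[of "norm a" "norm b"] by (simp add: power2_sum)
  finally show ?thesis .
qed

lemma L2_zero: "(\<lambda>x. 0) \<in> L2"
  by (simp add: L2_iff)

lemma L2_add: "f \<in> L2 \<Longrightarrow> g \<in> L2 \<Longrightarrow> (\<lambda>x. f x + g x) \<in> L2"
proof -
  assume fg: "f \<in> L2" "g \<in> L2"
  have int: "integrable lebesgue (\<lambda>x. 2 * (norm (f x))\<^sup>2 + 2 * (norm (g x))\<^sup>2)"
    using fg by (auto simp: L2_iff)
  have [measurable]: "f \<in> borel_measurable lebesgue" "g \<in> borel_measurable lebesgue"
    using fg by (auto simp: L2_iff)
  have "integrable lebesgue (\<lambda>x. (norm (f x + g x))\<^sup>2)"
  proof (rule Bochner_Integration.integrable_bound[OF int])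
    show "AE x in lebesgue. norm ((norm (f x + g x))\<^sup>2) \<le> norm (2 * (norm (f x))\<^sup>2 + 2 * (norm (g x))\<^sup>2)"
      using norm_add_square_le by (intro AE_I2) simp
  qed measurable
  then show ?thesis by (simp add: L2_iff)
qed

lemma L2_cmult: "f \<in> L2 \<Longrightarrow> (\<lambda>x. c * f x) \<in> L2"
  by (auto simp: L2_iff norm_mult power_mult_distrib)

lemma L2_uminus: "f \<in> L2 \<Longrightarrow> (\<lambda>x. - f x) \<in> L2"
  by (simp add: L2_iff)

lemma L2_diff: "f \<in> L2 \<Longrightarrow> g \<in> L2 \<Longrightarrow> (\<lambda>x. f x - g x) \<in> L2"
  using L2_add[of f "\<lambda>x. - g x"] L2_uminus[of g] by simp

lemma L2_bound:
  assumes "f \<in> L2" "g \<in> borel_measurable lebesgue" "\<And>x. norm (g x) \<le> norm (f x)"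
  shows "g \<in> L2"
proof -
  have "integrable lebesgue (\<lambda>x. (norm (g x))\<^sup>2)"
    by (rule Bochner_Integration.integrable_bound[OF L2_integrable[OF assms(1)]])
      (use assms in \<open>auto intro!: power_mono\<close>)
  then show ?thesis using assms by (simp add: L2_iff)
qed

lemma L2_integrable_product:
  assumes fg: "f \<in> L2" "g \<in> L2"
  shows "integrable lebesgue (\<lambda>x. f x * cnj (g x))"
proof (rule Bochner_Integration.integrable_bound)
  show "integrable lebesgue (\<lambda>x. (norm (f x))\<^sup>2 + (norm (g x))\<^sup>2)"
    using fg by (auto simp: L2_iff)
  show "(\<lambda>x. f x * cnj (g x)) \<in> borel_measurable lebesgue"
    using fg by (intro borel_measurable_times measurable_compose[OF _ borel_measurable_continuous_onI[of cnj]]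
        L2_measurable continuous_intros)
  have "a * b \<le> a\<^sup>2 + b\<^sup>2" if "a \<ge> 0" "b \<ge> 0" for a b :: real
    using sum_squares_bound[of a b] mult_nonneg_nonneg[OF that] by linarith
  then show "AE x in lebesgue. norm (f x * cnj (g x)) \<le> norm ((norm (f x))\<^sup>2 + (norm (g x))\<^sup>2)"
    by (simp add: norm_mult)
qed

\<comment> \<open>The quotient by almost everywhere equality, its real inner product and
  completeness\<close>
quotient_type l2 = "real \<Rightarrow> complex" /
  partial: "\<lambda>f g. f \<in> L2 \<and> g \<in> L2 \<and> (AE x in lebesgue. f x = g x)"
  morphisms rep_l2 abs_l2
proof (rule part_equivpI)
  show "\<exists>f. f \<in> L2 \<and> f \<in> L2 \<and> (AE x in lebesgue. f x = f x)"
    using L2_zero by auto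
  show "symp (\<lambda>f g. f \<in> L2 \<and> g \<in> L2 \<and> (AE x in lebesgue. f x = g x))"
    by (rule sympI) (auto simp: eq_commute)
  show "transp (\<lambda>f g. f \<in> L2 \<and> g \<in> L2 \<and> (AE x in lebesgue. f x = g x))"
    by (rule transpI) (auto elim: eventually_elim2)
qed

lemma rep_l2_L2 [simp]: "rep_l2 x \<in> L2"
  using Quotient_rep_reflp[OF Quotient_l2] by blast

lemma abs_rep_l2 [simp]: "abs_l2 (rep_l2 x) = x"
  using Quotient_abs_rep[OF Quotient_l2] .

lemma rep_abs_l2: "f \<in> L2 \<Longrightarrow> AE x in lebesgue. rep_l2 (abs_l2 f) x = f x"
  using Quotient_rep_abs[OF Quotient_l2, of f] by simp

lemma abs_l2_eqI: "f \<in> L2 \<Longrightarrow> g \<in> L2 \<Longrightarrow> AE x in lebesgue. f x = g x \<Longrightarrow> abs_l2 f = abs_l2 g"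
  using Quotient_rel_abs[OF Quotient_l2] by simp

lemma abs_l2_eq_iff: "f \<in> L2 \<Longrightarrow> g \<in> L2 \<Longrightarrow> abs_l2 f = abs_l2 g \<longleftrightarrow> (AE x in lebesgue. f x = g x)"
  using Quotient_rel[OF Quotient_l2, of f g] by simp

instantiation l2 :: real_inner
begin

lift_definition zero_l2 :: l2 is "\<lambda>x. 0" by (simp add: L2_zero)
lift_definition plus_l2 :: "l2 \<Rightarrow> l2 \<Rightarrow> l2" is "\<lambda>f g x. f x + g x"
  by (auto simp: L2_add elim: eventually_elim2)
lift_definition minus_l2 :: "l2 \<Rightarrow> l2 \<Rightarrow> l2" is "\<lambda>f g x. f x - g x"
  by (auto simp: L2_diff elim: eventually_elim2)
lift_definition uminus_l2 :: "l2 \<Rightarrow> l2" is "\<lambda>f x. - f x"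
  by (auto simp: L2_uminus)
lift_definition scaleR_l2 :: "real \<Rightarrow> l2 \<Rightarrow> l2" is "\<lambda>r f x. complex_of_real r * f x"
  by (auto simp: L2_cmult)
lift_definition inner_l2 :: "l2 \<Rightarrow> l2 \<Rightarrow> real" is "\<lambda>f g. LINT x|lebesgue. Re (f x * cnj (g x))"
proof -
  fix f1 g1 f2 g2 :: "real \<Rightarrow> complex"
  assume 1: "f1 \<in> L2 \<and> g1 \<in> L2 \<and> (AE x in lebesgue. f1 x = g1 x)"
    and 2: "f2 \<in> L2 \<and> g2 \<in> L2 \<and> (AE x in lebesgue. f2 x = g2 x)"
  have [measurable]: "f1 \<in> borel_measurable lebesgue" "g1 \<in> borel_measurable lebesgue"
    "f2 \<in> borel_measurable lebesgue" "g2 \<in> borel_measurable lebesgue"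
    using 1 2 by (auto simp: L2_iff)
  show "(LINT x|lebesgue. Re (f1 x * cnj (f2 x))) = (LINT x|lebesgue. Re (g1 x * cnj (g2 x)))"
    using 1 2 by (intro integral_cong_AE) (auto elim: eventually_elim2)
qed
definition norm_l2 :: "l2 \<Rightarrow> real" where "norm_l2 x = sqrt (inner x x)"
definition dist_l2 :: "l2 \<Rightarrow> l2 \<Rightarrow> real" where "dist_l2 x y = norm (x - y)"
definition sgn_l2 :: "l2 \<Rightarrow> l2" where "sgn_l2 x = scaleR (inverse (norm x)) x"
definition [code del]:
  "(uniformity :: (l2 \<times> l2) filter) = (INF e\<in>{0 <..}. principal {(x, y). dist x y < e})"
definition open_l2 :: "l2 set \<Rightarrow> bool" where
  [code del]: "open_l2 S = (\<forall>x\<in>S. \<forall>\<^sub>F (x', y) in uniformity. x' = x \<longrightarrow> y \<in> S)"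

instance
proof
  fix x y z :: l2 and a b r :: real
  show "x + y + z = x + (y + z)" by transfer (auto simp: L2_add algebra_simps)
  show "x + y = y + x" by transfer (auto simp: L2_add algebra_simps)
  show "0 + x = x" by transfer auto
  show "- x + x = 0" by transfer (auto simp: L2_zero)
  show "x - y = x + - y" by transfer (auto simp: L2_add L2_diff L2_uminus)
  show "a *\<^sub>R (x + y) = a *\<^sub>R x + a *\<^sub>R y"
    by transfer (auto simp: L2_add L2_cmult distrib_left distrib_right)
  show "(a + b) *\<^sub>R x = a *\<^sub>R x + b *\<^sub>R x"
    by transfer (auto simp: L2_add L2_cmult distrib_left distrib_right)
  show "a *\<^sub>R b *\<^sub>R x = (a * b) *\<^sub>R x" by transfer (auto simp: L2_cmult simp flip: mult.assoc)
  show "1 *\<^sub>R x = x" by transfer auto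
  show "dist x y = norm (x - y)" by (simp add: dist_l2_def)
  show "sgn x = scaleR (inverse (norm x)) x" by (simp only: sgn_l2_def)
  show "uniformity = (INF e\<in>{0 <..}. principal {(x, y::l2). dist x y < e})"
    by (rule uniformity_l2_def)
  show "open U = (\<forall>x\<in>U. \<forall>\<^sub>F (x', y) in uniformity. x' = x \<longrightarrow> y \<in> U)" for U :: "l2 set"
    by (rule open_l2_def)
  show "inner x y = inner y x"
    by transfer (auto intro!: Bochner_Integration.integral_cong simp: algebra_simps)
  show "inner (x + y) z = inner x z + inner y z"
  proof (transfer, clarify)
    fix f g h assume "f \<in> L2" "g \<in> L2" "h \<in> L2"
    then have "integrable lebesgue (\<lambda>x. Re (f x * cnj (h x)))" "integrable lebesgue (\<lambda>x. Re (g x * cnj (h x)))"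
      by (blast intro: integrable_Re[OF L2_integrable_product])+
    then show "(LINT x|lebesgue. Re ((f x + g x) * cnj (h x))) =
        (LINT x|lebesgue. Re (f x * cnj (h x))) + (LINT x|lebesgue. Re (g x * cnj (h x)))"
      by (subst Bochner_Integration.integral_add[symmetric])
        (auto intro!: Bochner_Integration.integral_cong simp: algebra_simps)
  qed
  show "inner (r *\<^sub>R x) y = r * inner x y"
    by transfer (auto intro!: Bochner_Integration.integral_cong simp: algebra_simps
        simp flip: integral_mult_right_zero)
  show "0 \<le> inner x x"
    by transfer (auto intro!: Bochner_Integration.integral_nonneg)
  show "inner x x = 0 \<longleftrightarrow> x = 0"
  proof (transfer, clarify)
    fix f assume f: "f \<in> L2"
    have sq: "Re (f x * cnj (f x)) = (norm (f x))\<^sup>2" for x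
      by (simp add: complex_mult_cnj cmod_power2)
    show "(LINT x|lebesgue. Re (f x * cnj (f x))) = 0 \<longleftrightarrow>
        f \<in> L2 \<and> (\<lambda>x. 0) \<in> L2 \<and> (AE x in lebesgue. f x = 0)"
      using f unfolding sq
      by (subst integral_nonneg_eq_0_iff_AE) (auto simp: L2_integrable L2_zero)
  qed
  show "norm x = sqrt (inner x x)" by (simp add: norm_l2_def)
qed
end

lemma inner_abs_l2:
  "f \<in> L2 \<Longrightarrow> g \<in> L2 \<Longrightarrow> inner (abs_l2 f) (abs_l2 g) = (LINT x|lebesgue. Re (f x * cnj (g x)))"
  by (simp add: inner_l2.abs_eq)

lemma inner_l2_rep: "inner x y = (LINT t|lebesgue. Re (rep_l2 x t * cnj (rep_l2 y t)))"
  using inner_abs_l2[of "rep_l2 x" "rep_l2 y"] by simp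

lemma norm_abs_l2_sq: "f \<in> L2 \<Longrightarrow> (norm (abs_l2 f))\<^sup>2 = (LINT x|lebesgue. (norm (f x))\<^sup>2)"
  unfolding power2_norm_eq_inner[of "abs_l2 f"] inner_abs_l2 Re_mult_cnj_self ..

lemma l2_norm_sq_abs: "f \<in> L2 \<Longrightarrow> l2_norm_sq f = ennreal ((norm (abs_l2 f))\<^sup>2)"
  by (simp add: norm_abs_l2_sq l2_norm_sq_L2)

lemma abs_l2_diff: "f \<in> L2 \<Longrightarrow> g \<in> L2 \<Longrightarrow> abs_l2 f - abs_l2 g = abs_l2 (\<lambda>x. f x - g x)"
  by (simp add: minus_l2.abs_eq)

lemma abs_l2_add: "f \<in> L2 \<Longrightarrow> g \<in> L2 \<Longrightarrow> abs_l2 f + abs_l2 g = abs_l2 (\<lambda>x. f x + g x)"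
  by (simp add: plus_l2.abs_eq)

text \<open>Riesz-Fischer: a fast subsequence converges pointwise almost everywhere, Fatou's lemma
  shows that the pointwise limit is also the limit in norm, and a Cauchy sequence converges along
  with a subsequence.\<close>

instance l2 :: complete_space
proof
  fix X :: "nat \<Rightarrow> l2" assume X: "Cauchy X"
  have "\<exists>N. \<forall>m\<ge>N. norm (X m - X N) < (1/4) ^ n" for n
    using CauchyD[OF X, of "(1/4) ^ n"] by (meson order_refl zero_less_power zero_less_divide_1_iff zero_less_numeral)
  then obtain N where N: "\<And>n m. m \<ge> N n \<Longrightarrow> norm (X m - X (N n)) < (1/4) ^ n" by metis
  \<comment> \<open>The sum dominates each \<open>N i\<close> with i \<le> n, and the summand
    \<open>n\<close> makes \<open>r\<close> strictly increasing.\<close>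
  define r where "r n = n + (\<Sum>i\<le>n. N i)" for n
  have r: "strict_mono r" by (simp add: strict_mono_Suc_iff r_def)
  have rN: "r n \<ge> N n" "r (Suc n) \<ge> N n" for n
  proof -
    have "N n \<le> (\<Sum>i\<le>n. N i)" by (rule member_le_sum) auto
    then show "r n \<ge> N n" "r (Suc n) \<ge> N n" by (auto simp: r_def)
  qed
  define F where "F n = rep_l2 (X (r n))" for n
  have F: "F n \<in> L2" for n by (simp add: F_def)
  have [measurable]: "F n \<in> borel_measurable lebesgue" for n using F by (simp add: L2_iff)
  have absF: "abs_l2 (F n) = X (r n)" for n by (simp add: F_def)
  have nrm: "(\<integral>\<^sup>+ x. ennreal ((norm (F m x - F n x))\<^sup>2) \<partial>lebesgue) = ennreal ((norm (X (r m) - X (r n)))\<^sup>2)" for m n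
    using l2_norm_sq_abs[OF L2_diff[OF F[of m] F[of n]]]
    by (simp add: l2_norm_sq_def F absF flip: abs_l2_diff)
  have step: "norm (X (r (Suc n)) - X (r n)) \<le> 2 * (1/4) ^ n" for n
    using N[OF rN(1)[of n]] N[OF rN(2)[of n]]
      norm_triangle_ineq4[of "X (r (Suc n)) - X (N n)" "X (r n) - X (N n)"] by simp
  \<comment> \<open>The weight 4^n is summable against the squared steps, of order 16^-n, and yet
    finiteness of the weighted sum at a point forces pointwise steps of order 2^-n there.\<close>
  let ?d = "\<lambda>n x. (norm (F (Suc n) x - F n x))\<^sup>2"
  have "(\<integral>\<^sup>+ x. (\<Sum>n. ennreal (4 ^ n * ?d n x)) \<partial>lebesgue) = (\<Sum>n. \<integral>\<^sup>+ x. ennreal (4 ^ n * ?d n x) \<partial>lebesgue)"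
    by (rule nn_integral_suminf) measurable
  also have "\<dots> = (\<Sum>n. ennreal (4 ^ n * (norm (X (r (Suc n)) - X (r n)))\<^sup>2))"
    by (simp add: ennreal_mult nn_integral_cmult nrm)
  also have "\<dots> \<le> (\<Sum>n. ennreal (4 * (1/4) ^ n))"
  proof (intro suminf_le ennreal_leI)
    fix n :: nat
    have "(norm (X (r (Suc n)) - X (r n)))\<^sup>2 \<le> (2 * (1/4) ^ n)\<^sup>2"
      by (intro power_mono step) auto
    then have "4 ^ n * (norm (X (r (Suc n)) - X (r n)))\<^sup>2 \<le> 4 ^ n * (2 * (1/4) ^ n)\<^sup>2"
      by (intro mult_left_mono) auto
    also have "\<dots> = 4 * (4 ^ n * (1/4) ^ n) * (1/4) ^ n" by (simp add: power2_eq_square)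
    also have "4 ^ n * (1/4 :: real) ^ n = 1" by (subst power_mult_distrib[symmetric]) simp
    also have "4 * 1 * (1/4 :: real) ^ n = 4 * (1/4) ^ n" by simp
    finally show "4 ^ n * (norm (X (r (Suc n)) - X (r n)))\<^sup>2 \<le> 4 * (1/4) ^ n" .
  qed auto
  also have "\<dots> < \<infinity>"
  proof -
    have "summable (\<lambda>n. 4 * (1/4 :: real) ^ n)" by (intro summable_mult summable_geometric) auto
    then show ?thesis by (subst suminf_ennreal2) auto
  qed
  finally have fin: "(\<integral>\<^sup>+ x. (\<Sum>n. ennreal (4 ^ n * ?d n x)) \<partial>lebesgue) < \<infinity>" .
  have "AE x in lebesgue. (\<Sum>n. ennreal (4 ^ n * ?d n x)) \<noteq> \<infinity>"
    by (rule nn_integral_PInf_AE) (use fin in auto)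
  then have conv: "AE x in lebesgue. convergent (\<lambda>n. F n x)"
  proof (rule AE_mp, intro AE_I2 impI)
    fix x assume fx: "(\<Sum>n. ennreal (4 ^ n * ?d n x)) \<noteq> \<infinity>"
    have "\<exists>M\<ge>0. S = ennreal M" if "S \<noteq> \<infinity>" for S
      using that by (cases S) auto
    from this[OF fx] obtain M where M: "(\<Sum>n. ennreal (4 ^ n * ?d n x)) = ennreal M" "0 \<le> M"
      by blast
    have le: "norm (F (Suc n) x - F n x) \<le> sqrt M * (1/2) ^ n" for n
    proof -
      have "ennreal (4 ^ n * ?d n x) \<le> ennreal M"
      proof -
        have "g n \<le> suminf g" for g :: "nat \<Rightarrow> ennreal"
          using sum_le_suminf[of g "{n}"] by simp
        from this[of "\<lambda>n. ennreal (4 ^ n * ?d n x)"] show ?thesis by (simp only: M(1))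
      qed
      then have "4 ^ n * ?d n x \<le> M" using M(2) by (simp add: ennreal_le_iff)
      moreover have "(2 ^ n * norm (F (Suc n) x - F n x))\<^sup>2 = 4 ^ n * ?d n x"
      proof -
        have "(2 ^ n)\<^sup>2 = (4 :: real) ^ n"
          unfolding power2_eq_square by (subst power_mult_distrib[symmetric]) simp
        then show ?thesis by (simp only: power_mult_distrib)
      qed
      ultimately have "(2 ^ n * norm (F (Suc n) x - F n x))\<^sup>2 \<le> M" by simp
      then have "2 ^ n * norm (F (Suc n) x - F n x) \<le> sqrt M"
        by (rule real_le_rsqrt)
      then show ?thesis by (simp add: field_simps)
    qed
    have "summable (\<lambda>n. sqrt M * (1/2) ^ n)" by (intro summable_mult summable_geometric) auto
    then have "summable (\<lambda>n. F (Suc n) x - F n x)"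
      by (rule summable_comparison_test'[of _ 0]) (use le in auto)
    then have "convergent (\<lambda>n. F n x - F 0 x)"
      by (simp add: summable_iff_convergent sum_lessThan_telescope[of "\<lambda>n. F n x"])
    from convergent_add[OF this convergent_const[of "F 0 x"]] show "convergent (\<lambda>n. F n x)" by simp
  qed
  define f where "f x = lim (\<lambda>n. F n x)" for x
  have [measurable]: "f \<in> borel_measurable lebesgue"
    unfolding f_def by (rule borel_measurable_lim_metric) measurable
  have lim: "AE x in lebesgue. (\<lambda>n. F n x) \<longlonglongrightarrow> f x"
    using conv by (rule AE_mp) (auto simp: f_def convergent_LIMSEQ_iff)
  have fat: "(\<integral>\<^sup>+ x. ennreal ((norm (f x - F n x))\<^sup>2) \<partial>lebesgue) \<le> ennreal ((2 * (1/4) ^ n)\<^sup>2)" for n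
  proof -
    have "(\<integral>\<^sup>+ x. ennreal ((norm (f x - F n x))\<^sup>2) \<partial>lebesgue) =
        (\<integral>\<^sup>+ x. liminf (\<lambda>m. ennreal ((norm (F m x - F n x))\<^sup>2)) \<partial>lebesgue)"
    proof (rule nn_integral_cong_AE, rule AE_mp[OF lim], intro AE_I2 impI)
      fix x assume "(\<lambda>n. F n x) \<longlonglongrightarrow> f x"
      then have "(\<lambda>m. ennreal ((norm (F m x - F n x))\<^sup>2)) \<longlonglongrightarrow> ennreal ((norm (f x - F n x))\<^sup>2)"
        by (intro tendsto_intros)
      then show "ennreal ((norm (f x - F n x))\<^sup>2) = liminf (\<lambda>m. ennreal ((norm (F m x - F n x))\<^sup>2))"
        by (rule lim_imp_Liminf[OF sequentially_bot, symmetric])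
    qed
    also have "\<dots> \<le> liminf (\<lambda>m. \<integral>\<^sup>+ x. ennreal ((norm (F m x - F n x))\<^sup>2) \<partial>lebesgue)"
      by (rule nn_integral_liminf) measurable
    also have "\<dots> \<le> ennreal ((2 * (1/4) ^ n)\<^sup>2)"
    proof (rule Liminf_le)
      show "\<forall>\<^sub>F m in sequentially. (\<integral>\<^sup>+ x. ennreal ((norm (F m x - F n x))\<^sup>2) \<partial>lebesgue) \<le> ennreal ((2 * (1/4) ^ n)\<^sup>2)"
      proof (rule eventually_sequentiallyI[of n])
        fix m assume "n \<le> m"
        then have "r m \<ge> N n" using rN(1)[of n] strict_mono_less_eq[OF r, of n m] by linarith
        then have "norm (X (r m) - X (r n)) \<le> 2 * (1/4) ^ n"
          using N[OF rN(1)[of n]] N[of n "r m"]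
            norm_triangle_ineq4[of "X (r m) - X (N n)" "X (r n) - X (N n)"] by simp
        then show "(\<integral>\<^sup>+ x. ennreal ((norm (F m x - F n x))\<^sup>2) \<partial>lebesgue) \<le> ennreal ((2 * (1/4) ^ n)\<^sup>2)"
          unfolding nrm by (intro ennreal_leI power_mono) auto
      qed
    qed auto
    finally show ?thesis .
  qed
  have fF: "(\<lambda>x. f x - F n x) \<in> L2" for n
    unfolding L2_def l2_norm_sq_def
  proof (intro CollectI conjI)
    show "(\<integral>\<^sup>+ x. ennreal ((norm (f x - F n x))\<^sup>2) \<partial>lebesgue) < \<infinity>"
      by (rule le_less_trans[OF fat]) simp
  qed measurable
  have f: "f \<in> L2" using L2_add[OF fF[of 0] F[of 0]] by simp
  have "norm (X (r n) - abs_l2 f) \<le> 2 * (1/4) ^ n" for n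
  proof -
    have "ennreal ((norm (abs_l2 f - X (r n)))\<^sup>2) \<le> ennreal ((2 * (1/4) ^ n)\<^sup>2)"
      using fat[of n] l2_norm_sq_abs[OF fF[of n]] by (simp add: l2_norm_sq_def f F absF flip: abs_l2_diff)
    then have "(norm (abs_l2 f - X (r n)))\<^sup>2 \<le> (2 * (1/4) ^ n)\<^sup>2"
      by (subst (asm) ennreal_le_iff) auto
    then show ?thesis by (subst norm_minus_commute, elim power2_le_imp_le) simp
  qed
  moreover have "(\<lambda>n. 2 * (1/4 :: real) ^ n) \<longlonglongrightarrow> 0"
    by (intro tendsto_mult_right_zero LIMSEQ_realpow_zero) auto
  ultimately have "(\<lambda>n. X (r n) - abs_l2 f) \<longlonglongrightarrow> 0"
    by (intro Lim_null_comparison[of "\<lambda>n. X (r n) - abs_l2 f" "\<lambda>n. 2 * (1/4 :: real) ^ n"]) auto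
  then have "(X \<circ> r) \<longlonglongrightarrow> abs_l2 f" by (simp add: o_def LIM_zero_iff)
  then have "X \<longlonglongrightarrow> abs_l2 f"
    using X r by (metis Cauchy_converges_subseq)
  then show "convergent X" by (auto simp: convergent_def)
qed

instance l2 :: banach ..

text \<open>One nonzero vector is enough, as its small multiples translate to points accumulating
  anywhere. The class is what gives \<open>l2 endo\<close> its unit.\<close>

instance l2 :: perfect_space
proof
  fix x :: l2
  let ?h = "\<lambda>x::real. if x \<in> {0..1} then 1 else 0 :: complex" 
  have h: "?h \<in> L2"
  proof -
    have "integrable lebesgue (indicator {0..1::real} :: real \<Rightarrow> real)" by auto
    moreover have "(\<lambda>x. (norm (?h x))\<^sup>2) = indicator {0..1}"
      by (auto simp: indicator_def)
    moreover have "?h \<in> borel_measurable lebesgue"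
      by (rule measurable_If_set) (auto intro: sets_completionI_sets)
    ultimately show ?thesis by (simp add: L2_iff)
  qed
  have "abs_l2 ?h \<noteq> 0"
  proof
    assume "abs_l2 ?h = 0"
    then have "AE x in lebesgue. ?h x = 0" using h L2_zero
      by (simp add: zero_l2_def abs_l2_eq_iff)
    then have "AE x in lebesgue. x \<notin> {0..1::real}" by (rule AE_mp) (auto simp: indicator_def)
    then have "emeasure lebesgue {0..1::real} = 0"
      by (subst (asm) AE_iff_measurable[of "{0..1}"]) auto
    then show False by simp
  qed
  then obtain y :: l2 where y: "y \<noteq> 0" by blast
  have "(\<lambda>n. x + inverse (real (Suc n)) *\<^sub>R y) \<longlonglongrightarrow> x + 0 *\<^sub>R y"
    by (intro tendsto_intros LIMSEQ_inverse_real_of_nat)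
  then have "(\<lambda>n. x + inverse (real (Suc n)) *\<^sub>R y) \<longlonglongrightarrow> x" by simp
  then show "\<not> open {x}"
    using y by (auto dest!: topological_tendstoD[of _ x _ "{x}"] simp: eventually_sequentially)
qed

section \<open>Complex scalars and restriction to a set\<close>

lift_definition scaleC_l2 :: "complex \<Rightarrow> l2 \<Rightarrow> l2" is "\<lambda>c f x. c * f x"
  by (auto simp: L2_cmult)

lemma L2_restrict:
  assumes h: "h \<in> L2" shows "(\<lambda>x. if S \<in> sets lebesgue \<and> x \<in> S then h x else 0) \<in> L2"
proof (rule L2_bound[OF h])
  have [measurable]: "h \<in> borel_measurable lebesgue" using h by (simp add: L2_iff)
  show "(\<lambda>x. if S \<in> sets lebesgue \<and> x \<in> S then h x else 0) \<in> borel_measurable lebesgue"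
  proof (cases "S \<in> sets lebesgue")
    case True
    then show ?thesis by measurable
  qed simp
qed auto

text \<open>Multiplication by the indicator function. For a set that is not measurable the result is
  0, which keeps the map total and linear.\<close>

lift_definition restrict_l2 :: "real set \<Rightarrow> l2 \<Rightarrow> l2" is
  "\<lambda>S f x. if S \<in> sets lebesgue \<and> x \<in> S then f x else 0"
  by (auto intro: L2_restrict elim: eventually_mono)

lemma scaleC_l2_add_right: "scaleC_l2 c (x + y) = scaleC_l2 c x + scaleC_l2 c y"
  by transfer (auto simp: L2_add L2_cmult distrib_left distrib_right)

lemma scaleC_l2_add_left: "scaleC_l2 (c + d) x = scaleC_l2 c x + scaleC_l2 d x"
  by transfer (auto simp: L2_add L2_cmult distrib_left distrib_right)

lemma scaleC_l2_scaleC [simp]: "scaleC_l2 c (scaleC_l2 d x) = scaleC_l2 (c * d) x"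
  by transfer (auto simp: L2_cmult algebra_simps)

lemma scaleC_l2_of_real: "scaleC_l2 (complex_of_real r) x = r *\<^sub>R x"
  by transfer (auto simp: L2_cmult)

lemma scaleC_l2_one [simp]: "scaleC_l2 1 x = x"
  using scaleC_l2_of_real[of 1 x] by simp

lemma norm_scaleC_l2 [simp]: "norm (scaleC_l2 c x) = norm c * norm x"
proof -
  have "inner (scaleC_l2 c x) (scaleC_l2 c x) = (norm c)\<^sup>2 * inner x x"
  proof (transfer, clarify)
    fix c and f :: "real \<Rightarrow> complex"
    have "Re (c * f x * cnj (c * f x)) = (norm c)\<^sup>2 * Re (f x * cnj (f x))" for x
      unfolding Re_mult_cnj_self by (simp add: norm_mult power_mult_distrib)
    then show "(LINT x|lebesgue. Re (c * f x * cnj (c * f x))) = (norm c)\<^sup>2 * (LINT x|lebesgue. Re (f x * cnj (f x)))"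
      by simp
  qed
  then show ?thesis by (simp add: norm_eq_sqrt_inner real_sqrt_mult)
qed

text \<open>The complex structure lives beside the real inner product. As a bounded bilinear map it
  comes with continuity and a product rule for derivatives, which the factor exp(i z t) in front of
  the evolution will use.\<close>

lemma bounded_bilinear_scaleC_l2: "bounded_bilinear scaleC_l2"
proof
  show "scaleC_l2 (r *\<^sub>R c) x = r *\<^sub>R scaleC_l2 c x" for r c x
    by (simp add: scaleR_conv_of_real flip: scaleC_l2_of_real)
  show "scaleC_l2 c (r *\<^sub>R x) = r *\<^sub>R scaleC_l2 c x" for r c x
    by (simp add: mult.commute flip: scaleC_l2_of_real)
  show "\<exists>K. \<forall>a b. norm (scaleC_l2 a b) \<le> norm a * norm b * K"
    by (rule exI[of _ 1]) simp
qed (simp_all add: scaleC_l2_add_left scaleC_l2_add_right)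

interpretation scaleC_l2: bounded_bilinear scaleC_l2
  by (rule bounded_bilinear_scaleC_l2)

lemma inner_scaleC_l2_scaleC: "inner (scaleC_l2 a x) (scaleC_l2 b y) = inner (scaleC_l2 (a * cnj b) x) y"
  by transfer (auto intro!: Bochner_Integration.integral_cong simp: algebra_simps)

lemma scaleC_l2_Re_Im: "scaleC_l2 c x = Re c *\<^sub>R x + Im c *\<^sub>R scaleC_l2 \<i> x"
proof -
  have "scaleC_l2 c x = scaleC_l2 (complex_of_real (Re c)) x + scaleC_l2 (complex_of_real (Im c) * \<i>) x"
    by (metis complex_eq mult.commute scaleC_l2_add_left)
  then show ?thesis by (simp add: scaleC_l2_of_real flip: scaleC_l2_scaleC)
qed

lemma abs_l2_scaleC: "f \<in> L2 \<Longrightarrow> scaleC_l2 c (abs_l2 f) = abs_l2 (\<lambda>x. c * f x)"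
  by (simp add: scaleC_l2.abs_eq)

lemma restrict_l2_scaleC: "restrict_l2 S (scaleC_l2 c x) = scaleC_l2 c (restrict_l2 S x)"
proof (rule l2.abs_induct[of _ x])
  fix f assume "f \<in> L2 \<and> f \<in> L2 \<and> (AE x in lebesgue. f x = f x)"
  then show "restrict_l2 S (scaleC_l2 c (abs_l2 f)) = scaleC_l2 c (restrict_l2 S (abs_l2 f))"
    by (simp add: restrict_l2.abs_eq scaleC_l2.abs_eq L2_cmult L2_restrict if_distrib[of "(*) c"] cong: if_cong)
qed


subsection \<open>Locally absolutely continuous functions\<close>

definition locally_integrable :: "(real \<Rightarrow> 'b::euclidean_space) \<Rightarrow> bool" where
  "locally_integrable h \<longleftrightarrow> (\<forall>a b. h absolutely_integrable_on {a..b})"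

lemma locally_integrable_absolutely: "locally_integrable h \<Longrightarrow> h absolutely_integrable_on {a..b}"
  by (simp add: locally_integrable_def)

lemma locally_integrable_integrable: "locally_integrable h \<Longrightarrow> h integrable_on {a..b}"
  by (simp add: locally_integrable_def absolutely_integrable_on_def)

lemma locally_integrable_norm: "locally_integrable h \<Longrightarrow> locally_integrable (\<lambda>x. norm (h x))"
  by (simp add: locally_integrable_def absolutely_integrable_on_def)

lemma locally_integrable_continuous: "continuous_on UNIV h \<Longrightarrow> locally_integrable h"
  unfolding locally_integrable_def
  by (meson absolutely_integrable_continuous_real continuous_on_subset subset_UNIV)

lemma locally_integrable_add:
  "locally_integrable h \<Longrightarrow> locally_integrable k \<Longrightarrow> locally_integrable (\<lambda>x. h x + k x)"
  unfolding locally_integrable_def by (blast intro: set_integral_add(1))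

lemma locally_integrable_diff:
  "locally_integrable h \<Longrightarrow> locally_integrable k \<Longrightarrow> locally_integrable (\<lambda>x. h x - k x)"
  unfolding locally_integrable_def by (blast intro: set_integral_diff(1))

lemma locally_integrable_linear:
  "locally_integrable h \<Longrightarrow> bounded_linear L \<Longrightarrow> locally_integrable (\<lambda>x. L (h x))"
  unfolding locally_integrable_def using absolutely_integrable_linear by (fastforce simp: o_def)

lemma locally_integrable_cmult:
  fixes c :: "'b::{euclidean_space, real_normed_algebra}"
  shows "locally_integrable h \<Longrightarrow> locally_integrable (\<lambda>x. c * h x)"
  by (rule locally_integrable_linear) (auto intro: bounded_linear_mult_right)

lemma locally_integrable_mult:
  fixes h g :: "real \<Rightarrow> 'b::{euclidean_space, real_normed_algebra}"
  assumes h: "locally_integrable h" and g: "continuous_on UNIV g"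
  shows "locally_integrable (\<lambda>x. h x * g x)"
  unfolding locally_integrable_def
proof (intro allI)
  fix a b :: real
  have g': "continuous_on {a..b} g" using g continuous_on_subset by blast
  show "(\<lambda>x. h x * g x) absolutely_integrable_on {a..b}"
  proof (rule absolutely_integrable_bounded_measurable_product[where h = "\<lambda>x y. y * x"])
    show "bilinear (\<lambda>x y. y * x :: 'b)"
      by (simp add: bilinear_def linear_iff distrib_left distrib_right)
    show "g \<in> borel_measurable (lebesgue_on {a..b})"
      using g' by (simp add: continuous_imp_measurable_on_sets_lebesgue)
    show "bounded (g ` {a..b})"
      using compact_continuous_image[OF g'] compact_imp_bounded by blast
  qed (use h in \<open>auto simp: locally_integrable_def\<close>)
qed

lemma locally_integrable_spike:
  assumes h: "locally_integrable h" and eq: "AE x in lebesgue. h x = k x"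
  shows "locally_integrable k"
proof -
  obtain N where N: "negligible N" "{x. h x \<noteq> k x} \<subseteq> N"
    using eq unfolding eventually_ae_filter_negligible by auto
  show ?thesis
    unfolding locally_integrable_def
  proof (intro allI absolutely_integrable_spike[OF locally_integrable_absolutely[OF h] N(1)])
    show "k x = h x" if "x \<in> {a..b} - N" for a b x
      using that subsetD[OF N(2), of x] by (cases "h x = k x") auto
  qed
qed

lemma has_ac_derivative_locally_integrable: "has_ac_derivative g h \<Longrightarrow> locally_integrable h"
  unfolding has_ac_derivative_def locally_integrable_def
  by (metis absolutely_integrable_on_null atLeastatMost_empty content_real_if interval_cbox linorder_not_le
      box_real(2) content_empty)

lemma has_ac_derivative_has_integral:
  "has_ac_derivative g h \<Longrightarrow> a \<le> b \<Longrightarrow> (h has_integral (g b - g a)) {a..b}"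
  by (simp add: has_ac_derivative_def)

lemma has_ac_derivative_integral:
  "has_ac_derivative g h \<Longrightarrow> a \<le> b \<Longrightarrow> integral {a..b} h = g b - g a"
  by (simp add: has_ac_derivative_has_integral integral_unique)

lemma has_ac_derivativeI:
  "locally_integrable h \<Longrightarrow> (\<And>a b. a \<le> b \<Longrightarrow> integral {a..b} h = g b - g a) \<Longrightarrow> has_ac_derivative g h"
  unfolding has_ac_derivative_def
  by (metis has_integral_integral locally_integrable_absolutely locally_integrable_integrable)

lemma has_ac_derivative_continuous:
  assumes "has_ac_derivative g h" shows "continuous_on S g"
proof -
  have "isCont g x" for x
  proof -
    have "continuous_on {x-1..x+1} (\<lambda>y. g (x-1) + integral {x-1..y} h)"
      by (intro continuous_intros indefinite_integral_continuous_1 locally_integrable_integrable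
          has_ac_derivative_locally_integrable[OF assms])
    then have "continuous_on {x-1..x+1} g"
      by (rule continuous_on_eq) (use has_ac_derivative_integral[OF assms] in auto)
    then show ?thesis
      by (rule continuous_on_interior) (simp add: interior_atLeastAtMost_real)
  qed
  then show ?thesis by (simp add: continuous_at_imp_continuous_on)
qed

lemma has_ac_derivative_cong:
  assumes g: "has_ac_derivative g h" and eq: "AE x in lebesgue. h x = k x"
  shows "has_ac_derivative g k"
proof (rule has_ac_derivativeI)
  show "locally_integrable k"
    using locally_integrable_spike[OF has_ac_derivative_locally_integrable[OF g] eq] .
  obtain N where N: "negligible N" "{x. h x \<noteq> k x} \<subseteq> N"
    using eq unfolding eventually_ae_filter_negligible by auto
  show "integral {a..b} k = g b - g a" if "a \<le> b" for a b
  proof -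
    have "k x = h x" if "x \<in> {a..b} - N" for x using that subsetD[OF N(2), of x] by (cases "h x = k x") auto
    then show ?thesis
      using has_ac_derivative_integral[OF g that] integral_spike[OF N(1), of "{a..b}" k h] by simp
  qed
qed

lemma has_ac_derivative_linear:
  assumes g: "has_ac_derivative g h" and L: "bounded_linear L"
  shows "has_ac_derivative (\<lambda>x. L (g x)) (\<lambda>x. L (h x))"
proof (rule has_ac_derivativeI)
  show "locally_integrable (\<lambda>x. L (h x))"
    by (rule locally_integrable_linear[OF has_ac_derivative_locally_integrable[OF g] L])
  show "integral {a..b} (\<lambda>x. L (h x)) = L (g b) - L (g a)" if "a \<le> b" for a b
    using integral_linear[OF locally_integrable_integrable[OF has_ac_derivative_locally_integrable[OF g]] L, of a b]
      has_ac_derivative_integral[OF g that] by (simp add: o_def linear_diff[OF bounded_linear.linear[OF L]])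
qed

lemma has_ac_derivative_cmult: "has_ac_derivative g h \<Longrightarrow> has_ac_derivative (\<lambda>x. c * g x) (\<lambda>x. c * h x)"
  by (rule has_ac_derivative_linear) (auto intro: bounded_linear_mult_right)

lemma has_ac_derivative_add:
  assumes "has_ac_derivative g h" "has_ac_derivative g' h'"
  shows "has_ac_derivative (\<lambda>x. g x + g' x) (\<lambda>x. h x + h' x)"
  using assms unfolding has_ac_derivative_def
  by (auto intro!: set_integral_add(1) has_integral_eq_rhs[OF has_integral_add])

lemma has_ac_derivative_diff:
  assumes "has_ac_derivative g h" "has_ac_derivative g' h'"
  shows "has_ac_derivative (\<lambda>x. g x - g' x) (\<lambda>x. h x - h' x)"
  using has_ac_derivative_add[OF assms(1) has_ac_derivative_cmult[OF assms(2), of "-1"]] by simp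

lemma has_ac_derivative_C1:
  assumes "\<And>x. (g has_vector_derivative h x) (at x)" "continuous_on UNIV h"
  shows "has_ac_derivative g h"
  unfolding has_ac_derivative_def
  using locally_integrable_continuous[OF assms(2)]
    fundamental_theorem_of_calculus[OF _ has_vector_derivative_at_within[OF assms(1)]]
  by (auto simp: locally_integrable_def)

text \<open>The defect \<open>E c d\<close> of the product formula is additive over adjacent
  intervals. On a short interval \<open>F\<close> and \<open>G\<close> vary by at most
  \<open>e\<close>, so the defect is at most \<open>e\<close> times the integral of
  \<open>w\<close>. Subdivision carries this bound to {a..b}, and \<open>e\<close> is
  arbitrary.\<close>

lemma has_ac_derivative_mult:
  assumes F: "has_ac_derivative F f" and G: "has_ac_derivative G g"
  shows "has_ac_derivative (\<lambda>x. F x * G x) (\<lambda>x. f x * G x + F x * g x)"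
proof (rule has_ac_derivativeI)
  note lF = has_ac_derivative_locally_integrable[OF F] and lG = has_ac_derivative_locally_integrable[OF G]
  note cF = has_ac_derivative_continuous[OF F] and cG = has_ac_derivative_continuous[OF G]
  have lFg: "locally_integrable (\<lambda>x. F x * g x)"
    using locally_integrable_mult[OF lG cF] by (simp add: mult.commute)
  show li: "locally_integrable (\<lambda>x. f x * G x + F x * g x)"
    by (intro locally_integrable_add locally_integrable_mult lF cG lFg)
  define w where "w x = norm (f x) + norm (g x)" for x
  have w: "locally_integrable w"
    unfolding w_def by (intro locally_integrable_add locally_integrable_norm lF lG)
  fix a b :: real assume ab: "a \<le> b"
  define E where "E c d = F d * G d - F c * G c - integral {c..d} (\<lambda>x. f x * G x + F x * g x)" for c d
  have small: "norm (E a b) \<le> e * integral {a..b} w" if e: "e > 0" for e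
    using ab
  proof (induction rule: Bolzano)
    case (trans c d e')
    have "E c e' = E c d + E d e'"
      using Henstock_Kurzweil_Integration.integral_combine[OF trans(3,4) locally_integrable_integrable[OF li]]
      by (simp add: E_def algebra_simps)
    moreover have "integral {c..d} w + integral {d..e'} w = integral {c..e'} w"
      using Henstock_Kurzweil_Integration.integral_combine[OF trans(3,4) locally_integrable_integrable[OF w]] .
    ultimately show ?case
      using trans(1,2) norm_triangle_ineq[of "E c d" "E d e'"] by (simp add: distrib_left flip: \<open>integral {c..d} w + _ = _\<close>)
  next
    case (local x)
    have "isCont F x" "isCont G x" using cF[of UNIV] cG[of UNIV] by (auto simp: continuous_on_eq_continuous_at)
    moreover have "e / 2 > 0" using e by simp
    ultimately have "\<exists>r>0. \<forall>y. dist y x < r \<longrightarrow> dist (F y) (F x) < e / 2"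
      "\<exists>r>0. \<forall>y. dist y x < r \<longrightarrow> dist (G y) (G x) < e / 2"
      unfolding continuous_at_eps_delta by blast+
    then obtain r1 r2 where r: "r1 > 0" "\<And>y. dist y x < r1 \<Longrightarrow> dist (F y) (F x) < e / 2"
      "r2 > 0" "\<And>y. dist y x < r2 \<Longrightarrow> dist (G y) (G x) < e / 2"
      by blast
    show ?case
    proof (intro exI[of _ "min r1 r2"] conjI allI impI)
      show "0 < min r1 r2" using r by simp
      fix c d assume cd: "c \<le> x \<and> x \<le> d \<and> d - c < min r1 r2"
      then have cd': "c \<le> d" by simp
      have near: "dist y x < min r1 r2" if "y \<in> {c..d}" for y
        using that cd by (auto simp: dist_real_def)
      have bd: "norm (G d - G y) \<le> e" "norm (F c - F y) \<le> e" if y: "y \<in> {c..d}" for y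
      proof -
        have "dist (F y) (F x) < e / 2" "dist (F c) (F x) < e / 2"
          "dist (G y) (G x) < e / 2" "dist (G d) (G x) < e / 2"
          using r(2)[of y] r(2)[of c] r(4)[of y] r(4)[of d] near[OF y] near[of c] near[of d] cd' by simp_all
        then show "norm (G d - G y) \<le> e" "norm (F c - F y) \<le> e"
          using dist_triangle2[of "G d" "G y" "G x"] dist_triangle2[of "F c" "F y" "F x"]
          by (auto simp: dist_norm)
      qed
      \<comment> \<open>With \<open>G\<close> frozen at the right end and \<open>F\<close> at the
        left end the integral is exactly \<open>F d * G d - F c * G c\<close>, so the defect is the
        integral of the freezing errors.\<close>
      have i1: "((\<lambda>y. f y * G d + F c * g y) has_integral (F d - F c) * G d + F c * (G d - G c)) {c..d}"
        by (intro has_integral_add has_integral_mult_left has_integral_mult_right has_ac_derivative_has_integral F G cd')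
      have "((\<lambda>y. (f y * G d + F c * g y) - (f y * G y + F y * g y)) has_integral E c d) {c..d}"
        by (rule has_integral_eq_rhs[OF has_integral_diff[OF i1 integrable_integral[OF locally_integrable_integrable[OF li]]]])
          (simp add: E_def algebra_simps)
      moreover have "(\<lambda>y. (f y * G d + F c * g y) - (f y * G y + F y * g y)) =
          (\<lambda>y. f y * (G d - G y) + (F c - F y) * g y)"
        by (simp add: algebra_simps)
      ultimately have i2: "((\<lambda>y. f y * (G d - G y) + (F c - F y) * g y) has_integral E c d) {c..d}" by simp
      have "norm (integral {c..d} (\<lambda>y. f y * (G d - G y) + (F c - F y) * g y)) \<le> integral {c..d} (\<lambda>y. e * w y)"
      proof (rule integral_norm_bound_integral)
        show "(\<lambda>y. e * w y) integrable_on {c..d}"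
          using locally_integrable_integrable[OF w] by (intro integrable_on_mult_right)
        fix y assume y: "y \<in> {c..d}"
        have "norm (f y * (G d - G y) + (F c - F y) * g y) \<le> norm (f y) * e + e * norm (g y)"
          by (intro norm_triangle_mono) (auto simp: norm_mult intro!: mult_mono bd[OF y] norm_ge_zero less_imp_le[OF e])
        then show "norm (f y * (G d - G y) + (F c - F y) * g y) \<le> e * w y"
          by (simp add: w_def algebra_simps)
      qed (use i2 in auto)
      then show "norm (E c d) \<le> e * integral {c..d} w"
        using integral_unique[OF i2] by simp
    qed
  qed
  have "norm (E a b) \<le> 0"
  proof (rule ccontr)
    assume n: "\<not> ?thesis"
    have W: "integral {a..b} w \<ge> 0" by (intro integral_nonneg locally_integrable_integrable w) (simp add: w_def)
    have "norm (E a b) \<le> norm (E a b) / 2 / (integral {a..b} w + 1) * integral {a..b} w"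
      using n W by (intro small) auto
    also have "\<dots> \<le> norm (E a b) / 2" using W by (intro divide_add_one_mult_le) auto
    finally show False using n by simp
  qed
  then show "integral {a..b} (\<lambda>x. f x * G x + F x * g x) = F b * G b - F a * G a"
    by (simp add: E_def)
qed

subsection \<open>The inhomogeneous equation\<close>

text \<open>The derivative is an explicit function and the equation is solved for the second
  derivative. One format then serves homogeneous solutions, resolvent functions and their
  conjugates, with Cauchy data available at every point.\<close>

definition schroedinger_pair ::
  "(real \<Rightarrow> real) \<Rightarrow> (real \<Rightarrow> complex) \<Rightarrow> (real \<Rightarrow> complex) \<Rightarrow> (real \<Rightarrow> complex) \<Rightarrow> bool" where
  "schroedinger_pair V \<psi> u u' \<longleftrightarrow>
     (\<forall>x. (u has_vector_derivative u' x) (at x)) \<and>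
     has_ac_derivative u' (\<lambda>x. complex_of_real (V x) * u x - \<psi> x)"

lemma schroedinger_eq_pair:
  assumes "schroedinger_eq V u \<psi>"
  shows "schroedinger_pair V \<psi> u (\<lambda>x. vector_derivative u (at x))"
proof -
  obtain w where w: "has_ac_derivative (\<lambda>x. vector_derivative u (at x)) w"
    "AE x in lebesgue. - w x + complex_of_real (V x) * u x = \<psi> x"
    using assms by (auto simp: schroedinger_eq_def)
  have "AE x in lebesgue. w x = complex_of_real (V x) * u x - \<psi> x"
    using w(2) by (rule AE_mp) (auto simp: algebra_simps)
  from has_ac_derivative_cong[OF w(1) this] show ?thesis
    using assms by (simp add: schroedinger_pair_def schroedinger_eq_def vector_derivative_works)
qed

lemma schroedinger_pair_derivative:
  "schroedinger_pair V \<psi> u u' \<Longrightarrow> vector_derivative u (at x) = u' x"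
  by (simp add: schroedinger_pair_def vector_derivative_at)

lemma schroedinger_pair_eq:
  assumes "schroedinger_pair V \<psi> u u'" shows "schroedinger_eq V u \<psi>"
  unfolding schroedinger_eq_def
proof (intro conjI exI)
  show "\<forall>x. u differentiable at x"
    using assms unfolding schroedinger_pair_def by (blast intro: differentiableI_vector)
  show "has_ac_derivative (\<lambda>x. vector_derivative u (at x)) (\<lambda>x. complex_of_real (V x) * u x - \<psi> x)"
    using assms by (simp add: schroedinger_pair_derivative[OF assms] schroedinger_pair_def)
qed simp

lemma schroedinger_pair_ac:
  assumes "schroedinger_pair V \<psi> u u'" shows "has_ac_derivative u u'"
  using assms by (intro has_ac_derivative_C1) (auto simp: schroedinger_pair_def intro: has_ac_derivative_continuous)

lemma schroedinger_pair_ac':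
  "schroedinger_pair V \<psi> u u' \<Longrightarrow> has_ac_derivative u' (\<lambda>x. complex_of_real (V x) * u x - \<psi> x)"
  by (simp add: schroedinger_pair_def)

lemma schroedinger_pair_continuous:
  assumes "schroedinger_pair V \<psi> u u'"
  shows "continuous_on S u" "continuous_on S u'"
  using has_ac_derivative_continuous schroedinger_pair_ac[OF assms] schroedinger_pair_ac'[OF assms] by blast+

lemma schroedinger_pair_cong:
  assumes "schroedinger_pair V \<psi> u u'" "AE x in lebesgue. \<psi> x = \<eta> x"
  shows "schroedinger_pair V \<eta> u u'"
  unfolding schroedinger_pair_def
proof
  show "has_ac_derivative u' (\<lambda>x. complex_of_real (V x) * u x - \<eta> x)"
    by (rule has_ac_derivative_cong[OF schroedinger_pair_ac'[OF assms(1)]])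
      (rule AE_mp[OF assms(2)], auto)
qed (use assms in \<open>simp add: schroedinger_pair_def\<close>)

lemma schroedinger_pair_combine:
  assumes "schroedinger_pair V \<psi> u u'" "schroedinger_pair V \<eta> v v'"
  shows "schroedinger_pair V (\<lambda>x. a * \<psi> x + b * \<eta> x) (\<lambda>x. a * u x + b * v x) (\<lambda>x. a * u' x + b * v' x)"
  unfolding schroedinger_pair_def
proof (intro conjI allI)
  show "((\<lambda>x. a * u x + b * v x) has_vector_derivative a * u' x + b * v' x) (at x)" for x
    using assms by (intro has_vector_derivative_add has_vector_derivative_mult_right) (auto simp: schroedinger_pair_def)
  show "has_ac_derivative (\<lambda>x. a * u' x + b * v' x)
      (\<lambda>x. complex_of_real (V x) * (a * u x + b * v x) - (a * \<psi> x + b * \<eta> x))"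
    using has_ac_derivative_add[OF has_ac_derivative_cmult[OF schroedinger_pair_ac'[OF assms(1)], of a]
        has_ac_derivative_cmult[OF schroedinger_pair_ac'[OF assms(2)], of b]]
    by (simp add: algebra_simps)
qed

lemma schroedinger_pair_cnj:
  assumes "schroedinger_pair V \<psi> u u'"
  shows "schroedinger_pair V (\<lambda>x. cnj (\<psi> x)) (\<lambda>x. cnj (u x)) (\<lambda>x. cnj (u' x))"
  unfolding schroedinger_pair_def
proof (intro conjI allI)
  show "((\<lambda>x. cnj (u x)) has_vector_derivative cnj (u' x)) (at x)" for x
    using assms by (intro bounded_linear.has_vector_derivative[OF bounded_linear_cnj]) (simp add: schroedinger_pair_def)
  show "has_ac_derivative (\<lambda>x. cnj (u' x)) (\<lambda>x. complex_of_real (V x) * cnj (u x) - cnj (\<psi> x))"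
    using has_ac_derivative_linear[OF schroedinger_pair_ac'[OF assms] bounded_linear_cnj] by simp
qed

lemma schroedinger_pair_locally_integrable:
  assumes "schroedinger_pair V \<psi> u u'" and V: "locally_integrable V"
  shows "locally_integrable \<psi>"
proof -
  have "locally_integrable (\<lambda>x. complex_of_real (V x) * u x - (complex_of_real (V x) * u x - \<psi> x))"
    by (intro locally_integrable_diff locally_integrable_mult locally_integrable_linear[OF V]
        schroedinger_pair_continuous[OF assms(1)] bounded_linear_of_real
        has_ac_derivative_locally_integrable[OF schroedinger_pair_ac'[OF assms(1)]])
  then show ?thesis by simp
qed

text \<open>The terms with u' v' and with V u v cancel. In integrated form this is Green's formula,
  the source of symmetry, of the energy bound and of the lower bound on Cauchy data.\<close>

lemma wronskian_ac_derivative: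
  assumes "schroedinger_pair V \<psi> u u'" "schroedinger_pair V \<eta> v v'"
  shows "has_ac_derivative (\<lambda>x. u x * v' x - u' x * v x) (\<lambda>x. \<psi> x * v x - u x * \<eta> x)"
proof -
  have "has_ac_derivative (\<lambda>x. u x * v' x - u' x * v x)
     (\<lambda>x. (u' x * v' x + u x * (complex_of_real (V x) * v x - \<eta> x)) -
          ((complex_of_real (V x) * u x - \<psi> x) * v x + u' x * v' x))"
    by (intro has_ac_derivative_diff has_ac_derivative_mult schroedinger_pair_ac[OF assms(1)]
        schroedinger_pair_ac[OF assms(2)] schroedinger_pair_ac'[OF assms(1)] schroedinger_pair_ac'[OF assms(2)])
  then show ?thesis by (simp add: algebra_simps)
qed


lemma integral_nonneg_mono_interval:
  fixes h :: "real \<Rightarrow> real"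
  assumes h: "locally_integrable h" and "\<And>x. h x \<ge> 0" and "{c..d} \<subseteq> {a..b}"
  shows "integral {c..d} h \<le> integral {a..b} h"
  using assms by (intro integral_subset_le locally_integrable_integrable) auto

text \<open>The bound only involves the \<open>L\<^sup>1\<close> norm of \<open>V\<close>: the oscillation of \<open>u'\<close> over the interval is at
  most \<open>K sup \<bar>u\<bar> + \<integral> \<bar>\<psi>\<bar>\<close>, so \<open>u\<close> cannot be small in the mean with a large derivative.\<close>

lemma local_estimate:
  assumes u: "schroedinger_pair V \<psi> u u'" and V: "locally_integrable V"
    and K: "integral {a..a+1} (\<lambda>x. \<bar>V x\<bar>) \<le> K" and x: "x \<in> {a..a+1}"
  shows "norm (u x) + norm (u' x) \<le> (4 * (2 + K) * (3 + K) + 1) *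
    (integral {a..a+1} (\<lambda>x. norm (u x)) + integral {a..a+1} (\<lambda>x. norm (\<psi> x)))"
proof -
  note psi = schroedinger_pair_locally_integrable[OF u V]
  note cu = schroedinger_pair_continuous(1)[OF u]
  have lu: "locally_integrable (\<lambda>x. norm (u x))" by (intro locally_integrable_norm locally_integrable_continuous cu)
  have lV: "locally_integrable (\<lambda>x. \<bar>V x\<bar>)" using locally_integrable_norm[OF V] by simp
  have lpsi: "locally_integrable (\<lambda>x. norm (\<psi> x))" using locally_integrable_norm[OF psi] .
  define I where "I = integral {a..a+1} (\<lambda>x. norm (u x))"
  define P where "P = integral {a..a+1} (\<lambda>x. norm (\<psi> x))"
  define L where "L = 2 + K"
  have I0: "0 \<le> I" unfolding I_def by (intro integral_nonneg locally_integrable_integrable lu) auto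
  have P0: "0 \<le> P" unfolding P_def by (intro integral_nonneg locally_integrable_integrable lpsi) auto
  have "0 \<le> integral {a..a+1} (\<lambda>x. \<bar>V x\<bar>)" by (intro integral_nonneg locally_integrable_integrable lV) auto
  then have K0: "0 \<le> K" using K by simp
  then have L: "L \<ge> 2" by (simp add: L_def)
  obtain x0 where x0: "x0 \<in> {a..a+1}" "\<And>y. y \<in> {a..a+1} \<Longrightarrow> norm (u y) \<le> norm (u x0)"
    using continuous_attains_sup[of "{a..a+1}" "\<lambda>x. norm (u x)", OF _ _ continuous_on_norm[OF cu]]
    by auto
  define s where "s = norm (u x0)"
  have s0: "0 \<le> s" by (simp add: s_def)
  have osc1: "norm (u' d - u' c) \<le> K * s + P" if cd: "c \<le> d" "c \<in> {a..a+1}" "d \<in> {a..a+1}" for c d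
  proof -
    have sub: "{c..d} \<subseteq> {a..a+1}" using cd by auto
    have "norm (integral {c..d} (\<lambda>x. complex_of_real (V x) * u x - \<psi> x)) \<le>
        integral {c..d} (\<lambda>x. \<bar>V x\<bar> * s + norm (\<psi> x))"
    proof (rule integral_norm_bound_integral)
      show "(\<lambda>x. complex_of_real (V x) * u x - \<psi> x) integrable_on {c..d}"
        using schroedinger_pair_ac'[OF u] has_ac_derivative_locally_integrable locally_integrable_integrable by blast
      show "(\<lambda>x. \<bar>V x\<bar> * s + norm (\<psi> x)) integrable_on {c..d}"
        by (intro integrable_add integrable_on_mult_left locally_integrable_integrable lV lpsi)
      fix y assume "y \<in> {c..d}"
      then have "norm (u y) \<le> s" using x0(2) sub by (auto simp: s_def)
      have "norm (complex_of_real (V y) * u y - \<psi> y) \<le> norm (complex_of_real (V y) * u y) + norm (\<psi> y)"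
        by (rule norm_triangle_ineq4)
      also have "\<dots> \<le> \<bar>V y\<bar> * s + norm (\<psi> y)"
        using \<open>norm (u y) \<le> s\<close> by (simp add: norm_mult mult_left_mono)
      finally show "norm (complex_of_real (V y) * u y - \<psi> y) \<le> \<bar>V y\<bar> * s + norm (\<psi> y)" .
    qed
    also have "\<dots> = integral {c..d} (\<lambda>x. \<bar>V x\<bar>) * s + integral {c..d} (\<lambda>x. norm (\<psi> x))"
      by (subst integral_add[OF integrable_on_mult_left[OF locally_integrable_integrable[OF lV]]
            locally_integrable_integrable[OF lpsi]]) simp
    also have "\<dots> \<le> integral {a..a+1} (\<lambda>x. \<bar>V x\<bar>) * s + P"
      unfolding P_def
      by (intro add_mono mult_right_mono integral_nonneg_mono_interval lV lpsi sub s0) auto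
    also have "\<dots> \<le> K * s + P" using K s0 by (intro add_right_mono mult_right_mono)
    finally show ?thesis
      by (simp add: has_ac_derivative_integral[OF schroedinger_pair_ac'[OF u] cd(1)])
  qed
  have osc: "norm (u' d - u' c) \<le> K * s + P" if "c \<in> {a..a+1}" "d \<in> {a..a+1}" for c d
    using osc1[of c d] osc1[of d c] that by (cases "c \<le> d") (auto simp: norm_minus_commute)
  \<comment> \<open>The mean of \<open>u'\<close> over the unit interval is
    \<open>u (a+1) - u a\<close>, of norm at most \<open>2 * s\<close>; adding the oscillation bound
    gives the constant L = 2 + K.\<close>
  have du: "norm (u' y) \<le> L * s + P" if y: "y \<in> {a..a+1}" for y
  proof -
    have "((\<lambda>t. u' t - u' y) has_integral (u (a+1) - u a) - (a + 1 - a) *\<^sub>R u' y) {a..a+1}"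
      using has_integral_diff[OF has_ac_derivative_has_integral[OF schroedinger_pair_ac[OF u], of a "a+1"]
          has_integral_const_real[of "u' y" a "a+1"]] by simp
    then have h: "((\<lambda>t. u' t - u' y) has_integral (u (a+1) - u a) - u' y) {a..a+1}" by simp
    have "norm ((u (a+1) - u a) - u' y) \<le> (K * s + P) * measure lborel {a..a+1}"
      by (rule has_integral_bound_real[OF _ finite.emptyI h]) (use osc[OF y] K0 s0 P0 in \<open>auto simp: norm_minus_commute\<close>)
    then have "norm ((u (a+1) - u a) - u' y) \<le> K * s + P" by simp
    moreover have "norm (u (a+1)) \<le> s" "norm (u a) \<le> s" using x0(2) by (auto simp: s_def)
    ultimately have "norm (u' y) \<le> s + s + (K * s + P)"
      using norm_triangle_ineq4[of "u (a+1) - u a" "(u (a+1) - u a) - u' y"] norm_triangle_ineq4[of "u (a+1)" "u a"]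
      by simp
    then show ?thesis by (simp add: L_def algebra_simps)
  qed
  \<comment> \<open>Over a length \<delta> the part \<open>L * s\<close> of the derivative bound
    lowers \<open>norm u\<close> by at most s/2. Since \<delta> is at most 1/4, an interval of this
    length fits on at least one side of \<open>x0\<close>.\<close>
  define \<delta> where "\<delta> = 1 / (2 * L)"
  have \<delta>: "0 < \<delta>" "\<delta> \<le> 1/4" using L by (auto simp: \<delta>_def field_simps)
  obtain c where c: "{c..c+\<delta>} \<subseteq> {a..a+1}" "x0 \<in> {c..c+\<delta>}"
  proof (cases "x0 \<le> a + 1/2")
    case True then show ?thesis using x0 \<delta> by (intro that[of x0]) auto
  next
    case False then show ?thesis using x0 \<delta> by (intro that[of "x0 - \<delta>"]) auto
  qed
  have low: "s - \<delta> * (L * s + P) \<le> norm (u y)" if y: "y \<in> {c..c+\<delta>}" for y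
  proof -
    have "norm (u x0 - u y) \<le> (L * s + P) * norm (x0 - y)"
    proof (rule differentiable_bound[of "{a..a+1}" u "\<lambda>z r. r *\<^sub>R u' z"])
      fix z assume z: "z \<in> {a..a+1}"
      show "(u has_derivative (\<lambda>r. r *\<^sub>R u' z)) (at z within {a..a+1})"
        using u by (auto simp: schroedinger_pair_def has_vector_derivative_def intro: has_derivative_at_withinI)
      show "onorm (\<lambda>r. r *\<^sub>R u' z) \<le> L * s + P"
        using du[OF z] by (intro onorm_le) (simp add: mult.commute mult_left_mono)
    qed (use y c x0 in auto)
    also have "\<dots> \<le> (L * s + P) * \<delta>"
      using y c(2) L s0 P0 by (intro mult_left_mono) (auto simp: abs_le_iff)
    finally have "norm (u x0 - u y) \<le> \<delta> * (L * s + P)" by (simp add: mult.commute)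
    then show ?thesis using norm_triangle_ineq2[of "u x0" "u y"] by (simp add: s_def)
  qed
  have "\<delta> * (s - \<delta> * (L * s + P)) = integral {c..c+\<delta>} (\<lambda>y. s - \<delta> * (L * s + P))"
    using \<delta> by simp
  also have "\<dots> \<le> integral {c..c+\<delta>} (\<lambda>y. norm (u y))"
    by (rule integral_le[OF integrable_const_ivl locally_integrable_integrable[OF lu] low])
  also have "\<dots> \<le> I" unfolding I_def by (intro integral_nonneg_mono_interval lu c) auto
  finally have 1: "\<delta> * (s - \<delta> * (L * s + P)) \<le> I" .
  have "2 * L * (\<delta> * (s - \<delta> * (L * s + P))) = s / 2 - P / (2 * L)"
    using L by (simp add: \<delta>_def field_simps)
  then have "s / 2 \<le> 2 * L * I + P / (2 * L)"
    using mult_left_mono[OF 1, of "2 * L"] L by simp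
  moreover have "P / (2 * L) \<le> 2 * L * P"
  proof -
    have "P * 1 \<le> P * (4 * L * L)" using P0 L mult_mono[of 1 L 1 L] by (intro mult_left_mono) auto
    then show ?thesis using L by (simp add: field_simps)
  qed
  ultimately have s: "s \<le> 4 * L * (I + P)" by (simp add: algebra_simps)
  have "norm (u x) + norm (u' x) \<le> s + (L * s + P)"
    using du[OF x] x0(2)[OF x] by (simp add: s_def)
  also have "\<dots> = (1 + L) * s + P" by (simp add: algebra_simps)
  also have "\<dots> \<le> (1 + L) * (4 * L * (I + P)) + (I + P)"
    using L I0 by (intro add_mono mult_left_mono s) auto
  also have "\<dots> = (4 * L * (1 + L) + 1) * (I + P)" by (simp add: algebra_simps)
  finally show ?thesis by (simp add: I_def P_def L_def)
qed


subsection \<open>Existence of solutions of initial value problems\<close>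

text \<open>The primitive vanishing at 0, on the whole line: for x of either sign one of the two
  integrals is over an empty interval, and at 0 both are over a point.\<close>

definition prim :: "(real \<Rightarrow> 'b::euclidean_space) \<Rightarrow> real \<Rightarrow> 'b" where
  "prim h x = integral {0..x} h - integral {x..0} h"

lemma prim_nonneg: "0 \<le> x \<Longrightarrow> prim h x = integral {0..x} h"
  by (cases "x = 0") (auto simp: prim_def)

lemma prim_nonpos: "x \<le> 0 \<Longrightarrow> prim h x = - integral {x..0} h"
  by (cases "x = 0") (auto simp: prim_def)

lemma prim_0 [simp]: "prim h 0 = 0"
  by (simp add: prim_def)

lemma prim_diff:
  assumes h: "locally_integrable h" and ab: "a \<le> b"
  shows "prim h b - prim h a = integral {a..b} h"
proof -
  note c = Henstock_Kurzweil_Integration.integral_combine[OF _ _ locally_integrable_integrable[OF h]]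
  consider "0 \<le> a" | "a \<le> 0" "0 \<le> b" | "b \<le> 0" by linarith
  then show ?thesis
  proof cases
    case 1 then show ?thesis using ab c[of 0 a b] by (simp add: prim_nonneg algebra_simps)
  next
    case 2 then show ?thesis using c[of a 0 b] by (simp add: prim_nonneg prim_nonpos algebra_simps)
  next
    case 3 then show ?thesis using ab c[of a b 0] by (simp add: prim_nonpos algebra_simps)
  qed
qed

lemma has_ac_derivative_prim: "locally_integrable h \<Longrightarrow> has_ac_derivative (\<lambda>x. c + prim h x) h"
  by (rule has_ac_derivativeI) (simp_all add: prim_diff[symmetric])

lemma continuous_prim: "locally_integrable h \<Longrightarrow> continuous_on S (prim h :: real \<Rightarrow> complex)"
  using has_ac_derivative_continuous[OF has_ac_derivative_prim[of h 0]] by simp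

lemma has_ac_derivative_vector_derivative:
  assumes F: "has_ac_derivative F f" and f: "continuous_on UNIV f"
  shows "(F has_vector_derivative f x) (at x)"
proof -
  have "((\<lambda>y. integral {x-1..y} f) has_vector_derivative f x) (at x within {x-1..x+1})"
    by (rule integral_has_vector_derivative) (use f continuous_on_subset in auto)
  then have "((\<lambda>y. F (x-1) + integral {x-1..y} f) has_vector_derivative f x) (at x within {x-1..x+1})"
    by (auto intro!: derivative_eq_intros)
  then have "(F has_vector_derivative f x) (at x within {x-1..x+1})"
    by (rule has_vector_derivative_transform[rotated 2]) (use has_ac_derivative_integral[OF F] in auto)
  then show ?thesis using at_within_Icc_at[of "x-1" x "x+1"] by simp
qed

text \<open>By the product rule \<open>k * prim k ^ n\<close> is the derivative of
  \<open>prim k ^ Suc n / Suc n\<close>. This is where iterated integrals gain their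
  factorials.\<close>

lemma integral_prim_power:
  assumes k: "locally_integrable (k :: real \<Rightarrow> real)" and "a \<le> b"
  shows "((\<lambda>x. k x * prim k x ^ n) has_integral (prim k b ^ Suc n - prim k a ^ Suc n) / real (Suc n)) {a..b}"
proof -
  \<comment> \<open>The product rule is stated for complex functions; the real identity is read off
    as a real part.\<close>
  define kc where "kc x = complex_of_real (k x)" for x
  have kc: "locally_integrable kc"
    unfolding kc_def by (rule locally_integrable_linear[OF k bounded_linear_of_real])
  have pk: "prim kc x = complex_of_real (prim k x)" for x
    using integral_linear[OF locally_integrable_integrable[OF k] bounded_linear_of_real[where 'a = complex]]
    by (simp add: prim_def kc_def[abs_def] o_def)
  have D: "has_ac_derivative (prim kc) kc" using has_ac_derivative_prim[OF kc, of 0] by simp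
  have pow: "has_ac_derivative (\<lambda>x. prim kc x ^ Suc n) (\<lambda>x. of_nat (Suc n) * (kc x * prim kc x ^ n))" for n
  proof (induction n)
    case (Suc n)
    show ?case
      using has_ac_derivative_mult[OF Suc D] by (simp add: algebra_simps)
  qed (use D in simp)
  have "((\<lambda>x. real (Suc n) * (k x * prim k x ^ n)) has_integral prim k b ^ Suc n - prim k a ^ Suc n) {a..b}"
  proof -
    have "of_nat (Suc n) * (kc x * prim kc x ^ n) = complex_of_real (real (Suc n) * (k x * prim k x ^ n))" for x
      by (simp add: pk kc_def)
    moreover have "prim kc b ^ Suc n - prim kc a ^ Suc n = complex_of_real (prim k b ^ Suc n - prim k a ^ Suc n)"
      by (simp add: pk)
    ultimately show ?thesis
      using has_integral_Re[OF has_ac_derivative_has_integral[OF pow assms(2), of n]]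
      by (simp only: Re_complex_of_real)
  qed
  from has_integral_divide[OF this, of "real (Suc n)"] show ?thesis by (simp del: of_nat_Suc)
qed

text \<open>One step of the iteration: the n-th term of the exponential series of \<bar>prim k\<bar>
  is integrated to the next one. The two half-lines are treated apart because \<open>prim k\<close>
  is negative to the left of 0, whence the factors \<open>(-1) ^ n\<close>.\<close>

lemma prim_power_bound:
  fixes h :: "real \<Rightarrow> complex" and k :: "real \<Rightarrow> real"
  assumes h: "locally_integrable h" and k: "locally_integrable k" and k0: "\<And>s. k s \<ge> 0" and M: "M \<ge> 0"
    and le: "\<And>s. \<bar>s\<bar> \<le> \<bar>x\<bar> \<Longrightarrow> norm (h s) \<le> k s * (M * \<bar>prim k s\<bar> ^ n / fact n)"
  shows "norm (prim h x) \<le> M * \<bar>prim k x\<bar> ^ Suc n / fact (Suc n)"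
proof (cases "0 \<le> x")
  case True
  have pos: "prim k s \<ge> 0" if "s \<ge> 0" for s
    using that by (auto simp: prim_nonneg intro!: integral_nonneg locally_integrable_integrable k k0)
  note I = has_integral_mult_right[OF integral_prim_power[OF k True, of n], of "M / fact n"]
  have "norm (integral {0..x} h) \<le> integral {0..x} (\<lambda>s. M / fact n * (k s * prim k s ^ n))"
  proof (rule integral_norm_bound_integral)
    fix s assume "s \<in> {0..x}"
    then show "norm (h s) \<le> M / fact n * (k s * prim k s ^ n)"
      using le[of s] pos[of s] True by (simp add: field_simps)
  qed (use I locally_integrable_integrable[OF h] in auto)
  then show ?thesis
    using True pos[OF True] unfolding integral_unique[OF I] by (simp add: prim_nonneg field_simps)
next
  case False
  then have x: "x \<le> 0" by simp
  have neg: "prim k s \<le> 0" if "s \<le> 0" for s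
    using that by (auto simp: prim_nonpos intro!: integral_nonneg locally_integrable_integrable k k0)
  note I = has_integral_mult_right[OF integral_prim_power[OF k x, of n], of "M / fact n * (-1) ^ n"]
  have ab: "\<bar>prim k s\<bar> ^ m = (-1) ^ m * prim k s ^ m" if "s \<le> 0" for s m
    using neg[OF that] by (simp add: abs_of_nonpos flip: power_mult_distrib)
  have "norm (integral {x..0} h) \<le> integral {x..0} (\<lambda>s. M / fact n * (-1) ^ n * (k s * prim k s ^ n))"
  proof (rule integral_norm_bound_integral)
    fix s assume s: "s \<in> {x..0}"
    then show "norm (h s) \<le> M / fact n * (-1) ^ n * (k s * prim k s ^ n)"
      using le[of s] x by (simp add: ab field_simps)
  qed (use I locally_integrable_integrable[OF h] in auto)
  then show ?thesis
    using x unfolding integral_unique[OF I] ab[OF x] by (simp add: prim_nonpos field_simps)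
qed

text \<open>The partial sums are dominated by \<open>k s * suminf B\<close>, so dominated
  convergence exchanges sum and integral on every subinterval of {-X..X}.\<close>

lemma
  fixes h :: "nat \<Rightarrow> real \<Rightarrow> complex"
  assumes h: "\<And>n. locally_integrable (h n)" and k: "locally_integrable k" and B: "summable B" "\<And>n. B n \<ge> 0"
    and le: "\<And>n s. \<bar>s\<bar> \<le> X \<Longrightarrow> norm (h n s) \<le> k s * B n"
  shows integrable_suminf: "(\<lambda>s. \<Sum>n. h n s) absolutely_integrable_on {-X..X}"
    and prim_sums: "\<bar>x\<bar> \<le> X \<Longrightarrow> (\<lambda>n. prim (h n) x) sums prim (\<lambda>s. \<Sum>n. h n s) x"
proof -
  have sm: "summable (\<lambda>n. norm (h n s))" if "\<bar>s\<bar> \<le> X" for s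
    by (rule summable_comparison_test'[OF summable_mult[OF B(1), of "k s"], of 0]) (use le[OF that] in auto)
  have main: "(\<lambda>s. \<Sum>n. h n s) integrable_on {c..d}"
    "(\<lambda>n. integral {c..d} (h n)) sums integral {c..d} (\<lambda>s. \<Sum>n. h n s)"
    if sub: "{c..d} \<subseteq> {-X..X}" for c d
  proof -
    have ib: "(\<lambda>s. \<Sum>i<n. h i s) integrable_on {c..d}" for n
      by (intro integrable_sum locally_integrable_integrable h) auto
    have kb: "(\<lambda>s. k s * suminf B) integrable_on {c..d}"
      by (intro integrable_on_mult_left locally_integrable_integrable k)
    have le': "norm (\<Sum>i<n. h i s) \<le> k s * suminf B" if "s \<in> {c..d}" for n s
    proof -
      have s: "\<bar>s\<bar> \<le> X" using that sub by (auto simp: abs_le_iff)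
      have "norm (\<Sum>i<n. h i s) \<le> (\<Sum>i<n. norm (h i s))" by (rule norm_sum)
      also have "\<dots> \<le> (\<Sum>i. norm (h i s))" by (rule sum_le_suminf[OF sm[OF s]]) auto
      also have "\<dots> \<le> (\<Sum>i. k s * B i)" by (intro suminf_le le s sm summable_mult B)
      also have "\<dots> = k s * suminf B" by (rule suminf_mult[OF B(1)])
      finally show ?thesis .
    qed
    have lim: "(\<lambda>n. \<Sum>i<n. h i s) \<longlonglongrightarrow> (\<Sum>n. h n s)" if "s \<in> {c..d}" for s
      using summable_LIMSEQ[OF summable_norm_cancel[OF sm[of s]]] that sub by (auto simp: abs_le_iff)
    show "(\<lambda>s. \<Sum>n. h n s) integrable_on {c..d}"
      by (rule dominated_convergence(1)[OF ib kb le' lim])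
    have "(\<lambda>n. integral {c..d} (\<lambda>s. \<Sum>i<n. h i s)) \<longlonglongrightarrow> integral {c..d} (\<lambda>s. \<Sum>n. h n s)"
      by (rule dominated_convergence(2)[OF ib kb le' lim])
    moreover have "integral {c..d} (\<lambda>s. \<Sum>i<n. h i s) = (\<Sum>i<n. integral {c..d} (h i))" for n
      by (intro integral_sum locally_integrable_integrable h) auto
    ultimately show "(\<lambda>n. integral {c..d} (h n)) sums integral {c..d} (\<lambda>s. \<Sum>n. h n s)"
      by (simp add: sums_def)
  qed
  show "(\<lambda>s. \<Sum>n. h n s) absolutely_integrable_on {-X..X}"
  proof (rule absolutely_integrable_integrable_bound)
    show "(\<lambda>s. k s * suminf B) integrable_on {-X..X}"
      by (intro integrable_on_mult_left locally_integrable_integrable k)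
    fix s assume "s \<in> {-X..X}"
    then have s: "\<bar>s\<bar> \<le> X" by auto
    have "norm (\<Sum>i. h i s) \<le> (\<Sum>i. norm (h i s))" by (rule summable_norm[OF sm[OF s]])
    also have "\<dots> \<le> (\<Sum>i. k s * B i)" by (intro suminf_le le s sm summable_mult B)
    also have "\<dots> = k s * suminf B" by (rule suminf_mult[OF B(1)])
    finally show "norm (\<Sum>n. h n s) \<le> k s * suminf B" .
  qed (rule main, simp)
  show "(\<lambda>n. prim (h n) x) sums prim (\<lambda>s. \<Sum>n. h n s) x" if "\<bar>x\<bar> \<le> X"
    unfolding prim_def by (intro sums_diff main) (use that in auto)
qed

text \<open>The terms of the Neumann series for u = a + prim v, v = w + prim (q u), not its partial
  sums.\<close>

primrec picard :: "(real \<Rightarrow> complex) \<Rightarrow> complex \<Rightarrow> (real \<Rightarrow> complex) \<Rightarrow> nat \<Rightarrow>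
    (real \<Rightarrow> complex) \<times> (real \<Rightarrow> complex)" where
  "picard q a w 0 = ((\<lambda>x. a), w)"
| "picard q a w (Suc n) = (prim (snd (picard q a w n)), prim (\<lambda>x. q x * fst (picard q a w n) x))"

lemma picard_continuous:
  assumes q: "locally_integrable q" and w: "continuous_on UNIV w"
  shows "continuous_on UNIV (fst (picard q a w n)) \<and> continuous_on UNIV (snd (picard q a w n))"
proof (induction n)
  case (Suc n)
  then show ?case
    by (simp add: continuous_prim locally_integrable_continuous locally_integrable_mult[OF q])
qed (use w in auto)

lemma picard_bound:
  assumes q: "locally_integrable q" and w: "continuous_on UNIV w"
    and M: "\<And>s. \<bar>s\<bar> \<le> X \<Longrightarrow> norm a \<le> M \<and> norm (w s) \<le> M" and x: "\<bar>x\<bar> \<le> X"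
  shows "norm (fst (picard q a w n) x) \<le> M * \<bar>prim (\<lambda>s. 1 + norm (q s)) x\<bar> ^ n / fact n \<and>
    norm (snd (picard q a w n) x) \<le> M * \<bar>prim (\<lambda>s. 1 + norm (q s)) x\<bar> ^ n / fact n"
  using x
proof (induction n arbitrary: x)
  case 0 then show ?case using M by simp
next
  case (Suc n)
  let ?k = "\<lambda>s. 1 + norm (q s)"
  have k: "locally_integrable ?k"
    by (intro locally_integrable_add locally_integrable_norm q locally_integrable_continuous) auto
  have M0: "0 \<le> M" using M[of x] Suc.prems by (meson norm_ge_zero order_trans)
  have B0: "0 \<le> M * \<bar>prim ?k s\<bar> ^ n / fact n" for s using M0 by simp
  note c = picard_continuous[OF q w, of a n]
  show ?case unfolding picard.simps fst_conv snd_conv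
  proof (intro conjI prim_power_bound[OF _ k _ M0])
    show "norm (snd (picard q a w n) s) \<le> ?k s * (M * \<bar>prim ?k s\<bar> ^ n / fact n)" if "\<bar>s\<bar> \<le> \<bar>x\<bar>" for s
    proof -
      have "norm (snd (picard q a w n) s) \<le> 1 * (M * \<bar>prim ?k s\<bar> ^ n / fact n)"
        using Suc.IH[of s] Suc.prems that by simp
      also have "\<dots> \<le> ?k s * (M * \<bar>prim ?k s\<bar> ^ n / fact n)"
        by (rule mult_right_mono[OF _ B0]) simp
      finally show ?thesis .
    qed
    show "norm (q s * fst (picard q a w n) s) \<le> ?k s * (M * \<bar>prim ?k s\<bar> ^ n / fact n)" if "\<bar>s\<bar> \<le> \<bar>x\<bar>" for s
    proof -
      have "norm (q s * fst (picard q a w n) s) \<le> norm (q s) * (M * \<bar>prim ?k s\<bar> ^ n / fact n)"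
        unfolding norm_mult using Suc.IH[of s] Suc.prems that by (intro mult_left_mono) auto
      also have "\<dots> \<le> ?k s * (M * \<bar>prim ?k s\<bar> ^ n / fact n)"
        by (rule mult_right_mono[OF _ B0]) simp
      finally show ?thesis .
    qed
  qed (use c q in \<open>auto intro: locally_integrable_continuous locally_integrable_mult\<close>)
qed

text \<open>On {-X..X} the n-th term is at most M R^n / n!, with R the integral of 1 + \<bar>q\<bar>
  over that interval. The series therefore converges for every X, and the solution is
  global.\<close>

lemma volterra_system_solution:
  fixes q w :: "real \<Rightarrow> complex"
  assumes q: "locally_integrable q" and w: "continuous_on UNIV w"
  shows "\<exists>u v. locally_integrable v \<and> locally_integrable (\<lambda>x. q x * u x) \<and>
    (\<forall>x. u x = a + prim v x) \<and> (\<forall>x. v x = w x + prim (\<lambda>x. q x * u x) x)"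
proof -
  define us where "us n = fst (picard q a w n)" for n
  define vs where "vs n = snd (picard q a w n)" for n
  define u where "u x = (\<Sum>n. us n x)" for x
  define v where "v x = (\<Sum>n. vs n x)" for x
  let ?k = "\<lambda>s. 1 + norm (q s)"
  have k: "locally_integrable ?k"
    by (intro locally_integrable_add locally_integrable_norm q locally_integrable_continuous) auto
  have cont: "continuous_on UNIV (us n)" "continuous_on UNIV (vs n)" for n
    using picard_continuous[OF q w] by (auto simp: us_def vs_def)
  have bnd: "\<exists>B. summable B \<and> (\<forall>n. 0 \<le> B n) \<and> (\<forall>n s. \<bar>s\<bar> \<le> X \<longrightarrow> norm (us n s) \<le> B n \<and> norm (vs n s) \<le> B n)" for X
  proof -
    have "bounded (w ` {-X..X})"
      by (intro compact_imp_bounded compact_continuous_image continuous_on_subset[OF w]) auto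
    then obtain M0 where "\<forall>y\<in>w ` {-X..X}. norm y \<le> M0" unfolding bounded_iff by blast
    then have M0: "\<And>s. s \<in> {-X..X} \<Longrightarrow> norm (w s) \<le> M0" by blast
    define M where "M = max (norm a) M0"
    have M: "norm a \<le> M \<and> norm (w s) \<le> M" if "\<bar>s\<bar> \<le> X" for s
    proof -
      have "s \<in> {-X..X}" using that by auto
      from M0[OF this] show ?thesis by (auto simp: M_def)
    qed
    have Mn: "0 \<le> M" by (simp add: M_def max_def) (meson norm_ge_zero order_trans nle_le)
    define R where "R = integral {-X..X} ?k"
    have R: "\<bar>prim ?k s\<bar> \<le> R" if "\<bar>s\<bar> \<le> X" for s
    proof -
      have "integral {0..s} ?k \<le> R" "integral {s..0} ?k \<le> R" "0 \<le> integral {0..s} ?k" "0 \<le> integral {s..0} ?k"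
        unfolding R_def using that
        by (auto intro!: integral_nonneg_mono_interval[OF k] integral_nonneg locally_integrable_integrable[OF k])
      then show ?thesis by (cases "0 \<le> s") (auto simp: prim_nonneg prim_nonpos)
    qed
    have R0: "0 \<le> R" unfolding R_def by (intro integral_nonneg locally_integrable_integrable k) auto
    show ?thesis
    proof (intro exI[of _ "\<lambda>n. M * R ^ n / fact n"] conjI allI impI)
      show "summable (\<lambda>n. M * R ^ n / fact n)"
        using summable_mult[OF summable_exp[of R], of M] by (simp add: divide_inverse mult_ac)
      show "0 \<le> M * R ^ n / fact n" for n using Mn R0 by simp
      fix n s assume s: "\<bar>s\<bar> \<le> X"
      have "M * \<bar>prim ?k s\<bar> ^ n / fact n \<le> M * R ^ n / fact n"
        using R[OF s] Mn by (intro divide_right_mono mult_left_mono power_mono) auto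
      then show "norm (us n s) \<le> M * R ^ n / fact n" "norm (vs n s) \<le> M * R ^ n / fact n"
        using picard_bound[OF q w M s, of n] by (auto simp: us_def vs_def)
    qed
  qed
  have qus: "locally_integrable (\<lambda>x. q x * us n x)" for n
    by (intro locally_integrable_mult q cont)
  have sums: "(\<lambda>n. us n x) sums u x \<and> (\<lambda>n. vs n x) sums v x" for x
  proof -
    obtain B where B: "summable B" "\<And>n s. \<bar>s\<bar> \<le> \<bar>x\<bar> \<Longrightarrow> norm (us n s) \<le> B n \<and> norm (vs n s) \<le> B n"
      using bnd[of "\<bar>x\<bar>"] by blast
    have "summable (\<lambda>n. us n x)" "summable (\<lambda>n. vs n x)"
      by (rule summable_comparison_test'[OF B(1), of 0]; use B(2)[of x] in simp)+
    then show ?thesis by (simp add: u_def v_def summable_sums)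
  qed
  have main: "(\<lambda>n. prim (vs n) x) sums prim v x \<and> (\<lambda>n. prim (\<lambda>s. q s * us n s) x) sums prim (\<lambda>s. q s * u s) x \<and>
      v absolutely_integrable_on {-X..X} \<and> (\<lambda>s. q s * u s) absolutely_integrable_on {-X..X}" if x: "\<bar>x\<bar> \<le> X" for x X
  proof -
    obtain B where B: "summable B" "\<And>n. 0 \<le> B n" "\<And>n s. \<bar>s\<bar> \<le> X \<Longrightarrow> norm (us n s) \<le> B n \<and> norm (vs n s) \<le> B n"
      using bnd[of X] by blast
    have 1: "norm (vs n s) \<le> 1 * B n" if "\<bar>s\<bar> \<le> X" for n s
      using B(3)[OF that] by simp
    have 2: "norm (q s * us n s) \<le> norm (q s) * B n" if "\<bar>s\<bar> \<le> X" for n s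
      unfolding norm_mult using B(3)[OF that] by (intro mult_left_mono) auto
    have one: "locally_integrable (\<lambda>s::real. 1 :: real)" by (rule locally_integrable_continuous) auto
    have qsum: "(\<Sum>n. q s * us n s) = q s * u s" for s
      using sums_mult[of "\<lambda>n. us n s" "u s" "q s"] sums[of s] by (simp add: sums_iff)
    note I1 = integrable_suminf[OF locally_integrable_continuous[OF cont(2)] one B(1,2) 1]
      prim_sums[OF locally_integrable_continuous[OF cont(2)] one B(1,2) 1 x]
    note I2 = integrable_suminf[OF qus locally_integrable_norm[OF q] B(1,2) 2]
      prim_sums[OF qus locally_integrable_norm[OF q] B(1,2) 2 x]
    show ?thesis using I1 I2 unfolding qsum by (simp flip: v_def)
  qed
  have li: "locally_integrable h" if "\<And>X. X \<ge> 0 \<Longrightarrow> h absolutely_integrable_on {-X..X}" for h :: "real \<Rightarrow> complex"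
    unfolding locally_integrable_def
  proof (intro allI)
    fix c d :: real
    show "h absolutely_integrable_on {c..d}"
      by (rule absolutely_integrable_on_subinterval[OF that[of "\<bar>c\<bar> + \<bar>d\<bar>"]]) auto
  qed
  show ?thesis
  proof (intro exI conjI allI)
    show "locally_integrable v" "locally_integrable (\<lambda>x. q x * u x)"
      by (rule li, use main[of 0] in simp)+
    fix x
    have "(\<lambda>n. us (Suc n) x) sums (u x - us 0 x)" "(\<lambda>n. vs (Suc n) x) sums (v x - vs 0 x)"
      using sums[of x] sums_Suc_iff[of "\<lambda>n. us n x" "u x - us 0 x"] sums_Suc_iff[of "\<lambda>n. vs n x" "v x - vs 0 x"]
      by auto
    moreover have "us (Suc n) x = prim (vs n) x" "vs (Suc n) x = prim (\<lambda>s. q s * us n s) x" for n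
      by (simp_all add: us_def vs_def)
    moreover have "us 0 x = a" "vs 0 x = w x" by (simp_all add: us_def vs_def)
    ultimately have "u x - a = prim v x" "v x - w x = prim (\<lambda>x. q x * u x) x"
      using main[of x "\<bar>x\<bar>"] sums_unique2 by (auto, blast+)
    then show "u x = a + prim v x" "v x = w x + prim (\<lambda>x. q x * u x) x" by (simp_all add: algebra_simps)
  qed
qed

text \<open>The inhomogeneity is only locally integrable, but the integrated system contains just
  its primitive, which is continuous and can be put into the datum \<open>w\<close>.\<close>

lemma initial_value_problem:
  assumes V: "locally_integrable V" and g: "locally_integrable g"
  shows "\<exists>u u'. schroedinger_pair V (\<lambda>x. z * u x + g x) u u' \<and> u 0 = a \<and> u' 0 = b"
proof -
  define q where "q x = complex_of_real (V x) - z" for x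
  have q: "locally_integrable q"
    unfolding q_def by (intro locally_integrable_diff locally_integrable_linear[OF V] bounded_linear_of_real
        locally_integrable_continuous continuous_intros)
  have w: "continuous_on UNIV (\<lambda>x. b - prim g x)" by (intro continuous_intros continuous_prim g)
  obtain u v where uv: "locally_integrable v" "locally_integrable (\<lambda>x. q x * u x)"
    "\<And>x. u x = a + prim v x" "\<And>x. v x = (b - prim g x) + prim (\<lambda>x. q x * u x) x"
    using volterra_system_solution[OF q w, of a] by blast
  have u': "has_ac_derivative u v"
    using has_ac_derivative_prim[OF uv(1), of a] by (simp flip: uv(3))
  have "has_ac_derivative (\<lambda>x. (b + prim (\<lambda>x. q x * u x) x) - (0 + prim g x)) (\<lambda>x. q x * u x - g x)"
    by (intro has_ac_derivative_diff has_ac_derivative_prim uv g)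
  moreover have "(\<lambda>x. (b + prim (\<lambda>x. q x * u x) x) - (0 + prim g x)) = v"
    by (rule ext, subst uv(4)) simp
  moreover have "(\<lambda>x. q x * u x - g x) = (\<lambda>x. complex_of_real (V x) * u x - (z * u x + g x))"
    by (simp add: q_def algebra_simps)
  ultimately have v': "has_ac_derivative v (\<lambda>x. complex_of_real (V x) * u x - (z * u x + g x))"
    by simp
  have "schroedinger_pair V (\<lambda>x. z * u x + g x) u v"
    using v' has_ac_derivative_vector_derivative[OF u' has_ac_derivative_continuous[OF v']]
    by (simp add: schroedinger_pair_def)
  moreover have "u 0 = a" "v 0 = b" using uv(3,4)[of 0] by simp_all
  ultimately show ?thesis by blast
qed


subsection \<open>The self-adjoint operator\<close>

lemma uniformly_locally_integrable_bound:
  assumes "uniformly_locally_integrable V"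
  shows "locally_integrable V" "\<exists>K\<ge>0. \<forall>a. integral {a..a+1} (\<lambda>x. \<bar>V x\<bar>) \<le> K"
proof -
  define S where "S = (SUP x. \<integral>\<^sup>+ t\<in>{x..x+1}. ennreal \<bar>V t\<bar> \<partial>lebesgue)"
  have [measurable]: "V \<in> borel_measurable lebesgue" and S: "S < \<infinity>"
    using assms by (auto simp: uniformly_locally_integrable_def S_def)
  have le: "(\<integral>\<^sup>+ t\<in>{a..a+1}. ennreal \<bar>V t\<bar> \<partial>lebesgue) \<le> S" for a
    unfolding S_def by (rule SUP_upper) simp
  have eq: "(\<integral>\<^sup>+ t\<in>{a..a+1}. ennreal \<bar>V t\<bar> \<partial>lebesgue) = (\<integral>\<^sup>+ t. ennreal (norm (indicator {a..a+1} t *\<^sub>R V t)) \<partial>lebesgue)" for a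
    by (intro nn_integral_cong) (auto simp: indicator_def)
  have unit: "V absolutely_integrable_on {a..a+1}" for a
    unfolding set_integrable_def
  proof (rule integrableI_bounded)
    show "(\<integral>\<^sup>+ t. ennreal (norm (indicator {a..a+1} t *\<^sub>R V t)) \<partial>lebesgue) < \<infinity>"
      using le[of a] S unfolding eq by (rule le_less_trans)
    show "(\<lambda>t. indicator {a..a+1} t *\<^sub>R V t) \<in> borel_measurable lebesgue"
      by (intro borel_measurable_scaleR borel_measurable_indicator) auto
  qed
  have nat: "V absolutely_integrable_on {a..a + real n}" for a n
  proof (induction n)
    case (Suc n)
    have "V absolutely_integrable_on {a..a + real n} \<union> {a + real n..a + real n + 1}"
      by (intro absolutely_integrable_Un Suc unit)
    moreover have "{a..a + real n} \<union> {a + real n..a + real n + 1} = {a..a + real (Suc n)}" by auto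
    ultimately show ?case by simp
  qed (simp add: absolutely_integrable_negligible)
  show "locally_integrable V"
    unfolding locally_integrable_def
  proof (intro allI)
    fix a b :: real
    obtain n :: nat where "b - a < real n" using reals_Archimedean2 by blast
    then show "V absolutely_integrable_on {a..b}"
      by (intro absolutely_integrable_on_subinterval[OF nat[of a n]]) auto
  qed
  show "\<exists>K\<ge>0. \<forall>a. integral {a..a+1} (\<lambda>x. \<bar>V x\<bar>) \<le> K"
  proof (intro exI[of _ "enn2real S"] conjI allI)
    fix a
    have i: "integrable lebesgue (\<lambda>t. norm (indicator {a..a+1} t *\<^sub>R V t))"
      using unit[of a] unfolding set_integrable_def by (rule integrable_norm)
    have ab: "(\<lambda>x. \<bar>V x\<bar>) absolutely_integrable_on {a..a+1}"
      using set_integrable_norm[OF unit[of a]] by simp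
    have "integral {a..a+1} (\<lambda>x. \<bar>V x\<bar>) = (LINT t|lebesgue. norm (indicator {a..a+1} t *\<^sub>R V t))"
      using set_lebesgue_integral_eq_integral(2)[OF ab]
      by (simp add: set_lebesgue_integral_def abs_mult)
    also have "ennreal \<dots> = (\<integral>\<^sup>+ t\<in>{a..a+1}. ennreal \<bar>V t\<bar> \<partial>lebesgue)"
      unfolding eq by (rule nn_integral_eq_integral[symmetric, OF i]) auto
    also have "\<dots> \<le> S" by (rule le)
    also have "S = ennreal (enn2real S)" using S by (simp add: less_top)
    finally show "integral {a..a+1} (\<lambda>x. \<bar>V x\<bar>) \<le> enn2real S"
      by (subst (asm) ennreal_le_iff) auto
  qed simp
qed

section \<open>Fundamental systems, and square integrable functions on unit intervals\<close>

lemma wronskian_constant: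
  assumes "schroedinger_pair V (\<lambda>x. z * u x) u u'" "schroedinger_pair V (\<lambda>x. z * v x) v v'"
  shows "u x * v' x - u' x * v x = u y * v' y - u' y * v y"
proof -
  have "has_ac_derivative (\<lambda>x. u x * v' x - u' x * v x) (\<lambda>x. 0)"
    using wronskian_ac_derivative[OF assms] by (simp add: algebra_simps)
  from has_ac_derivative_integral[OF this, of x y] has_ac_derivative_integral[OF this, of y x]
  show ?thesis by (cases "x \<le> y") auto
qed

definition fundamental_system ::
  "(real \<Rightarrow> real) \<Rightarrow> complex \<Rightarrow> (real \<Rightarrow> complex) \<Rightarrow> (real \<Rightarrow> complex) \<Rightarrow>
    (real \<Rightarrow> complex) \<Rightarrow> (real \<Rightarrow> complex) \<Rightarrow> bool" where
  "fundamental_system V z c c' s s' \<longleftrightarrow>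
     schroedinger_pair V (\<lambda>x. z * c x) c c' \<and> schroedinger_pair V (\<lambda>x. z * s x) s s' \<and>
     c 0 = 1 \<and> c' 0 = 0 \<and> s 0 = 0 \<and> s' 0 = 1"

lemma fundamental_system_exists:
  assumes "locally_integrable V" shows "\<exists>c c' s s'. fundamental_system V z c c' s s'"
proof -
  have z: "locally_integrable (\<lambda>x. 0 :: complex)" by (rule locally_integrable_continuous) auto
  show ?thesis
    using initial_value_problem[OF assms z, of z 1 0] initial_value_problem[OF assms z, of z 0 1]
    by (simp add: fundamental_system_def) blast
qed

lemma fundamental_system_wronskian:
  assumes "fundamental_system V z c c' s s'" shows "c x * s' x - c' x * s x = 1"
  using wronskian_constant[of V z c c' s s' x 0] assms by (simp add: fundamental_system_def)

lemma L2_locally_integrable_sq: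
  assumes "f \<in> L2" shows "locally_integrable (\<lambda>x. (norm (f x))\<^sup>2)"
  unfolding locally_integrable_def set_integrable_def
  by (intro allI integrable_mult_indicator L2_integrable[OF assms]) auto

lemma L2_locally_integrable:
  assumes f: "f \<in> L2" shows "locally_integrable f"
  unfolding locally_integrable_def set_integrable_def
proof (intro allI)
  fix a b :: real
  have [measurable]: "f \<in> borel_measurable lebesgue" using f by (rule L2_measurable)
  have *: "integrable lebesgue (\<lambda>x. indicator {a..b} x *\<^sub>R (1 + (norm (f x))\<^sup>2) :: real)"
    using locally_integrable_add[OF locally_integrable_continuous[of "\<lambda>x. 1 :: real"] L2_locally_integrable_sq[OF f]]
    unfolding locally_integrable_def set_integrable_def by auto
  moreover have "(\<lambda>x. indicator {a..b} x *\<^sub>R f x) \<in> borel_measurable lebesgue"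
    by (intro borel_measurable_scaleR borel_measurable_indicator) auto
  moreover have "norm (indicator {a..b} x *\<^sub>R f x) \<le> norm (indicator {a..b} x *\<^sub>R (1 + (norm (f x))\<^sup>2) :: real)" for x
  proof -
    have "t \<le> 1 + t\<^sup>2" for t :: real using sum_squares_bound[of t 1] by (smt (verit) power_one mult_1_right zero_le_power2)
    from this[of "norm (f x)"] show ?thesis by (simp add: indicator_def)
  qed
  ultimately show "integrable lebesgue (\<lambda>x. indicator {a..b} x *\<^sub>R f x)"
    by (intro Bochner_Integration.integrable_bound[OF *] AE_I2)
qed

text \<open>The integral of (h - m)^2 is nonnegative, where m is the mean of h over the unit
  interval.\<close>

lemma integral_square_le:
  fixes h :: "real \<Rightarrow> real"
  assumes h: "locally_integrable h" and h2: "locally_integrable (\<lambda>x. (h x)\<^sup>2)"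
  shows "(integral {a..a+1} h)\<^sup>2 \<le> integral {a..a+1} (\<lambda>x. (h x)\<^sup>2)"
proof -
  define m where "m = integral {a..a+1} h"
  have "((\<lambda>x. (h x)\<^sup>2 - 2 * m * h x + m\<^sup>2) has_integral
      integral {a..a+1} (\<lambda>x. (h x)\<^sup>2) - 2 * m * integral {a..a+1} h + (a + 1 - a) *\<^sub>R m\<^sup>2) {a..a+1}"
    by (intro has_integral_add has_integral_diff has_integral_mult_right has_integral_const_real[THEN has_integral_eq_rhs]
        integrable_integral locally_integrable_integrable h h2) auto
  then have "0 \<le> integral {a..a+1} (\<lambda>x. (h x)\<^sup>2) - 2 * m * integral {a..a+1} h + (a + 1 - a) *\<^sub>R m\<^sup>2"
  proof (rule has_integral_nonneg)
    show "0 \<le> (h x)\<^sup>2 - 2 * m * h x + m\<^sup>2" for x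
      using zero_le_power2[of "h x - m"] by (simp add: power2_diff algebra_simps)
  qed
  then show ?thesis by (simp add: m_def power2_eq_square)
qed

text \<open>Squaring \<open>local_estimate\<close> and bounding the squares of the means by means of
  squares leaves only L2 quantities.\<close>

lemma local_estimate_square:
  assumes u: "schroedinger_pair V \<psi> u u'" and V: "locally_integrable V"
    and K: "integral {a..a+1} (\<lambda>x. \<bar>V x\<bar>) \<le> K" and x: "x \<in> {a..a+1}"
    and psi: "locally_integrable (\<lambda>x. (norm (\<psi> x))\<^sup>2)"
  shows "(norm (u x) + norm (u' x))\<^sup>2 \<le> 2 * (4 * (2 + K) * (3 + K) + 1)\<^sup>2 *
    (integral {a..a+1} (\<lambda>x. (norm (u x))\<^sup>2) + integral {a..a+1} (\<lambda>x. (norm (\<psi> x))\<^sup>2))"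
proof -
  note cu = schroedinger_pair_continuous(1)[OF u]
  have lu: "locally_integrable (\<lambda>x. norm (u x))" by (intro locally_integrable_norm locally_integrable_continuous cu)
  have lu2: "locally_integrable (\<lambda>x. (norm (u x))\<^sup>2)" by (intro locally_integrable_continuous continuous_intros cu)
  have lpsi: "locally_integrable (\<lambda>x. norm (\<psi> x))"
    using locally_integrable_norm[OF schroedinger_pair_locally_integrable[OF u V]] .
  let ?D = "4 * (2 + K) * (3 + K) + 1"
  let ?I = "integral {a..a+1} (\<lambda>x. norm (u x))" and ?P = "integral {a..a+1} (\<lambda>x. norm (\<psi> x))"
  have "(norm (u x) + norm (u' x))\<^sup>2 \<le> (?D * (?I + ?P))\<^sup>2"
    using local_estimate[OF u V K x] by (intro power_mono) auto
  also have "\<dots> = ?D\<^sup>2 * (?I + ?P)\<^sup>2" by (simp add: power_mult_distrib)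
  also have "\<dots> \<le> ?D\<^sup>2 * (2 * ?I\<^sup>2 + 2 * ?P\<^sup>2)"
    by (rule mult_left_mono[OF _ zero_le_power2]) (use sum_squares_bound[of ?I ?P] in \<open>simp add: power2_sum\<close>)
  also have "\<dots> \<le> ?D\<^sup>2 * (2 * integral {a..a+1} (\<lambda>x. (norm (u x))\<^sup>2) + 2 * integral {a..a+1} (\<lambda>x. (norm (\<psi> x))\<^sup>2))"
    by (intro mult_left_mono add_mono integral_square_le lu lu2 lpsi psi) auto
  finally show ?thesis by (simp add: algebra_simps)
qed

text \<open>Half-lines are an intersection-stable generator of the Borel sets, so vanishing
  integrals spread from intervals to Borel sets by induction over the generated sigma-algebra, and
  to Lebesgue sets up to null sets. The cutoff to {-n..n} makes the function integrable, as
  complements require.\<close>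

lemma AE_zero_if_interval_integrals_zero:
  fixes h :: "real \<Rightarrow> complex"
  assumes h: "locally_integrable h" and z: "\<And>a b. a \<le> b \<Longrightarrow> integral {a..b} h = 0"
  shows "AE x in lebesgue. h x = 0"
proof -
  interpret lebesgue: sigma_finite_measure "lebesgue :: real measure"
  proof
    have "(\<Union>n. {-real n..real n}) = UNIV"
      by (auto simp: set_eq_iff) (metis abs_le_iff minus_le_iff real_arch_simple)
    then show "\<exists>A :: real set set. countable A \<and> A \<subseteq> sets lebesgue \<and> \<Union>A = space lebesgue \<and>
        (\<forall>a\<in>A. emeasure lebesgue a \<noteq> \<infinity>)"
      by (intro exI[of _ "range (\<lambda>n. {-real n..real n})"]) auto
  qed
  have bs: "sets (borel :: real measure) = sigma_sets UNIV (range (\<lambda>a. {..a}))"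
    by (subst borel_eq_atMost) simp
  have "AE x in lebesgue. indicator {-real n..real n} x *\<^sub>R h x = 0" for n
  proof (rule lebesgue.density_zero)
    let ?f = "\<lambda>x. indicator {-real n..real n} x *\<^sub>R h x"
    show int: "integrable lebesgue ?f"
      using locally_integrable_absolutely[OF h] by (simp add: set_integrable_def)
    have si: "set_integrable lebesgue A ?f" if "A \<in> sets lebesgue" for A
      unfolding set_integrable_def by (rule integrable_mult_indicator[OF that int])
    have full: "(LINT x|lebesgue. ?f x) = 0"
      using set_lebesgue_integral_eq_integral(2)[OF locally_integrable_absolutely[OF h, of "-real n" "real n"]] z
      by (simp add: set_lebesgue_integral_def)
    have borel0: "set_lebesgue_integral lebesgue B ?f = 0" if "B \<in> sigma_sets UNIV (range (\<lambda>a::real. {..a}))" for B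
    proof (rule sigma_sets_induct_disjoint[OF _ _ that, where P = "\<lambda>B. set_lebesgue_integral lebesgue B ?f = 0"])
      show "Int_stable (range (\<lambda>a::real. {..a}))"
        by (auto simp: Int_stable_def)
    next
      fix A :: "real set" assume "A \<in> range (\<lambda>a::real. {..a})"
      then obtain a where A: "A = {..a}" by auto
      have eq: "(\<lambda>x. indicator A x *\<^sub>R ?f x) = (\<lambda>x. indicator {-real n..min a (real n)} x *\<^sub>R h x)"
        by (auto simp: A indicator_def)
      show "set_lebesgue_integral lebesgue A ?f = 0"
        unfolding set_lebesgue_integral_def eq
        using set_lebesgue_integral_eq_integral(2)[OF locally_integrable_absolutely[OF h, of "-real n" "min a (real n)"]]
          z[of "-real n" "min a (real n)"] integral_empty
        by (cases "-real n \<le> min a (real n)") (auto simp: set_lebesgue_integral_def)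
    next
      fix A :: "real set" assume A: "A \<in> sigma_sets UNIV (range (\<lambda>a::real. {..a}))"
        and IH: "set_lebesgue_integral lebesgue A ?f = 0"
      have Am: "A \<in> sets lebesgue"
        by (rule sets_completionI_sets) (use A in \<open>auto simp: bs\<close>)
      have "(\<lambda>x. indicator (UNIV - A) x *\<^sub>R ?f x) = (\<lambda>x. ?f x - indicator A x *\<^sub>R ?f x)"
        by (auto simp: indicator_def)
      then show "set_lebesgue_integral lebesgue (UNIV - A) ?f = 0"
        using IH full si[OF Am] int by (simp add: set_lebesgue_integral_def set_integrable_def)
    next
      fix A :: "nat \<Rightarrow> real set"
      assume A: "disjoint_family A" "range A \<subseteq> sigma_sets UNIV (range (\<lambda>a::real. {..a}))"
        and IH: "\<And>i. set_lebesgue_integral lebesgue (A i) ?f = 0"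
      have Am: "A i \<in> sets lebesgue" for i
        by (rule sets_completionI_sets) (use A in \<open>auto simp: bs\<close>)
      show "set_lebesgue_integral lebesgue (\<Union>i. A i) ?f = 0"
        using A(1) IH Am
        by (subst lebesgue_integral_countable_add) (auto simp: disjoint_family_on_def intro!: si)
    qed (auto simp: set_lebesgue_integral_def)
    fix A :: "real set" assume A: "A \<in> sets lebesgue"
    then obtain S N N' where SN: "A = S \<union> N" "N \<subseteq> N'" "N' \<in> null_sets lborel" "S \<in> sets lborel"
      by (rule sets_completionE)
    have "AE x in lebesgue. x \<notin> N'"
      using SN(3) by (intro AE_not_in) (auto intro: null_sets_completionI)
    then have ae: "AE x in lebesgue. indicator A x *\<^sub>R ?f x = indicator S x *\<^sub>R ?f x"
      by (rule AE_mp) (use SN in \<open>auto simp: indicator_def\<close>)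
    have S: "S \<in> sets lebesgue" using SN(4) by (rule sets_completionI_sets)
    have "set_lebesgue_integral lebesgue A ?f = set_lebesgue_integral lebesgue S ?f"
      unfolding set_lebesgue_integral_def
      using si[OF A] si[OF S] ae unfolding set_integrable_def
      by (intro integral_cong_AE) auto
    also have "\<dots> = 0"
      using SN(4) by (intro borel0) (simp add: bs)
    finally show "set_lebesgue_integral lebesgue A ?f = 0" .
  qed
  then have "AE x in lebesgue. \<forall>n. indicator {-real n..real n} x *\<^sub>R h x = 0"
    unfolding AE_all_countable by blast
  then show ?thesis
  proof (rule AE_mp, intro AE_I2 impI)
    fix x assume *: "\<forall>n. indicator {-real n..real n} x *\<^sub>R h x = 0"
    obtain n :: nat where "\<bar>x\<bar> \<le> real n" using real_arch_simple by blast
    then show "h x = 0" using *[rule_format, of n] by (auto simp: indicator_def abs_le_iff)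
  qed
qed


text \<open>A continuous function that is 0 almost everywhere is 0, so the integral of \<psi> over
  every interval vanishes. This is the single-valuedness of the graph of H.\<close>

lemma schroedinger_eq_zero:
  assumes V: "locally_integrable V" and eq: "schroedinger_eq V u \<psi>" and u0: "AE x in lebesgue. u x = 0"
  shows "AE x in lebesgue. \<psi> x = 0"
proof -
  note pair = schroedinger_eq_pair[OF eq]
  have "closed {x. u x = 0}"
    using schroedinger_pair_continuous(1)[OF pair, of UNIV]
    by (intro closed_Collect_eq continuous_on_const)
  moreover have "AE x in lebesgue. x \<in> {x. u x = 0}" using u0 by simp
  ultimately have "x \<in> {x. u x = 0}" for x by (rule mem_closed_if_AE_lebesgue)
  then have u: "u = (\<lambda>x. 0)" by auto
  have ac: "has_ac_derivative (\<lambda>x. 0) (\<lambda>x. - \<psi> x)"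
    using schroedinger_pair_ac'[OF pair] by (simp add: u)
  have "AE x in lebesgue. - \<psi> x = 0"
    by (rule AE_zero_if_interval_integrals_zero[OF has_ac_derivative_locally_integrable[OF ac]])
      (use has_ac_derivative_integral[OF ac] in simp)
  then show ?thesis by simp
qed

lemma integrable_window_tendsto_0:
  fixes h :: "real \<Rightarrow> real" and a :: "nat \<Rightarrow> real"
  assumes h: "integrable lebesgue h" and a: "filterlim (\<lambda>n. \<bar>a n\<bar>) at_top sequentially"
  shows "(\<lambda>n. integral {a n..a n + 1} h) \<longlonglongrightarrow> 0"
proof -
  have "(\<lambda>n. LINT x|lebesgue. indicator {a n..a n + 1} x *\<^sub>R h x) \<longlonglongrightarrow> (LINT x::real|lebesgue. 0 :: real)"
  proof (rule integral_dominated_convergence[where w = "\<lambda>x. norm (h x)"])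
    show "AE x in lebesgue. (\<lambda>n. indicator {a n..a n + 1} x *\<^sub>R h x) \<longlonglongrightarrow> 0"
    proof (intro AE_I2 tendsto_eventually)
      fix x :: real
      have "\<forall>\<^sub>F n in sequentially. \<bar>x\<bar> + 1 < \<bar>a n\<bar>"
        using a by (simp add: filterlim_at_top_dense)
      then show "\<forall>\<^sub>F n in sequentially. indicator {a n..a n + 1} x *\<^sub>R h x = 0"
        by eventually_elim (auto simp: indicator_def)
    qed
    show "(\<lambda>x. indicator {a n..a n + 1} x *\<^sub>R h x) \<in> borel_measurable lebesgue" for n
      using h by (intro borel_measurable_scaleR borel_measurable_indicator) auto
    show "AE x in lebesgue. norm (indicator {a n..a n + 1} x *\<^sub>R h x) \<le> norm (h x)" for n
      by (intro AE_I2) (auto simp: indicator_def)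
  qed (use h in auto)
  moreover have "(LINT x|lebesgue. indicator {a n..a n + 1} x *\<^sub>R h x) = integral {a n..a n + 1} h" for n
    using set_lebesgue_integral_eq_integral(2)[of "{a n..a n+1}" h] integrable_mult_indicator[OF _ h]
    by (simp add: set_lebesgue_integral_def set_integrable_def)
  ultimately show ?thesis by simp
qed

lemma integral_symmetric_tendsto:
  fixes h :: "real \<Rightarrow> 'b::euclidean_space"
  assumes h: "integrable lebesgue h"
  shows "(\<lambda>n. integral {-real n..real n} h) \<longlonglongrightarrow> (LINT x|lebesgue. h x)"
proof -
  have "(\<lambda>n. LINT x|lebesgue. indicator {-real n..real n} x *\<^sub>R h x) \<longlonglongrightarrow> (LINT x|lebesgue. h x)"
  proof (rule integral_dominated_convergence[where w = "\<lambda>x. norm (h x)"])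
    show "AE x in lebesgue. (\<lambda>n. indicator {-real n..real n} x *\<^sub>R h x) \<longlonglongrightarrow> h x"
    proof (intro AE_I2 tendsto_eventually)
      fix x :: real
      have "\<forall>\<^sub>F n in sequentially. \<bar>x\<bar> \<le> real n"
        using filterlim_real_sequentially by (simp add: filterlim_at_top)
      then show "\<forall>\<^sub>F n in sequentially. indicator {-real n..real n} x *\<^sub>R h x = h x"
        by eventually_elim (auto simp: indicator_def)
    qed
    show "(\<lambda>x. indicator {-real n..real n} x *\<^sub>R h x) \<in> borel_measurable lebesgue" for n
      using h by (intro borel_measurable_scaleR borel_measurable_indicator) auto
    show "AE x in lebesgue. norm (indicator {-real n..real n} x *\<^sub>R h x) \<le> norm (h x)" for n
      by (intro AE_I2) (auto simp: indicator_def)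
  qed (use h in auto)
  moreover have "(LINT x|lebesgue. indicator {-real n..real n} x *\<^sub>R h x) = integral {-real n..real n} h" for n
    using set_lebesgue_integral_eq_integral(2)[of "{-real n..real n}" h] integrable_mult_indicator[OF _ h]
    by (simp add: set_lebesgue_integral_def set_integrable_def)
  ultimately show ?thesis by simp
qed

text \<open>Limit point case: by \<open>local_estimate_square\<close> the boundary terms of Green's formula vanish at
  infinity for functions in the maximal domain.\<close>

lemma operator_symmetric:
  assumes V: "uniformly_locally_integrable V" and eq: "schroedinger_eq V u \<psi>"
    and u: "u \<in> L2" and psi: "\<psi> \<in> L2"
  shows "(LINT x|lebesgue. Im (\<psi> x * cnj (u x))) = 0"
proof -
  note lV = uniformly_locally_integrable_bound(1)[OF V]
  obtain K where K: "\<And>a. integral {a..a+1} (\<lambda>x. \<bar>V x\<bar>) \<le> K"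
    using uniformly_locally_integrable_bound(2)[OF V] by blast
  obtain u' where pair: "schroedinger_pair V \<psi> u u'"
    using schroedinger_eq_pair[OF eq] by blast
  define W where "W x = u x * cnj (u' x) - u' x * cnj (u x)" for x
  define h where "h x = (norm (u x))\<^sup>2 + (norm (\<psi> x))\<^sup>2" for x
  have h: "integrable lebesgue h"
    unfolding h_def using u psi by (auto intro: L2_integrable)
  define D where "D = 2 * (4 * (2 + K) * (3 + K) + 1)\<^sup>2"
  \<comment> \<open>The boundary term is quadratic in the Cauchy data, hence bounded by the mass of
    \<open>u\<close> and \<psi> on a unit interval around \<open>x\<close>; this tends to 0 as the
    interval moves to infinity.\<close>
  have Wle: "norm (W x) \<le> D * integral {a..a+1} h" if x: "x \<in> {a..a+1}" for x a
  proof -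
    have "norm (W x) \<le> norm (u x) * norm (u' x) + norm (u' x) * norm (u x)"
      unfolding W_def by (intro order.trans[OF norm_triangle_ineq4]) (simp add: norm_mult)
    also have "\<dots> \<le> (norm (u x) + norm (u' x))\<^sup>2" by (simp add: power2_sum)
    also have "\<dots> \<le> D * (integral {a..a+1} (\<lambda>x. (norm (u x))\<^sup>2) + integral {a..a+1} (\<lambda>x. (norm (\<psi> x))\<^sup>2))"
      unfolding D_def by (rule local_estimate_square[OF pair lV K x L2_locally_integrable_sq[OF psi]])
    also have "integral {a..a+1} (\<lambda>x. (norm (u x))\<^sup>2) + integral {a..a+1} (\<lambda>x. (norm (\<psi> x))\<^sup>2) = integral {a..a+1} h"
      unfolding h_def by (rule Henstock_Kurzweil_Integration.integral_add[symmetric])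
        (intro locally_integrable_integrable L2_locally_integrable_sq u psi)+
    finally show ?thesis .
  qed
  have lim1: "(\<lambda>n. W (real n)) \<longlonglongrightarrow> 0"
  proof (rule Lim_null_comparison)
    show "\<forall>\<^sub>F n in sequentially. norm (W (real n)) \<le> D * integral {real n..real n + 1} h"
      by (intro always_eventually allI Wle) auto
    show "(\<lambda>n. D * integral {real n..real n + 1} h) \<longlonglongrightarrow> 0"
      by (intro tendsto_mult_right_zero integrable_window_tendsto_0 h)
        (simp add: filterlim_real_sequentially)
  qed
  have lim2: "(\<lambda>n. W (- real n)) \<longlonglongrightarrow> 0"
  proof (rule Lim_null_comparison)
    show "\<forall>\<^sub>F n in sequentially. norm (W (- real n)) \<le> D * integral {- real n..- real n + 1} h"
      by (intro always_eventually allI Wle) auto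
    show "(\<lambda>n. D * integral {- real n..- real n + 1} h) \<longlonglongrightarrow> 0"
      by (intro tendsto_mult_right_zero integrable_window_tendsto_0 h)
        (simp add: filterlim_real_sequentially)
  qed
  have ac: "has_ac_derivative W (\<lambda>x. \<psi> x * cnj (u x) - u x * cnj (\<psi> x))"
    unfolding W_def using wronskian_ac_derivative[OF pair schroedinger_pair_cnj[OF pair]] by simp
  have int: "integrable lebesgue (\<lambda>x. \<psi> x * cnj (u x) - u x * cnj (\<psi> x))"
    by (intro Bochner_Integration.integrable_diff L2_integrable_product u psi)
  have "(\<lambda>n. W (real n) - W (- real n)) \<longlonglongrightarrow> (LINT x|lebesgue. \<psi> x * cnj (u x) - u x * cnj (\<psi> x))"
    using integral_symmetric_tendsto[OF int] by (simp add: has_ac_derivative_integral[OF ac])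
  then have "(LINT x|lebesgue. \<psi> x * cnj (u x) - u x * cnj (\<psi> x)) = 0"
    using tendsto_diff[OF lim1 lim2] LIMSEQ_unique by fastforce
  then have "(LINT x|lebesgue. Im (\<psi> x * cnj (u x) - u x * cnj (\<psi> x))) = 0"
    using integral_Im[OF int] by simp
  moreover have "Im (\<psi> x * cnj (u x) - u x * cnj (\<psi> x)) = 2 * Im (\<psi> x * cnj (u x))" for x
    by (simp add: algebra_simps)
  ultimately have "(LINT x|lebesgue. 2 * Im (\<psi> x * cnj (u x))) = 0" by (simp only:)
  then show ?thesis unfolding integral_mult_right_zero by simp
qed

text \<open>Green's formula for \<open>u\<close> and its conjugate has no boundary terms under
  Dirichlet conditions. Its imaginary part expresses Im z times the mass of \<open>u\<close> through
  the pairing with \<open>g\<close>. The constant does not depend on the interval.\<close>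

lemma dirichlet_energy:
  assumes u: "schroedinger_pair V (\<lambda>x. z * u x + g x) u u'" and z: "Im z \<noteq> 0" and L: "a \<le> b"
    and bc: "u a = 0" "u b = 0" and g: "locally_integrable g" "locally_integrable (\<lambda>x. (norm (g x))\<^sup>2)"
  shows "integral {a..b} (\<lambda>x. (norm (u x))\<^sup>2) \<le> integral {a..b} (\<lambda>x. (norm (g x))\<^sup>2) / (Im z)\<^sup>2"
proof -
  note cu = schroedinger_pair_continuous(1)[OF u]
  have ccu: "continuous_on S (\<lambda>x. cnj (u x))" for S by (intro continuous_intros cu)
  have lu2: "locally_integrable (\<lambda>x. (norm (u x))\<^sup>2)" by (intro locally_integrable_continuous continuous_intros cu)
  note i = locally_integrable_integrable
  have ac: "has_ac_derivative (\<lambda>x. u x * cnj (u' x) - u' x * cnj (u x))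
      (\<lambda>x. (z * u x + g x) * cnj (u x) - u x * cnj (z * u x + g x))"
    using wronskian_ac_derivative[OF u schroedinger_pair_cnj[OF u]] by simp
  have "((\<lambda>x. (z * u x + g x) * cnj (u x) - u x * cnj (z * u x + g x)) has_integral 0) {a..b}"
    using has_ac_derivative_has_integral[OF ac L] by (simp add: bc)
  from has_integral_Im[OF this]
  have *: "((\<lambda>x. 2 * (Im z * (norm (u x))\<^sup>2 + Im (g x * cnj (u x)))) has_integral 0) {a..b}"
  proof -
    have "Im ((z * u x + g x) * cnj (u x) - u x * cnj (z * u x + g x)) =
        2 * (Im z * (norm (u x))\<^sup>2 + Im (g x * cnj (u x)))" for x
      unfolding cmod_power2 by (simp add: algebra_simps power2_eq_square)
    then show ?thesis using has_integral_Im[OF \<open>(_ has_integral 0) {a..b}\<close>] by simp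
  qed
  have gu: "locally_integrable (\<lambda>x. Im (g x * cnj (u x)))"
    by (intro locally_integrable_linear[OF _ bounded_linear_Im] locally_integrable_mult g ccu)
  let ?U = "integral {a..b} (\<lambda>x. (norm (u x))\<^sup>2)" and ?G = "integral {a..b} (\<lambda>x. (norm (g x))\<^sup>2)"
  have "((\<lambda>x. 2 * (Im z * (norm (u x))\<^sup>2 + Im (g x * cnj (u x)))) has_integral
      2 * (Im z * ?U + integral {a..b} (\<lambda>x. Im (g x * cnj (u x))))) {a..b}"
    by (intro has_integral_mult_right has_integral_add integrable_integral i lu2 gu)
  from has_integral_unique[OF this *]
  have eq: "Im z * ?U = - integral {a..b} (\<lambda>x. Im (g x * cnj (u x)))" by simp
  let ?m = "\<bar>Im z\<bar>"
  have m: "?m > 0" using z by simp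
  have U0: "0 \<le> ?U" by (intro integral_nonneg i lu2) auto
  have "?m * ?U = \<bar>integral {a..b} (\<lambda>x. Im (g x * cnj (u x)))\<bar>"
    using eq U0 by (metis abs_minus_cancel abs_mult abs_of_nonneg)
  also have "\<dots> = norm (integral {a..b} (\<lambda>x. Im (g x * cnj (u x))))" by simp
  \<comment> \<open>Young's inequality, weighted so that exactly half of the left side is
    absorbed.\<close>
  also have "\<dots> \<le> integral {a..b} (\<lambda>x. ?m / 2 * (norm (u x))\<^sup>2 + 1 / (2 * ?m) * (norm (g x))\<^sup>2)"
  proof (rule integral_norm_bound_integral)
    show "(\<lambda>x. ?m / 2 * (norm (u x))\<^sup>2 + 1 / (2 * ?m) * (norm (g x))\<^sup>2) integrable_on {a..b}"
      by (intro integrable_add integrable_on_mult_right i lu2 g)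
    fix x
    have "norm (Im (g x * cnj (u x))) \<le> norm (g x) * norm (u x)"
      using abs_Im_le_cmod[of "g x * cnj (u x)"] by (simp add: norm_mult)
    also have "\<dots> \<le> ?m / 2 * (norm (u x))\<^sup>2 + 1 / (2 * ?m) * (norm (g x))\<^sup>2"
    proof -
      have "2 * (?m * norm (u x)) * norm (g x) \<le> (?m * norm (u x))\<^sup>2 + (norm (g x))\<^sup>2"
        by (rule sum_squares_bound)
      then show ?thesis using m by (simp add: field_simps power2_eq_square)
    qed
    finally show "norm (Im (g x * cnj (u x))) \<le> ?m / 2 * (norm (u x))\<^sup>2 + 1 / (2 * ?m) * (norm (g x))\<^sup>2" .
  qed (intro i gu)
  also have "\<dots> = ?m / 2 * ?U + 1 / (2 * ?m) * ?G"
    by (subst Henstock_Kurzweil_Integration.integral_add[OF integrable_on_mult_right[OF i[OF lu2]]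
          integrable_on_mult_right[OF i[OF g(2)]]]) simp
  finally have "?m / 2 * ?U \<le> 1 / (2 * ?m) * ?G" by simp
  then have "?U * ?m\<^sup>2 \<le> ?G" using m by (simp add: field_simps power2_eq_square)
  then have "?U \<le> ?G / ?m\<^sup>2" using m by (subst pos_le_divide_eq) auto
  then show ?thesis by simp
qed

text \<open>A zero determinant makes the combination \<open>h\<close> vanish at both ends. The
  energy bound with g = 0 kills it on {-L..L}, so its data at 0, namely \<open>s L\<close> and
  \<open>- c L\<close>, are 0, against the Wronskian at \<open>L\<close>.\<close>

lemma dirichlet_nondegenerate:
  assumes V: "locally_integrable V" and z: "Im z \<noteq> 0" and L: "L > 0"
    and fs: "fundamental_system V z c c' s s'"
  shows "c L * s (- L) - c (- L) * s L \<noteq> 0"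
proof
  assume det: "c L * s (- L) - c (- L) * s L = 0"
  define h where "h x = s L * c x + (- c L) * s x" for x
  define h' where "h' x = s L * c' x + (- c L) * s' x" for x
  have pc: "schroedinger_pair V (\<lambda>x. z * c x) c c'" "schroedinger_pair V (\<lambda>x. z * s x) s s'"
    using fs by (auto simp: fundamental_system_def)
  have "schroedinger_pair V (\<lambda>x. s L * (z * c x) + (- c L) * (z * s x)) h h'"
    unfolding h_def h'_def by (rule schroedinger_pair_combine[OF pc])
  then have h: "schroedinger_pair V (\<lambda>x. z * h x + 0) h h'"
    by (simp add: h_def algebra_simps)
  have zero: "locally_integrable (\<lambda>x. 0 :: complex)" "locally_integrable (\<lambda>x::real. (norm (0::complex))\<^sup>2)"
    by (rule locally_integrable_continuous, simp)+
  have "integral {-L..L} (\<lambda>x. (norm (h x))\<^sup>2) \<le> integral {-L..L} (\<lambda>x. (norm (0::complex))\<^sup>2) / (Im z)\<^sup>2"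
    by (rule dirichlet_energy[OF h z _ _ _ zero]) (use L det in \<open>auto simp: h_def algebra_simps\<close>)
  moreover have ch: "continuous_on S h" for S by (rule schroedinger_pair_continuous[OF h])
  have c2: "continuous_on S (\<lambda>x. (norm (h x))\<^sup>2)" for S by (intro continuous_intros ch)
  have "0 \<le> integral {-L..L} (\<lambda>x. (norm (h x))\<^sup>2)"
    by (intro integral_nonneg integrable_continuous_real c2) auto
  ultimately have "integral {-L..L} (\<lambda>x. (norm (h x))\<^sup>2) = 0" by simp
  then have h0: "h x = 0" if "x \<in> {-L..L}" for x
    using that integral_eq_0_iff[OF c2, of "-L" L] L by auto
  have "((\<lambda>x. 0) has_vector_derivative h' 0) (at 0)"
  proof (rule has_vector_derivative_transform_within_open)
    show "(h has_vector_derivative h' 0) (at 0)" using h by (simp add: schroedinger_pair_def)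
  qed (use L h0 in \<open>auto intro: open_greaterThanLessThan[of "-L" L]\<close>)
  then have "h' 0 = 0"
    using vector_derivative_unique_at[OF _ has_vector_derivative_const] by blast
  moreover have "h 0 = 0" using h0 L by simp
  moreover have "h 0 = s L" "h' 0 = - c L" using fs by (simp_all add: h_def h'_def fundamental_system_def)
  ultimately show False using fundamental_system_wronskian[OF fs, of L] by simp
qed

text \<open>The resolvent is obtained by solving Dirichlet problems on growing intervals: their solutions
  are bounded in \<open>L\<^sup>2\<close> by \<open>dirichlet_energy\<close>, hence so are their Cauchy data at \<open>0\<close>, and a convergent
  subsequence of the data yields the solution on the line.\<close>

lemma resolvent_exists:
  assumes V: "uniformly_locally_integrable V" and z: "Im z \<noteq> 0" and g: "g \<in> L2"
  shows "\<exists>u\<in>L2. schroedinger_eq V u (\<lambda>x. z * u x + g x)"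
proof -
  note lV = uniformly_locally_integrable_bound(1)[OF V]
  obtain K where K: "\<And>a. integral {a..a+1} (\<lambda>x. \<bar>V x\<bar>) \<le> K"
    using uniformly_locally_integrable_bound(2)[OF V] by blast
  note lg = L2_locally_integrable[OF g] and lg2 = L2_locally_integrable_sq[OF g]
  obtain c c' s s' where fs: "fundamental_system V z c c' s s'"
    using fundamental_system_exists[OF lV] by blast
  then have pc: "schroedinger_pair V (\<lambda>x. z * c x) c c'" and ps: "schroedinger_pair V (\<lambda>x. z * s x) s s'"
    and data: "c 0 = 1" "c' 0 = 0" "s 0 = 0" "s' 0 = 1"
    by (auto simp: fundamental_system_def)
  obtain w w' where w: "schroedinger_pair V (\<lambda>x. z * w x + g x) w w'" "w 0 = 0" "w' 0 = 0"
    using initial_value_problem[OF lV lg, of z 0 0] by blast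
  define U where "U a b x = w x + (a * c x + b * s x)" for a b x
  define U' where "U' a b x = w' x + (a * c' x + b * s' x)" for a b x
  have U: "schroedinger_pair V (\<lambda>x. z * U a b x + g x) (U a b) (U' a b)" for a b
    using schroedinger_pair_combine[OF w(1) schroedinger_pair_combine[OF pc ps, of a b], of 1 1]
    by (simp add: U_def[abs_def] U'_def[abs_def] algebra_simps)
  define G where "G = (LINT x|lebesgue. (norm (g x))\<^sup>2)"
  define B where "B = G / (Im z)\<^sup>2"
  have sub: "integral {a..b} (\<lambda>x. (norm (g x))\<^sup>2) \<le> G" for a b
  proof -
    have "integral {a..b} (\<lambda>x. (norm (g x))\<^sup>2) = (LINT x|lebesgue. indicator {a..b} x *\<^sub>R (norm (g x))\<^sup>2)"
      using set_lebesgue_integral_eq_integral(2)[OF locally_integrable_absolutely[OF lg2]]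
      by (simp add: set_lebesgue_integral_def)
    also have "\<dots> \<le> G"
      unfolding G_def
      by (intro integral_mono integrable_mult_indicator L2_integrable g) (auto simp: indicator_def)
    finally show ?thesis .
  qed
  have "\<exists>a b. U a b (- real (Suc n)) = 0 \<and> U a b (real (Suc n)) = 0" for n
  proof -
    define L where "L = real (Suc n)"
    have d: "c L * s (- L) - c (- L) * s L \<noteq> 0"
      by (rule dirichlet_nondegenerate[OF lV z _ fs]) (simp add: L_def)
    \<comment> \<open>Cramer's rule for the two Dirichlet conditions.\<close>
    let ?d = "c L * s (- L) - c (- L) * s L"
    let ?a = "(- w L * s (- L) + w (- L) * s L) / ?d"
    let ?b = "(- w (- L) * c L + w L * c (- L)) / ?d"
    have "?a * c L + ?b * s L = (- w L * ?d) / ?d" "?a * c (- L) + ?b * s (- L) = (- w (- L) * ?d) / ?d"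
      unfolding times_divide_eq_left add_divide_distrib[symmetric] by (simp_all add: algebra_simps)
    then have "U ?a ?b L = 0" "U ?a ?b (- L) = 0"
      using d unfolding U_def by simp_all
    then show ?thesis unfolding L_def by blast
  qed
  then obtain a b where bc: "\<And>n. U (a n) (b n) (- real (Suc n)) = 0" "\<And>n. U (a n) (b n) (real (Suc n)) = 0"
    by metis
  define v where "v n = U (a n) (b n)" for n
  have cv: "continuous_on S (v n)" for S n unfolding v_def by (rule schroedinger_pair_continuous[OF U])
  have lv2: "locally_integrable (\<lambda>x. (norm (v n x))\<^sup>2)" for n
    by (intro locally_integrable_continuous continuous_intros cv)
  have vB: "integral {- real (Suc n)..real (Suc n)} (\<lambda>x. (norm (v n x))\<^sup>2) \<le> B" for n
  proof -
    have "integral {- real (Suc n)..real (Suc n)} (\<lambda>x. (norm (v n x))\<^sup>2) \<le>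
        integral {- real (Suc n)..real (Suc n)} (\<lambda>x. (norm (g x))\<^sup>2) / (Im z)\<^sup>2"
      unfolding v_def by (rule dirichlet_energy[OF U z _ bc lg lg2]) simp
    also have "\<dots> \<le> B" unfolding B_def by (intro divide_right_mono sub) simp
    finally show ?thesis .
  qed
  define D where "D = 2 * (4 * (2 + K) * (3 + K) + 1)\<^sup>2"
  define R where "R = D * (B + (2 * (norm z)\<^sup>2 * B + 2 * G))"
  \<comment> \<open>Since \<open>w\<close> has zero data at 0, the data of \<open>U a b\<close>
    there are exactly \<open>a\<close> and \<open>b\<close>; the estimate on {0..1} therefore bounds
    the coefficients independently of the length of the interval.\<close>
  have ab: "(norm (a n) + norm (b n))\<^sup>2 \<le> R" for n
  proof -
    have psi2: "locally_integrable (\<lambda>x. (norm (z * v n x + g x))\<^sup>2)"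
    proof -
      have "continuous_on UNIV (\<lambda>x. (norm (z * v n x))\<^sup>2)" "continuous_on UNIV (\<lambda>x. cnj (z * v n x))"
        by (intro continuous_intros cv)+
      then have "locally_integrable (\<lambda>x. (norm (z * v n x))\<^sup>2 + (norm (g x))\<^sup>2 + 2 * Re (g x * cnj (z * v n x)))"
        by (intro locally_integrable_add locally_integrable_cmult lg2 locally_integrable_linear[OF _ bounded_linear_Re]
            locally_integrable_mult[OF lg]) (rule locally_integrable_continuous)
      moreover have "(norm (p + q))\<^sup>2 = (norm p)\<^sup>2 + (norm q)\<^sup>2 + 2 * Re (q * cnj p)" for p q :: complex
        unfolding cmod_power2 by (simp add: power2_eq_square algebra_simps)
      ultimately show ?thesis by (simp only:)
    qed
    have "(norm (v n 0) + norm (U' (a n) (b n) 0))\<^sup>2 \<le> D *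
      (integral {0..0+1} (\<lambda>x. (norm (v n x))\<^sup>2) + integral {0..0+1} (\<lambda>x. (norm (z * v n x + g x))\<^sup>2))"
      unfolding v_def D_def using psi2
      by (intro local_estimate_square[OF U lV K]) (auto simp: v_def)
    also have "\<dots> \<le> D * (B + (2 * (norm z)\<^sup>2 * B + 2 * G))"
    proof (intro mult_left_mono add_mono)
      have "integral {0..0+1} (\<lambda>x. (norm (v n x))\<^sup>2) \<le> integral {- real (Suc n)..real (Suc n)} (\<lambda>x. (norm (v n x))\<^sup>2)"
        by (rule integral_nonneg_mono_interval[OF lv2]) auto
      then show 1: "integral {0..0+1} (\<lambda>x. (norm (v n x))\<^sup>2) \<le> B" using vB[of n] by linarith
      have "integral {0..0+1} (\<lambda>x. (norm (z * v n x + g x))\<^sup>2) \<le>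
          integral {0..0+1} (\<lambda>x. 2 * (norm z)\<^sup>2 * (norm (v n x))\<^sup>2 + 2 * (norm (g x))\<^sup>2)"
      proof (rule integral_le)
        show "(\<lambda>x. 2 * (norm z)\<^sup>2 * (norm (v n x))\<^sup>2 + 2 * (norm (g x))\<^sup>2) integrable_on {0..0+1}"
          by (intro integrable_add integrable_on_mult_right locally_integrable_integrable lv2 lg2)
        show "(norm (z * v n x + g x))\<^sup>2 \<le> 2 * (norm z)\<^sup>2 * (norm (v n x))\<^sup>2 + 2 * (norm (g x))\<^sup>2" for x
          using norm_add_square_le[of "z * v n x" "g x"] by (simp add: norm_mult power_mult_distrib mult.assoc)
      qed (intro locally_integrable_integrable psi2)
      also have "\<dots> = 2 * (norm z)\<^sup>2 * integral {0..0+1} (\<lambda>x. (norm (v n x))\<^sup>2) + 2 * integral {0..0+1} (\<lambda>x. (norm (g x))\<^sup>2)"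
        by (subst Henstock_Kurzweil_Integration.integral_add[OF
              integrable_on_mult_right[OF locally_integrable_integrable[OF lv2]]
              integrable_on_mult_right[OF locally_integrable_integrable[OF lg2]]]) simp
      also have "\<dots> \<le> 2 * (norm z)\<^sup>2 * B + 2 * G"
        by (intro add_mono mult_left_mono 1 sub) auto
      finally show "integral {0..0+1} (\<lambda>x. (norm (z * v n x + g x))\<^sup>2) \<le> 2 * (norm z)\<^sup>2 * B + 2 * G" .
    qed (simp add: D_def)
    finally show ?thesis by (simp add: v_def U_def U'_def data w R_def)
  qed
  have "norm (a n, b n) \<le> sqrt R" for n
  proof -
    have "norm (a n, b n) \<le> norm (a n) + norm (b n)" by (simp add: norm_Pair_le)
    also have "\<dots> \<le> sqrt R" using ab[of n] by (rule real_le_rsqrt)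
    finally show ?thesis .
  qed
  then have "\<forall>n. (a n, b n) \<in> cball 0 (sqrt R)" by simp
  then obtain l r where r: "strict_mono r" and lim: "((\<lambda>n. (a n, b n)) \<circ> r) \<longlonglongrightarrow> l"
    using compact_cball[of "0 :: complex \<times> complex" "sqrt R"] unfolding compact_def by meson
  define u where "u = U (fst l) (snd l)"
  have ulim: "(\<lambda>n. v (r n) x) \<longlonglongrightarrow> u x" for x
  proof -
    have "(\<lambda>n. a (r n)) \<longlonglongrightarrow> fst l" "(\<lambda>n. b (r n)) \<longlonglongrightarrow> snd l"
      using tendsto_fst[OF lim] tendsto_snd[OF lim] by (simp_all add: o_def)
    then show ?thesis unfolding u_def v_def U_def by (intro tendsto_intros)
  qed
  have cu: "continuous_on UNIV u" unfolding u_def by (rule schroedinger_pair_continuous[OF U])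
  have cont_meas: "f \<in> borel_measurable lebesgue" if "continuous_on UNIV f" for f :: "real \<Rightarrow> complex"
    using borel_measurable_continuous_onI[OF that] by (intro measurable_completion) simp
  \<comment> \<open>Fatou: each Dirichlet solution is cut off to its own interval, where the energy
    bound holds, and at a fixed point the cutoff is eventually invisible.\<close>
  have "l2_norm_sq u \<le> ennreal B"
  proof -
    let ?J = "\<lambda>n. {- real (Suc n)..real (Suc n)}"
    have "l2_norm_sq u = (\<integral>\<^sup>+ x. liminf (\<lambda>n. ennreal (indicator (?J (r n)) x * (norm (v (r n) x))\<^sup>2)) \<partial>lebesgue)"
      unfolding l2_norm_sq_def
    proof (intro nn_integral_cong)
      fix x :: real
      have ev: "\<forall>\<^sub>F n in sequentially. x \<in> ?J (r n)"
      proof -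
        obtain N :: nat where N: "\<bar>x\<bar> \<le> real N" using real_arch_simple by blast
        have "x \<in> ?J (r n)" if "n \<ge> N" for n
        proof -
          have "N \<le> r n" using that seq_suble[OF r, of n] by linarith
          then have "real N \<le> real (Suc (r n))" by simp
          then show ?thesis using N by auto
        qed
        then show ?thesis by (auto simp: eventually_sequentially)
      qed
      have "(\<lambda>n. ennreal (indicator (?J (r n)) x * (norm (v (r n) x))\<^sup>2)) \<longlonglongrightarrow> ennreal ((norm (u x))\<^sup>2)"
      proof (rule Lim_transform_eventually)
        show "(\<lambda>n. ennreal ((norm (v (r n) x))\<^sup>2)) \<longlonglongrightarrow> ennreal ((norm (u x))\<^sup>2)"
          by (intro tendsto_intros ulim)
        show "\<forall>\<^sub>F n in sequentially. ennreal ((norm (v (r n) x))\<^sup>2) = ennreal (indicator (?J (r n)) x * (norm (v (r n) x))\<^sup>2)"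
          using ev by eventually_elim simp
      qed
      then show "ennreal ((norm (u x))\<^sup>2) = liminf (\<lambda>n. ennreal (indicator (?J (r n)) x * (norm (v (r n) x))\<^sup>2))"
        by (rule lim_imp_Liminf[OF sequentially_bot, symmetric])
    qed
    also have "\<dots> \<le> liminf (\<lambda>n. \<integral>\<^sup>+ x. ennreal (indicator (?J (r n)) x * (norm (v (r n) x))\<^sup>2) \<partial>lebesgue)"
    proof (rule nn_integral_liminf)
      fix n
      have [measurable]: "v (r n) \<in> borel_measurable lebesgue" by (rule cont_meas[OF cv])
      have [measurable]: "(\<lambda>x. indicat_real (?J (r n)) x) \<in> borel_measurable lebesgue"
        by (rule borel_measurable_indicator) auto
      show "(\<lambda>x. ennreal (indicator (?J (r n)) x * (norm (v (r n) x))\<^sup>2)) \<in> borel_measurable lebesgue"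
        by measurable
    qed
    also have "\<dots> \<le> ennreal B"
    proof (rule Liminf_le)
      show "\<forall>\<^sub>F n in sequentially. (\<integral>\<^sup>+ x. ennreal (indicator (?J (r n)) x * (norm (v (r n) x))\<^sup>2) \<partial>lebesgue) \<le> ennreal B"
      proof (intro always_eventually allI)
        fix n
        have ai: "(\<lambda>x. (norm (v (r n) x))\<^sup>2) absolutely_integrable_on ?J (r n)"
          by (rule locally_integrable_absolutely[OF lv2])
        have "(\<integral>\<^sup>+ x. ennreal (indicator (?J (r n)) x * (norm (v (r n) x))\<^sup>2) \<partial>lebesgue) =
            ennreal (LINT x|lebesgue. indicator (?J (r n)) x * (norm (v (r n) x))\<^sup>2)"
          using ai by (intro nn_integral_eq_integral) (auto simp: set_integrable_def)
        also have "(LINT x|lebesgue. indicator (?J (r n)) x * (norm (v (r n) x))\<^sup>2) =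
            integral (?J (r n)) (\<lambda>x. (norm (v (r n) x))\<^sup>2)"
          using set_lebesgue_integral_eq_integral(2)[OF ai] by (simp add: set_lebesgue_integral_def)
        finally show "(\<integral>\<^sup>+ x. ennreal (indicator (?J (r n)) x * (norm (v (r n) x))\<^sup>2) \<partial>lebesgue) \<le> ennreal B"
          using vB[of "r n"] by (simp add: ennreal_leI)
      qed
    qed simp
    finally show ?thesis .
  qed
  then have "u \<in> L2"
    unfolding L2_def using cont_meas[OF cu] by (auto intro: le_less_trans)
  moreover have "schroedinger_eq V u (\<lambda>x. z * u x + g x)"
    unfolding u_def by (rule schroedinger_pair_eq[OF U])
  ultimately show ?thesis by blast
qed


subsection \<open>The unitary group\<close>

text \<open>The graph of -i H, the generator of exp(-i t H): the relation y = -i H x is written as H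
  x = i y.\<close>

definition generator_graph :: "(real \<Rightarrow> real) \<Rightarrow> l2 \<Rightarrow> l2 \<Rightarrow> bool" where
  "generator_graph V x y \<longleftrightarrow> schroedinger_op V (rep_l2 x) (\<lambda>t. \<i> * rep_l2 y t)"

lemma schroedinger_eq_cong:
  "schroedinger_eq V u \<psi> \<Longrightarrow> AE x in lebesgue. \<psi> x = \<eta> x \<Longrightarrow> schroedinger_eq V u \<eta>"
  by (blast intro: schroedinger_pair_eq schroedinger_pair_cong schroedinger_eq_pair)

lemma schroedinger_op_cong:
  assumes "schroedinger_op V \<phi> \<psi>" "\<phi>' \<in> L2" "\<psi>' \<in> L2"
    and "AE x in lebesgue. \<phi> x = \<phi>' x" "AE x in lebesgue. \<psi> x = \<psi>' x"
  shows "schroedinger_op V \<phi>' \<psi>'"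
proof -
  obtain \<phi>0 where 0: "AE x in lebesgue. \<phi>0 x = \<phi> x" "schroedinger_eq V \<phi>0 \<psi>"
    using assms(1) by (auto simp: schroedinger_op_def)
  have "AE x in lebesgue. \<phi>0 x = \<phi>' x" using 0(1) assms(4) by eventually_elim simp
  then show ?thesis
    using schroedinger_eq_cong[OF 0(2) assms(5)] assms(2,3) by (auto simp: schroedinger_op_def)
qed

lemma generator_graph_abs:
  assumes f: "f \<in> L2" and g: "g \<in> L2"
  shows "generator_graph V (abs_l2 f) (abs_l2 g) \<longleftrightarrow> schroedinger_op V f (\<lambda>t. \<i> * g t)"
proof -
  have a: "AE t in lebesgue. rep_l2 (abs_l2 f) t = f t" "AE t in lebesgue. \<i> * rep_l2 (abs_l2 g) t = \<i> * g t"
    using rep_abs_l2[OF f] rep_abs_l2[OF g] by auto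
  then have b: "AE t in lebesgue. f t = rep_l2 (abs_l2 f) t" "AE t in lebesgue. \<i> * g t = \<i> * rep_l2 (abs_l2 g) t"
    by (auto elim: eventually_mono)
  show ?thesis
    unfolding generator_graph_def
    using schroedinger_op_cong[OF _ f L2_cmult[OF g] a] schroedinger_op_cong[OF _ rep_l2_L2 L2_cmult[OF rep_l2_L2] b]
    by blast
qed

lemma schroedinger_op_combine:
  assumes "schroedinger_op V \<phi> \<psi>" "schroedinger_op V \<phi>' \<psi>'"
  shows "schroedinger_op V (\<lambda>x. a * \<phi> x + b * \<phi>' x) (\<lambda>x. a * \<psi> x + b * \<psi>' x)"
proof -
  obtain \<phi>0 \<phi>1 where 0: "AE x in lebesgue. \<phi>0 x = \<phi> x" "schroedinger_eq V \<phi>0 \<psi>"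
    and 1: "AE x in lebesgue. \<phi>1 x = \<phi>' x" "schroedinger_eq V \<phi>1 \<psi>'"
    using assms by (auto simp: schroedinger_op_def)
  have "AE x in lebesgue. a * \<phi>0 x + b * \<phi>1 x = a * \<phi> x + b * \<phi>' x"
    using 0(1) 1(1) by eventually_elim simp
  moreover have "schroedinger_eq V (\<lambda>x. a * \<phi>0 x + b * \<phi>1 x) (\<lambda>x. a * \<psi> x + b * \<psi>' x)"
    by (rule schroedinger_pair_eq[OF schroedinger_pair_combine[OF schroedinger_eq_pair[OF 0(2)] schroedinger_eq_pair[OF 1(2)]]])
  ultimately show ?thesis
    using assms by (auto simp: schroedinger_op_def intro!: L2_add L2_cmult)
qed

lemma schroedinger_op_symmetric:
  assumes V: "uniformly_locally_integrable V" and op: "schroedinger_op V \<phi> \<psi>"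
  shows "(LINT x|lebesgue. Im (\<psi> x * cnj (\<phi> x))) = 0"
proof -
  obtain \<phi>0 where 0: "AE x in lebesgue. \<phi>0 x = \<phi> x" "schroedinger_eq V \<phi>0 \<psi>"
    and L2: "\<phi> \<in> L2" "\<psi> \<in> L2"
    using op by (auto simp: schroedinger_op_def)
  have eq0: "AE x in lebesgue. \<phi> x = \<phi>0 x" using 0(1) by (auto elim: eventually_mono)
  have m: "\<phi>0 \<in> borel_measurable lebesgue"
    by (rule borel_measurable_AE[OF L2_measurable[OF L2(1)] eq0])
  have \<phi>0: "\<phi>0 \<in> L2" by (rule L2_AE_cong[OF L2(1) m eq0])
  have "(LINT x|lebesgue. Im (\<psi> x * cnj (\<phi> x))) = (LINT x|lebesgue. Im (\<psi> x * cnj (\<phi>0 x)))"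
  proof (rule integral_cong_AE)
    show "(\<lambda>x. Im (\<psi> x * cnj (\<phi> x))) \<in> borel_measurable lebesgue" "(\<lambda>x. Im (\<psi> x * cnj (\<phi>0 x))) \<in> borel_measurable lebesgue"
      by (rule borel_measurable_integrable[OF integrable_Im[OF L2_integrable_product]], (rule L2 \<phi>0)+)+
    show "AE x in lebesgue. Im (\<psi> x * cnj (\<phi> x)) = Im (\<psi> x * cnj (\<phi>0 x))"
      using eq0 by eventually_elim simp
  qed
  then show ?thesis using operator_symmetric[OF V 0(2) \<phi>0 L2(2)] by simp
qed

lemma scaleR_l2_abs: "f \<in> L2 \<Longrightarrow> c *\<^sub>R abs_l2 f = abs_l2 (\<lambda>x. complex_of_real c * f x)"
  by (simp add: abs_l2_scaleC flip: scaleC_l2_of_real)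

lemma skew_adjoint_generator:
  assumes V: "uniformly_locally_integrable V"
  shows "skew_adjoint (generator_graph V)"
proof
  note lV = uniformly_locally_integrable_bound(1)[OF V]
  have rep: "generator_graph V x y \<longleftrightarrow> schroedinger_op V (rep_l2 x) (\<lambda>t. \<i> * rep_l2 y t)" for x y
    by (simp add: generator_graph_def)
  fix x x' y y' :: l2 and c :: real
  show "generator_graph V (x + y) (x' + y')" if "generator_graph V x x'" "generator_graph V y y'"
  proof -
    have "generator_graph V (abs_l2 (\<lambda>t. rep_l2 x t + rep_l2 y t)) (abs_l2 (\<lambda>t. rep_l2 x' t + rep_l2 y' t))"
      using schroedinger_op_combine[of V "rep_l2 x" "\<lambda>t. \<i> * rep_l2 x' t" "rep_l2 y" "\<lambda>t. \<i> * rep_l2 y' t" 1 1] that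
      by (subst generator_graph_abs) (auto intro!: L2_add simp: rep distrib_left)
    then show ?thesis by (simp flip: abs_l2_add)
  qed
  show "generator_graph V (c *\<^sub>R x) (c *\<^sub>R x')" if "generator_graph V x x'"
  proof -
    have "generator_graph V (abs_l2 (\<lambda>t. complex_of_real c * rep_l2 x t)) (abs_l2 (\<lambda>t. complex_of_real c * rep_l2 x' t))"
      using schroedinger_op_combine[of V "rep_l2 x" "\<lambda>t. \<i> * rep_l2 x' t" "rep_l2 x" "\<lambda>t. \<i> * rep_l2 x' t" c 0] that
      by (subst generator_graph_abs) (auto intro!: L2_cmult simp: rep mult.left_commute)
    then show ?thesis by (simp flip: scaleR_l2_abs)
  qed
  show "inner x' x = 0" if "generator_graph V x x'"
  proof -
    have "(LINT t|lebesgue. Im (\<i> * rep_l2 x' t * cnj (rep_l2 x t))) = 0"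
      using that schroedinger_op_symmetric[OF V] by (simp only: rep)
    moreover have "Im (\<i> * a * cnj b) = Re (a * cnj b)" for a b by simp
    ultimately show ?thesis by (simp only: inner_l2_rep)
  qed
  show "y = 0" if zero: "generator_graph V 0 y"
  proof -
    obtain \<phi>0 where 0: "AE x in lebesgue. \<phi>0 x = rep_l2 0 x" "schroedinger_eq V \<phi>0 (\<lambda>t. \<i> * rep_l2 y t)"
      using zero by (auto simp: rep schroedinger_op_def)
    have "AE x in lebesgue. rep_l2 0 x = 0"
      using rep_abs_l2[OF L2_zero] by (simp add: zero_l2_def)
    with 0(1) have "AE x in lebesgue. \<phi>0 x = 0" by eventually_elim simp
    from schroedinger_eq_zero[OF lV 0(2) this] have "AE x in lebesgue. rep_l2 y x = 0" by simp
    then have "abs_l2 (rep_l2 y) = abs_l2 (\<lambda>x. 0)" by (intro abs_l2_eqI) (auto simp: L2_zero)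
    then show ?thesis by (simp add: zero_l2_def)
  qed
  show "\<exists>x x'. generator_graph V x x' \<and> x - c *\<^sub>R x' = g" if c: "c \<noteq> 0" for g
  proof -
    \<comment> \<open>With x' = -i H x the equation x - c x' = g reads (H - z) x = - z g for this
      \<open>z\<close>, whose imaginary part 1/c is nonzero.\<close>
    define z where "z = \<i> / complex_of_real c"
    have z: "Im z \<noteq> 0" using c by (simp add: z_def Im_divide_of_real)
    obtain u where u: "u \<in> L2" "schroedinger_eq V u (\<lambda>x. z * u x + (- z) * rep_l2 g x)"
      using resolvent_exists[OF V z L2_cmult[OF rep_l2_L2, of "- z" g]] by blast
    define u' where "u' t = - \<i> * (z * u t + (- z) * rep_l2 g t)" for t
    have u': "u' \<in> L2" unfolding u'_def by (intro L2_cmult L2_add u rep_l2_L2)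
    have iu': "(\<lambda>t. \<i> * u' t) = (\<lambda>x. z * u x + (- z) * rep_l2 g x)"
      by (auto simp: u'_def algebra_simps)
    have "schroedinger_op V u (\<lambda>t. \<i> * u' t)"
      unfolding schroedinger_op_def iu' using u by (auto intro!: L2_add L2_cmult L2_diff)
    then have "generator_graph V (abs_l2 u) (abs_l2 u')" by (simp add: generator_graph_abs u u')
    moreover have "abs_l2 u - c *\<^sub>R abs_l2 u' = g"
    proof -
      have "abs_l2 u - c *\<^sub>R abs_l2 u' = abs_l2 (\<lambda>t. u t - complex_of_real c * u' t)"
        by (simp add: scaleR_l2_abs abs_l2_diff u u' L2_cmult)
      also have "(\<lambda>t. u t - complex_of_real c * u' t) = rep_l2 g"
        using c by (auto simp: u'_def z_def field_simps)
      finally show ?thesis by simp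
    qed
    ultimately show ?thesis by blast
  qed
qed

lemma generator_graph_scaleC:
  assumes "generator_graph V x x'" shows "generator_graph V (scaleC_l2 c x) (scaleC_l2 c x')"
proof -
  have "generator_graph V (abs_l2 (\<lambda>t. c * rep_l2 x t)) (abs_l2 (\<lambda>t. c * rep_l2 x' t))"
    using schroedinger_op_combine[of V "rep_l2 x" "\<lambda>t. \<i> * rep_l2 x' t" "rep_l2 x" "\<lambda>t. \<i> * rep_l2 x' t" c 0] assms
    by (subst generator_graph_abs) (auto intro!: L2_cmult simp: generator_graph_def mult.left_commute)
  then show ?thesis by (simp flip: abs_l2_scaleC)
qed

lemma tendsto_ennreal_norm_sq_iff:
  fixes h :: "'a \<Rightarrow> 'b::real_normed_vector"
  shows "((\<lambda>t. ennreal ((norm (h t))\<^sup>2)) \<longlongrightarrow> 0) F \<longleftrightarrow> (h \<longlongrightarrow> 0) F"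
proof -
  have "((\<lambda>t. ennreal ((norm (h t))\<^sup>2)) \<longlongrightarrow> 0) F \<longleftrightarrow> ((\<lambda>t. (norm (h t))\<^sup>2) \<longlongrightarrow> 0) F"
    using tendsto_ennreal_iff[of "\<lambda>t. (norm (h t))\<^sup>2" F 0] by simp
  also have "\<dots> \<longleftrightarrow> (h \<longlongrightarrow> 0) F"
  proof
    assume "((\<lambda>t. (norm (h t))\<^sup>2) \<longlongrightarrow> 0) F"
    from tendsto_real_sqrt[OF this] have "((\<lambda>t. norm (h t)) \<longlongrightarrow> 0) F" by simp
    then show "(h \<longlongrightarrow> 0) F" by (rule tendsto_norm_zero_cancel)
  next
    assume "(h \<longlongrightarrow> 0) F"
    then show "((\<lambda>t. (norm (h t))\<^sup>2) \<longlongrightarrow> 0) F"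
      using tendsto_power[OF tendsto_norm_zero, of h F 2] by simp
  qed
  finally show ?thesis .
qed

lemma difference_quotient_l2:
  assumes f: "f \<in> L2" and g: "g \<in> L2" and h: "h \<in> L2"
  shows "l2_norm_sq (\<lambda>x. (f x - g x) / complex_of_real t + \<i> * h x) =
    ennreal ((norm ((abs_l2 f - abs_l2 g) /\<^sub>R t - abs_l2 (\<lambda>x. - \<i> * h x)))\<^sup>2)"
proof -
  have "(\<lambda>x. (f x - g x) / complex_of_real t + \<i> * h x) =
      (\<lambda>x. complex_of_real (inverse t) * (f x - g x) - (- \<i> * h x))"
    by (auto simp: field_simps)
  moreover have L: "(\<lambda>x. f x - g x) \<in> L2" "(\<lambda>x. - \<i> * h x) \<in> L2"
    using L2_diff[OF f g] L2_cmult[OF h, of "- \<i>"] by auto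
  ultimately have "l2_norm_sq (\<lambda>x. (f x - g x) / complex_of_real t + \<i> * h x) =
      ennreal ((norm (abs_l2 (\<lambda>x. complex_of_real (inverse t) * (f x - g x) - (- \<i> * h x))))\<^sup>2)"
    by (simp only: l2_norm_sq_abs[OF L2_diff[OF L2_cmult[OF L(1)] L(2)]])
  also have "abs_l2 (\<lambda>x. complex_of_real (inverse t) * (f x - g x) - (- \<i> * h x)) =
      (abs_l2 f - abs_l2 g) /\<^sub>R t - abs_l2 (\<lambda>x. - \<i> * h x)"
    by (simp only: scaleR_l2_abs[OF L(1)] abs_l2_diff[OF f g] abs_l2_diff[OF L2_cmult[OF L(1)] L(2)])
  finally show ?thesis .
qed

text \<open>Exhibiting one such group is enough for the choice operator; whatever is said later
  about \<open>evolution\<close> is derived from these defining properties.\<close>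

lemma evolution_unitary_group:
  assumes V: "uniformly_locally_integrable V"
  shows "unitary_group_generated_by (schroedinger_op V) (evolution V)"
proof -
  interpret skew_adjoint "generator_graph V" by (rule skew_adjoint_generator[OF V])
  define U where "U t f = rep_l2 (flow t (abs_l2 f))" for t f
  have absU: "abs_l2 (U t f) = flow t (abs_l2 f)" for t f by (simp add: U_def)
  have U: "U t f \<in> L2" for t f by (simp add: U_def)
  have "unitary_group_generated_by (schroedinger_op V) U"
    unfolding unitary_group_generated_by_def
  proof (intro conjI allI ballI)
    fix s t :: real and f g :: "real \<Rightarrow> complex" and a b :: complex
    assume f: "f \<in> L2"
    show "U t f \<in> L2" by (rule U)
    show "l2_norm_sq (U t f) = l2_norm_sq f"
      by (simp add: l2_norm_sq_abs U f absU)
    show "AE x in lebesgue. U 0 f x = f x"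
      using rep_abs_l2[OF f] by (simp add: U_def)
    show "AE x in lebesgue. U (s + t) f x = U s (U t f) x"
      by (simp add: U_def flow_add)
    have "((\<lambda>t. flow t (abs_l2 f) - abs_l2 f) \<longlongrightarrow> 0) (at 0)"
      by (rule LIM_zero[OF flow_tendsto_initial])
    then show "((\<lambda>t. l2_norm_sq (\<lambda>x. U t f x - f x)) \<longlongrightarrow> 0) (at 0)"
      by (simp add: l2_norm_sq_abs L2_diff U f absU tendsto_ennreal_norm_sq_iff flip: abs_l2_diff)
    assume g: "g \<in> L2"
    have "flow t (abs_l2 (\<lambda>y. a * f y + b * g y)) = scaleC_l2 a (flow t (abs_l2 f)) + scaleC_l2 b (flow t (abs_l2 g))"
      by (simp add: linear_add[OF linear_flow] flow_commute[OF scaleC_l2.bounded_linear_right generator_graph_scaleC]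
          f g L2_cmult flip: abs_l2_add abs_l2_scaleC)
    then have "abs_l2 (U t (\<lambda>y. a * f y + b * g y)) = abs_l2 (\<lambda>x. a * U t f x + b * U t g x)"
      by (simp add: absU U L2_cmult flip: abs_l2_add abs_l2_scaleC)
    then show "AE x in lebesgue. U t (\<lambda>y. a * f y + b * g y) x = a * U t f x + b * U t g x"
      by (subst (asm) abs_l2_eq_iff) (auto intro!: U L2_add L2_cmult)
  next
    fix \<phi> \<psi> :: "real \<Rightarrow> complex" assume \<phi>: "\<phi> \<in> L2" and \<psi>: "\<psi> \<in> L2"
    have i: "(\<lambda>t. \<i> * (- \<i> * \<psi> t)) = \<psi>" by (auto simp: algebra_simps)
    have "schroedinger_op V \<phi> \<psi> \<longleftrightarrow> generator_graph V (abs_l2 \<phi>) (abs_l2 (\<lambda>x. - \<i> * \<psi> x))"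
      unfolding generator_graph_abs[OF \<phi> L2_cmult[OF \<psi>]] i ..
    also have "\<dots> \<longleftrightarrow> ((\<lambda>t. (flow t (abs_l2 \<phi>) - abs_l2 \<phi>) /\<^sub>R t) \<longlongrightarrow> abs_l2 (\<lambda>x. - \<i> * \<psi> x)) (at 0)"
      by (rule generator_iff[symmetric])
    also have "\<dots> \<longleftrightarrow> ((\<lambda>t. l2_norm_sq (\<lambda>x. (U t \<phi> x - \<phi> x) / complex_of_real t + \<i> * \<psi> x)) \<longlongrightarrow> 0) (at 0)"
      unfolding difference_quotient_l2[OF U \<phi> \<psi>] tendsto_ennreal_norm_sq_iff absU
      by (rule LIM_zero_iff[symmetric])
    finally show "schroedinger_op V \<phi> \<psi> \<longleftrightarrow>
        ((\<lambda>t. l2_norm_sq (\<lambda>x. (U t \<phi> x - \<phi> x) / complex_of_real t + \<i> * \<psi> x)) \<longlongrightarrow> 0) (at 0)" .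
  qed
  then show ?thesis unfolding evolution_def by (rule someI[of "unitary_group_generated_by (schroedinger_op V)"])
qed

section \<open>The chosen evolution as a group on the Hilbert space\<close>

definition evolution_l2 :: "(real \<Rightarrow> real) \<Rightarrow> real \<Rightarrow> l2 \<Rightarrow> l2" where
  "evolution_l2 V t x = abs_l2 (evolution V t (rep_l2 x))"

context
  fixes V assumes V: "uniformly_locally_integrable V"
begin

private lemma U_L2: "f \<in> L2 \<Longrightarrow> evolution V t f \<in> L2"
  and U_norm: "f \<in> L2 \<Longrightarrow> l2_norm_sq (evolution V t f) = l2_norm_sq f"
  and U_linear: "f \<in> L2 \<Longrightarrow> g \<in> L2 \<Longrightarrow> AE x in lebesgue.
        evolution V t (\<lambda>y. a * f y + b * g y) x = a * evolution V t f x + b * evolution V t g x"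
  and U_0: "f \<in> L2 \<Longrightarrow> AE x in lebesgue. evolution V 0 f x = f x"
  and U_add: "f \<in> L2 \<Longrightarrow> AE x in lebesgue. evolution V (s + t) f x = evolution V s (evolution V t f) x"
  and U_cont: "f \<in> L2 \<Longrightarrow> ((\<lambda>t. l2_norm_sq (\<lambda>x. evolution V t f x - f x)) \<longlongrightarrow> 0) (at 0)"
  and U_generator: "\<phi> \<in> L2 \<Longrightarrow> \<psi> \<in> L2 \<Longrightarrow> schroedinger_op V \<phi> \<psi> \<Longrightarrow>
        ((\<lambda>t. l2_norm_sq (\<lambda>x. (evolution V t \<phi> x - \<phi> x) / complex_of_real t + \<i> * \<psi> x)) \<longlongrightarrow> 0) (at 0)"
  using evolution_unitary_group[OF V] unfolding unitary_group_generated_by_def by blast+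

text \<open>The defining properties do not mention respect for almost everywhere equality. It
  follows from them: the difference of two representatives has norm 0, which linearity and norm
  preservation carry over to the images.\<close>

lemma abs_l2_evolution:
  assumes f: "f \<in> L2" shows "abs_l2 (evolution V t f) = evolution_l2 V t (abs_l2 f)"
proof -
  define g where "g = rep_l2 (abs_l2 f)"
  have g: "g \<in> L2" by (simp add: g_def)
  have d: "(\<lambda>y. 1 * f y + (-1) * g y) \<in> L2" by (intro L2_add L2_cmult f g)
  have "abs_l2 f = abs_l2 g" by (simp add: g_def)
  then have "l2_norm_sq (\<lambda>y. 1 * f y + (-1) * g y) = 0"
    using l2_norm_sq_abs[OF L2_diff[OF f g]] by (simp flip: abs_l2_diff[OF f g])
  then have "l2_norm_sq (evolution V t (\<lambda>y. 1 * f y + (-1) * g y)) = 0"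
    using U_norm[OF d] by simp
  moreover have "abs_l2 (evolution V t (\<lambda>y. 1 * f y + (-1) * g y)) =
      abs_l2 (\<lambda>x. 1 * evolution V t f x + (-1) * evolution V t g x)"
    by (intro abs_l2_eqI U_linear U_L2 L2_add L2_cmult f g)
  ultimately have "norm (abs_l2 (\<lambda>x. 1 * evolution V t f x + (-1) * evolution V t g x)) = 0"
    using l2_norm_sq_abs[OF U_L2[OF d], of t] by simp
  then have "norm (abs_l2 (evolution V t f) - abs_l2 (evolution V t g)) = 0"
    by (simp add: abs_l2_diff U_L2 f g)
  then show ?thesis by (simp add: evolution_l2_def g_def)
qed

lemma norm_evolution_l2 [simp]: "norm (evolution_l2 V t x) = norm x"
proof -
  have "ennreal ((norm (evolution_l2 V t x))\<^sup>2) = ennreal ((norm x)\<^sup>2)"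
    using U_norm[OF rep_l2_L2, of t x] by (simp add: l2_norm_sq_abs U_L2 evolution_l2_def)
  then show ?thesis by simp
qed

lemma evolution_l2_combine:
  "evolution_l2 V t (scaleC_l2 a x + scaleC_l2 b y) = scaleC_l2 a (evolution_l2 V t x) + scaleC_l2 b (evolution_l2 V t y)"
proof -
  have "abs_l2 (evolution V t (\<lambda>s. a * rep_l2 x s + b * rep_l2 y s)) =
      abs_l2 (\<lambda>s. a * evolution V t (rep_l2 x) s + b * evolution V t (rep_l2 y) s)"
    by (intro abs_l2_eqI U_linear U_L2 L2_add L2_cmult rep_l2_L2)
  then show ?thesis
    by (simp add: abs_l2_evolution L2_add L2_cmult U_L2 flip: abs_l2_add abs_l2_scaleC)
qed

lemma evolution_l2_scaleC: "evolution_l2 V t (scaleC_l2 a x) = scaleC_l2 a (evolution_l2 V t x)"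
  using evolution_l2_combine[of t a x 0 0] by (simp add: scaleC_l2.zero_left)

lemma bounded_linear_evolution_l2: "bounded_linear (evolution_l2 V t)"
proof (rule bounded_linear_intro[where K = 1])
  show "evolution_l2 V t (x + y) = evolution_l2 V t x + evolution_l2 V t y" for x y
    using evolution_l2_combine[of t 1 x 1 y] by simp
  show "evolution_l2 V t (r *\<^sub>R x) = r *\<^sub>R evolution_l2 V t x" for r x
    using evolution_l2_scaleC[of t "complex_of_real r" x] by (simp add: scaleC_l2_of_real)
qed simp

lemma evolution_l2_0 [simp]: "evolution_l2 V 0 x = x"
proof -
  have "abs_l2 (evolution V 0 (rep_l2 x)) = abs_l2 (rep_l2 x)"
    by (intro abs_l2_eqI U_0 U_L2 rep_l2_L2)
  then show ?thesis by (simp add: evolution_l2_def)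
qed

lemma evolution_l2_add: "evolution_l2 V (s + t) x = evolution_l2 V s (evolution_l2 V t x)"
proof -
  have "abs_l2 (evolution V (s + t) (rep_l2 x)) = abs_l2 (evolution V s (evolution V t (rep_l2 x)))"
    by (intro abs_l2_eqI U_add U_L2 rep_l2_L2)
  then show ?thesis by (simp add: abs_l2_evolution U_L2)
qed

lemma evolution_l2_tendsto: "((\<lambda>t. evolution_l2 V t x) \<longlongrightarrow> x) (at 0)"
proof -
  have "((\<lambda>t. evolution_l2 V t x - x) \<longlongrightarrow> 0) (at 0)"
    using U_cont[OF rep_l2_L2, of x]
    by (simp add: l2_norm_sq_abs L2_diff U_L2 tendsto_ennreal_norm_sq_iff abs_l2_evolution flip: abs_l2_diff)
  then show ?thesis by (simp add: LIM_zero_iff)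
qed

lemma evolution_l2_continuous: "continuous_on S (\<lambda>t. evolution_l2 V t x)"
proof -
  have "isCont (\<lambda>t. evolution_l2 V t x) s" for s
  proof -
    interpret bounded_linear "evolution_l2 V s" by (rule bounded_linear_evolution_l2)
    have "((\<lambda>h. evolution_l2 V s (evolution_l2 V h x)) \<longlongrightarrow> evolution_l2 V s x) (at 0)"
      by (rule tendsto[OF evolution_l2_tendsto])
    then show ?thesis unfolding isCont_iff by (simp add: evolution_l2_add)
  qed
  then show ?thesis by (simp add: continuous_at_imp_continuous_on)
qed

text \<open>The defining property gives the derivative at 0; the group law and continuity of
  \<open>evolution_l2 V s\<close> move it to \<open>s\<close>.\<close>

lemma evolution_l2_derivative:
  assumes "generator_graph V x y"
  shows "((\<lambda>t. evolution_l2 V t x) has_vector_derivative evolution_l2 V s y) (at s)"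
proof -
  interpret bounded_linear "evolution_l2 V s" by (rule bounded_linear_evolution_l2)
  have op: "schroedinger_op V (rep_l2 x) (\<lambda>t. \<i> * rep_l2 y t)"
    using assms by (simp add: generator_graph_def)
  have i: "(\<lambda>t. - \<i> * (\<i> * rep_l2 y t)) = rep_l2 y" by (auto simp: algebra_simps)
  have "((\<lambda>t. (evolution_l2 V t x - x) /\<^sub>R t) \<longlongrightarrow> y) (at 0)"
  proof -
    have "((\<lambda>t. (evolution_l2 V t x - x) /\<^sub>R t - y) \<longlongrightarrow> 0) (at 0)"
      using U_generator[OF rep_l2_L2 L2_cmult[OF rep_l2_L2] op]
      unfolding difference_quotient_l2[OF U_L2[OF rep_l2_L2] rep_l2_L2 L2_cmult[OF rep_l2_L2]] i
        tendsto_ennreal_norm_sq_iff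
      by (simp add: abs_l2_evolution)
    then show ?thesis by (simp add: LIM_zero_iff)
  qed
  then have "((\<lambda>h. evolution_l2 V s ((evolution_l2 V h x - x) /\<^sub>R h)) \<longlongrightarrow> evolution_l2 V s y) (at 0)"
    by (rule tendsto)
  then have "((\<lambda>h. (evolution_l2 V (s + h) x - evolution_l2 V s x) /\<^sub>R h) \<longlongrightarrow> evolution_l2 V s y) (at 0)"
    by (simp add: scaleR diff evolution_l2_add)
  then have "((\<lambda>h. norm ((evolution_l2 V (s + h) x - evolution_l2 V s x) /\<^sub>R h - evolution_l2 V s y)) \<longlongrightarrow> 0) (at 0)"
    by (simp add: LIM_zero tendsto_norm_zero)
  then show ?thesis
    unfolding has_vector_derivative_def has_derivative_at
  proof (intro conjI bounded_linear_scaleR_left)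
    assume *: "((\<lambda>h. norm ((evolution_l2 V (s + h) x - evolution_l2 V s x) /\<^sub>R h - evolution_l2 V s y)) \<longlongrightarrow> 0) (at 0)"
    show "((\<lambda>h. norm (evolution_l2 V (s + h) x - evolution_l2 V s x - h *\<^sub>R evolution_l2 V s y) / norm h) \<longlongrightarrow> 0) (at 0)"
    proof (rule Lim_transform_eventually[OF *])
      show "\<forall>\<^sub>F h in at 0. norm ((evolution_l2 V (s + h) x - evolution_l2 V s x) /\<^sub>R h - evolution_l2 V s y) =
          norm (evolution_l2 V (s + h) x - evolution_l2 V s x - h *\<^sub>R evolution_l2 V s y) / norm h"
      proof (unfold eventually_at_filter, intro always_eventually allI impI)
        fix h :: real assume h: "h \<noteq> 0"
        let ?d = "evolution_l2 V (s + h) x - evolution_l2 V s x"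
        have "?d /\<^sub>R h - evolution_l2 V s y = (?d - h *\<^sub>R evolution_l2 V s y) /\<^sub>R h"
          using h by (simp add: scaleR_diff_right)
        then show "norm (?d /\<^sub>R h - evolution_l2 V s y) = norm (?d - h *\<^sub>R evolution_l2 V s y) / norm h"
          by (simp only: norm_scaleR) (simp add: divide_inverse mult.commute)
      qed
    qed
  qed
qed

end


subsection \<open>Time averages and the resolvent\<close>

lemma restrict_l2_add: "restrict_l2 S (x + y) = restrict_l2 S x + restrict_l2 S y"
  by transfer (auto simp: L2_restrict L2_add)

lemma norm_restrict_l2_sq:
  assumes "f \<in> L2" "S \<in> sets lebesgue"
  shows "(norm (restrict_l2 S (abs_l2 f)))\<^sup>2 = (LINT x|lebesgue. indicator S x * (norm (f x))\<^sup>2)"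
proof -
  have "(norm (restrict_l2 S (abs_l2 f)))\<^sup>2 = (LINT x|lebesgue. (norm (if S \<in> sets lebesgue \<and> x \<in> S then f x else 0))\<^sup>2)"
    using assms(1) by (subst restrict_l2.abs_eq) (auto intro: norm_abs_l2_sq[OF L2_restrict])
  also have "\<dots> = (LINT x|lebesgue. indicator S x * (norm (f x))\<^sup>2)"
    by (rule Bochner_Integration.integral_cong) (use assms(2) in \<open>auto simp: indicator_def\<close>)
  finally show ?thesis .
qed

lemma norm_restrict_l2_le: "norm (restrict_l2 S x) \<le> norm x"
proof -
  have "(norm (restrict_l2 S (abs_l2 (rep_l2 x))))\<^sup>2 \<le> (norm (abs_l2 (rep_l2 x)))\<^sup>2"
    unfolding norm_abs_l2_sq[OF rep_l2_L2] restrict_l2.abs_eq[unfolded eq_onp_def, simplified, OF rep_l2_L2]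
      norm_abs_l2_sq[OF L2_restrict[OF rep_l2_L2]]
    by (intro integral_mono L2_integrable L2_restrict rep_l2_L2) auto
  then show ?thesis by (simp add: power2_le_iff_abs_le)
qed

lemma bounded_linear_restrict_l2: "bounded_linear (restrict_l2 S)"
proof (rule bounded_linear_intro[where K = 1])
  show "restrict_l2 S (r *\<^sub>R x) = r *\<^sub>R restrict_l2 S x" for r x
    using restrict_l2_scaleC[of S "complex_of_real r" x] by (simp add: scaleC_l2_of_real)
qed (simp_all add: restrict_l2_add norm_restrict_l2_le)

section \<open>The Bessel inequality on an energy window\<close>

lemma integral_split_unit_intervals:
  fixes g :: "real \<Rightarrow> 'a::banach"
  assumes g: "continuous_on UNIV g"
  shows "integral {0..real K} g = (\<Sum>k<K. integral {0..1} (\<lambda>\<tau>. g (\<tau> + real k)))"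
proof (induction K)
  case (Suc K)
  have gi: "g integrable_on {a..b}" for a b
    by (intro integrable_continuous_real continuous_on_subset[OF g]) auto
  have "integral {0..real (Suc K)} g = integral {0..real K} g + integral {real K..real (Suc K)} g"
    by (rule Henstock_Kurzweil_Integration.integral_combine[symmetric]) (auto intro: gi)
  also have "integral {real K..real (Suc K)} g = integral {0..1} (\<lambda>\<tau>. g (\<tau> + real K))"
    using integral_shift_Icc_real[of 0 1 g "real K"]
    by (simp add: o_def add.commute)
  finally show ?case using Suc by simp
qed simp

lemma norm_integral_square_le:
  fixes g :: "real \<Rightarrow> 'a::banach"
  assumes g: "continuous_on UNIV g"
  shows "(norm (integral {0..1} g))\<^sup>2 \<le> integral {0..1} (\<lambda>t. (norm (g t))\<^sup>2)"
proof -
  have c: "continuous_on S (\<lambda>t. norm (g t))" for S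
    using g by (intro continuous_on_norm) (auto intro: continuous_on_subset)
  have "norm (integral {0..1} g) \<le> integral {0..1} (\<lambda>t. norm (g t))"
    by (intro integral_norm_bound_integral integrable_continuous_real continuous_on_subset[OF g] c) auto
  then have "(norm (integral {0..1} g))\<^sup>2 \<le> (integral {0..1} (\<lambda>t. norm (g t)))\<^sup>2"
    by (intro power_mono) auto
  also have "\<dots> \<le> integral {0..1} (\<lambda>t. (norm (g t))\<^sup>2)"
    using integral_square_le[of "\<lambda>t. norm (g t)" 0]
    by (simp add: locally_integrable_continuous c continuous_on_power)
  finally show ?thesis .
qed

lemma
  fixes m :: int and e :: real
  shows has_integral_cos_period: "((\<lambda>E. cos (E * of_int m)) has_integral (if m = 0 then 2 * pi else 0)) {e - pi..e + pi}"
    and has_integral_sin_period: "((\<lambda>E. sin (E * of_int m)) has_integral 0) {e - pi..e + pi}"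
proof -
  have s: "sin (pi * of_int m) = 0" by (rule sin_npi_int)
  show "((\<lambda>E. cos (E * of_int m)) has_integral (if m = 0 then 2 * pi else 0)) {e - pi..e + pi}"
  proof (cases "m = 0")
    case True
    then show ?thesis using has_integral_const_real[of "1::real" "e - pi" "e + pi"] by simp
  next
    case False
    have "((\<lambda>E. cos (E * of_int m)) has_integral
        sin ((e + pi) * of_int m) / of_int m - sin ((e - pi) * of_int m) / of_int m) {e - pi..e + pi}"
      by (rule fundamental_theorem_of_calculus)
        (use False in \<open>auto intro!: derivative_eq_intros simp flip: has_real_derivative_iff_has_vector_derivative\<close>)
    moreover have "sin ((e + pi) * of_int m) = sin ((e - pi) * of_int m)"
      using s by (simp add: distrib_right left_diff_distrib sin_add sin_diff)
    ultimately show ?thesis using False by simp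
  qed
  show "((\<lambda>E. sin (E * of_int m)) has_integral 0) {e - pi..e + pi}"
  proof (cases "m = 0")
    case False
    have "((\<lambda>E. sin (E * of_int m)) has_integral
        - cos ((e + pi) * of_int m) / of_int m - - cos ((e - pi) * of_int m) / of_int m) {e - pi..e + pi}"
      by (rule fundamental_theorem_of_calculus)
        (use False in \<open>auto intro!: derivative_eq_intros simp flip: has_real_derivative_iff_has_vector_derivative\<close>)
    moreover have "cos ((e + pi) * of_int m) = cos ((e - pi) * of_int m)"
      using s by (simp add: distrib_right left_diff_distrib cos_add cos_diff)
    ultimately show ?thesis by simp
  qed simp
qed

text \<open>A Bessel inequality for the Fourier transform on an energy window of length \<open>2\<pi>\<close>: splitting the
  time axis into unit intervals reduces it to the orthogonality of the characters \<open>cis (k E)\<close>, so that no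
  Fourier inversion is needed. The function \<open>\<Phi>\<close> is \<open>\<integral>\<^sub>0\<^sup>1 \<parallel>\<Sum>\<^sub>k cis (k E) h (\<tau> + k)\<parallel>\<^sup>2 d\<tau>\<close>.\<close>

lemma bessel_window:
  fixes h :: "real \<Rightarrow> l2" and K :: nat and e :: real
  assumes h: "continuous_on UNIV h"
  obtains \<Phi> where "continuous_on UNIV \<Phi>"
    "\<And>E. (norm (integral {0..real K} (\<lambda>t. scaleC_l2 (cis (E * t)) (h t))))\<^sup>2 \<le> \<Phi> E"
    "(\<Phi> has_integral 2 * pi * integral {0..real K} (\<lambda>t. (norm (h t))\<^sup>2)) {e - pi..e + pi}"
proof -
  have hc: "continuous_on S (\<lambda>\<tau>. h (\<tau> + real k))" for S k
    by (rule continuous_on_compose2[OF h]) (auto intro!: continuous_intros)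
  \<comment> \<open>The real inner product sees a relative phase cis \<theta> as cos \<theta> times
    the entry of \<open>P\<close> plus sin \<theta> times the entry of \<open>Q\<close>; together
    they hold the complex Gram matrix of the unit pieces of \<open>h\<close>.\<close>
  define P where "P k l = integral {0..1} (\<lambda>\<tau>. inner (h (\<tau> + real k)) (h (\<tau> + real l)))" for k l
  define Q where "Q k l = integral {0..1} (\<lambda>\<tau>. inner (scaleC_l2 \<i> (h (\<tau> + real k))) (h (\<tau> + real l)))" for k l
  define \<Phi> where "\<Phi> E = (\<Sum>k<K. \<Sum>l<K. cos (E * of_int (int k - int l)) * P k l + sin (E * of_int (int k - int l)) * Q k l)" for E
  have Pi: "((\<lambda>\<tau>. inner (h (\<tau> + real k)) (h (\<tau> + real l))) has_integral P k l) {0..1}" for k l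
    unfolding P_def by (intro integrable_integral integrable_continuous_real continuous_intros hc)
  have Qi: "((\<lambda>\<tau>. inner (scaleC_l2 \<i> (h (\<tau> + real k))) (h (\<tau> + real l))) has_integral Q k l) {0..1}" for k l
    unfolding Q_def
    by (intro integrable_integral integrable_continuous_real continuous_intros hc
        bounded_linear.continuous_on[OF scaleC_l2.bounded_linear_right])
  have "continuous_on UNIV \<Phi>" unfolding \<Phi>_def by (intro continuous_intros)
  moreover have "(norm (integral {0..real K} (\<lambda>t. scaleC_l2 (cis (E * t)) (h t))))\<^sup>2 \<le> \<Phi> E" for E
  proof -
    define G where "G t = scaleC_l2 (cis (E * t)) (h t)" for t
    have G: "continuous_on S G" for S
      unfolding G_def
      by (intro bounded_bilinear.continuous_on[OF bounded_bilinear_scaleC_l2] continuous_on_subset[OF h]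
          continuous_on_cis continuous_intros) auto
    have Gc: "continuous_on S (\<lambda>\<tau>. G (\<tau> + real k))" for S k
      by (rule continuous_on_compose2[OF G[of UNIV]]) (auto intro!: continuous_intros)
    have "integral {0..real K} G = integral {0..1} (\<lambda>\<tau>. \<Sum>k<K. G (\<tau> + real k))"
      unfolding integral_split_unit_intervals[OF G]
      by (rule integral_sum[symmetric]) (auto intro: integrable_continuous_real Gc)
    then have "(norm (integral {0..real K} G))\<^sup>2 \<le> integral {0..1} (\<lambda>\<tau>. (norm (\<Sum>k<K. G (\<tau> + real k)))\<^sup>2)"
      using norm_integral_square_le[OF continuous_on_sum[of "{..<K}", OF Gc]] by simp
    also have "(\<lambda>\<tau>. (norm (\<Sum>k<K. G (\<tau> + real k)))\<^sup>2) = (\<lambda>\<tau>. \<Sum>k<K. \<Sum>l<K.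
        cos (E * of_int (int k - int l)) * inner (h (\<tau> + real k)) (h (\<tau> + real l)) +
        sin (E * of_int (int k - int l)) * inner (scaleC_l2 \<i> (h (\<tau> + real k))) (h (\<tau> + real l)))"
    proof
      fix \<tau>
      have "inner (G (\<tau> + real k)) (G (\<tau> + real l)) =
        cos (E * of_int (int k - int l)) * inner (h (\<tau> + real k)) (h (\<tau> + real l)) +
        sin (E * of_int (int k - int l)) * inner (scaleC_l2 \<i> (h (\<tau> + real k))) (h (\<tau> + real l))" for k l
      proof -
        \<comment> \<open>The common phase E \<tau> cancels and the integer frequency k - l remains;
          this is why time intervals of length 1 go with an energy window of length 2 pi.\<close>
        have "cis (E * (\<tau> + real k)) * cnj (cis (E * (\<tau> + real l))) = cis (E * of_int (int k - int l))"
          by (simp add: cis_cnj cis_mult algebra_simps)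
        then have "inner (G (\<tau> + real k)) (G (\<tau> + real l)) =
            inner (scaleC_l2 (cis (E * of_int (int k - int l))) (h (\<tau> + real k))) (h (\<tau> + real l))"
          unfolding G_def inner_scaleC_l2_scaleC by (simp only:)
        also have "\<dots> = inner (cos (E * of_int (int k - int l)) *\<^sub>R h (\<tau> + real k) +
            sin (E * of_int (int k - int l)) *\<^sub>R scaleC_l2 \<i> (h (\<tau> + real k))) (h (\<tau> + real l))"
          by (subst scaleC_l2_Re_Im) simp
        finally show ?thesis by (simp add: inner_add_left)
      qed
      then show "(norm (\<Sum>k<K. G (\<tau> + real k)))\<^sup>2 = (\<Sum>k<K. \<Sum>l<K.
        cos (E * of_int (int k - int l)) * inner (h (\<tau> + real k)) (h (\<tau> + real l)) +
        sin (E * of_int (int k - int l)) * inner (scaleC_l2 \<i> (h (\<tau> + real k))) (h (\<tau> + real l)))"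
        by (simp only: power2_norm_eq_inner inner_sum_left inner_sum_right) (rule sum.swap)
    qed
    also have "integral {0..1} \<dots> = \<Phi> E"
      unfolding \<Phi>_def
      by (intro integral_unique has_integral_sum finite_lessThan has_integral_add has_integral_mult_right Pi Qi)
    finally show ?thesis by (simp add: G_def)
  qed
  moreover have "(\<Phi> has_integral 2 * pi * integral {0..real K} (\<lambda>t. (norm (h t))\<^sup>2)) {e - pi..e + pi}"
  proof -
    have "(\<Phi> has_integral (\<Sum>k<K. \<Sum>l<K. (if int k - int l = 0 then 2 * pi else 0) * P k l + 0 * Q k l)) {e - pi..e + pi}"
      unfolding \<Phi>_def
      by (intro has_integral_sum finite_lessThan has_integral_add has_integral_mult_left
          has_integral_cos_period has_integral_sin_period)
    moreover have "(\<Sum>l<K. (if int k - int l = 0 then 2 * pi else 0) * P k l + 0 * Q k l) = 2 * pi * P k k" if "k < K" for k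
    proof -
      have "(\<Sum>l<K. (if int k - int l = 0 then 2 * pi else 0) * P k l + 0 * Q k l) = (\<Sum>l<K. if l = k then 2 * pi * P k l else 0)"
        by (intro sum.cong) auto
      then show ?thesis using that by (simp add: sum.delta)
    qed
    moreover have "(\<Sum>k<K. P k k) = integral {0..real K} (\<lambda>t. (norm (h t))\<^sup>2)"
    proof -
      have "continuous_on UNIV (\<lambda>t. (norm (h t))\<^sup>2)" by (intro continuous_intros h)
      from integral_split_unit_intervals[OF this, of K] show ?thesis
        by (simp add: P_def power2_norm_eq_inner)
    qed
    ultimately show ?thesis by (simp flip: sum_distrib_left)
  qed
  ultimately show thesis by (rule that)
qed

text \<open>The resolvent function is a Laplace transform of the evolution, so a lower bound on its
  mass in \<open>S\<close> for each E in \<open>B\<close> bounds a Fourier integral of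
  \<open>h\<close> from below. The Bessel inequality, integrated over \<open>B\<close>, turns this
  into a bound on the time integral of the mass.\<close>

lemma resolvent_transport:
  assumes V: "uniformly_locally_integrable V" and f: "f \<in> L2" and T: "T > 0"
    and S: "S \<in> sets lebesgue" and m: "m > 0"
    and B: "B \<in> sets lebesgue" "B \<subseteq> {e - pi..e + pi}"
    and res: "\<And>E. E \<in> B \<Longrightarrow> \<exists>u\<in>L2. schroedinger_eq V u (\<lambda>x. Complex E (1 / T) * u x + f x) \<and>
      m \<le> norm (restrict_l2 S (abs_l2 u))"
  shows "ennreal (m\<^sup>2 / (8 * pi)) * emeasure lebesgue B \<le>
    (\<integral>\<^sup>+ t\<in>{0..}. ennreal (exp (- 2 * t / T) * (norm (restrict_l2 S (evolution_l2 V t (abs_l2 f))))\<^sup>2) \<partial>lebesgue)"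
proof -
  define F where "F = abs_l2 f"
  define h where "h t = exp (- t / T) *\<^sub>R restrict_l2 S (evolution_l2 V t F)" for t
  interpret skew_adjoint "generator_graph V" by (rule skew_adjoint_generator[OF V])
  interpret R: bounded_linear "restrict_l2 S" by (rule bounded_linear_restrict_l2)
  note cev = evolution_l2_continuous[OF V]
  have hc: "continuous_on A h" for A
    unfolding h_def by (intro continuous_intros R.continuous_on cev) (use T in auto)
  \<comment> \<open>Truncation time: the remainder at \<open>K\<close> is at most exp(-K/T) times
    the norm of the resolvent function, which is at most \<open>T * norm F\<close>. Half of
    \<open>m\<close> pays for it. \<open>K\<close> is a natural number since
    \<open>bessel_window\<close> needs whole unit intervals.\<close>
  obtain K :: nat where K: "exp (- real K / T) * (T * norm F) \<le> m / 2"
  proof -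
    have "(\<lambda>K. exp (- real K / T) * (T * norm F)) \<longlonglongrightarrow> 0"
    proof (rule tendsto_mult_left_zero)
      have "(\<lambda>K. (exp (- 1 / T)) ^ K) \<longlonglongrightarrow> 0"
        using T by (intro LIMSEQ_realpow_zero) auto
      then show "(\<lambda>K. exp (- real K / T)) \<longlonglongrightarrow> 0"
        by (simp flip: exp_of_nat_mult)
    qed
    then have "\<forall>\<^sub>F K in sequentially. exp (- real K / T) * (T * norm F) < m / 2"
      by (rule order_tendstoD(2)) (use m in simp)
    then show thesis using that by (auto simp: eventually_sequentially intro: less_imp_le)
  qed
  have low: "m / 2 \<le> norm (integral {0..real K} (\<lambda>t. scaleC_l2 (cis (E * t)) (h t)))" if E: "E \<in> B" for E
  proof -
    define z where "z = Complex E (1 / T)"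
    obtain u where u: "u \<in> L2" "schroedinger_eq V u (\<lambda>x. z * u x + f x)" "m \<le> norm (restrict_l2 S (abs_l2 u))"
      using res[OF E] by (auto simp: z_def)
    define x where "x = abs_l2 u"
    define y where "y = scaleC_l2 (- \<i>) (scaleC_l2 z x + F)"
    have y: "y = abs_l2 (\<lambda>t. - \<i> * (z * u t + f t))"
      by (simp only: y_def x_def F_def abs_l2_scaleC abs_l2_add u f L2_cmult L2_add)
    have "(\<lambda>t. \<i> * (- \<i> * (z * u t + f t))) = (\<lambda>t. z * u t + f t)"
      by (auto simp: algebra_simps)
    then have "schroedinger_op V u (\<lambda>t. \<i> * (- \<i> * (z * u t + f t)))"
      unfolding schroedinger_op_def using u(1,2) by (auto intro: L2_add L2_cmult f)
    then have xy: "generator_graph V x y"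
      unfolding x_def y by (subst generator_graph_abs) (auto intro!: u f L2_cmult L2_add L2_uminus)
    \<comment> \<open>The bound by 1 / Im z, from skewness: -i z has real part 1/T, and its
      imaginary part drops out because i x is orthogonal to x.\<close>
    have nx: "norm x \<le> T * norm F"
    proof -
      have "0 = inner y x" using skew[OF xy] by simp
      also have "\<dots> = inner (scaleC_l2 (- \<i> * z) x) x + inner (scaleC_l2 (- \<i>) F) x"
        by (simp add: y_def scaleC_l2_add_right inner_add_left)
      also have "inner (scaleC_l2 (- \<i> * z) x) x = (1 / T) * inner x x + (- E) * inner (scaleC_l2 \<i> x) x"
        by (subst scaleC_l2_Re_Im) (simp add: z_def inner_add_left inner_diff_left)
      also have "inner (scaleC_l2 \<i> x) x = 0"
      proof -
        have "inner (scaleC_l2 \<i> x) x = inner (scaleC_l2 1 x) (scaleC_l2 (- \<i>) x)"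
          unfolding inner_scaleC_l2_scaleC by simp
        also have "\<dots> = - inner (scaleC_l2 \<i> x) x"
          using scaleC_l2.minus_left[of \<i> x] by (simp add: inner_commute)
        finally show ?thesis by simp
      qed
      finally have "inner x x / T = - inner (scaleC_l2 (- \<i>) F) x" by simp
      then have "inner x x = - T * inner (scaleC_l2 (- \<i>) F) x" using T by (simp add: field_simps)
      then have "norm x * norm x = - T * inner (scaleC_l2 (- \<i>) F) x"
        by (metis power2_eq_square power2_norm_eq_inner)
      also have "\<dots> \<le> T * (norm F * norm x)"
      proof -
        have "- inner (scaleC_l2 (- \<i>) F) x \<le> norm F * norm x"
          using norm_cauchy_schwarz[of "- scaleC_l2 (- \<i>) F" x] by simp
        from mult_left_mono[OF this, of T] show ?thesis using T by simp
      qed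
      finally show ?thesis by (cases "norm x = 0") (use T in \<open>auto simp: mult.assoc[symmetric] mult_le_cancel_right\<close>)
    qed
    \<comment> \<open>As \<open>y\<close> is -i (z x + F), the terms with \<open>z\<close> cancel in
      the derivative of exp(i z t) times the evolution of \<open>x\<close>, and only
      \<open>F\<close> is left: the resolvent integral up to time \<open>K\<close>.\<close>
    have fund: "((\<lambda>t. scaleC_l2 (- \<i> * exp (\<i> * z * of_real t)) (evolution_l2 V t F)) has_integral
        scaleC_l2 (exp (\<i> * z * of_real (real K))) (evolution_l2 V (real K) x) - x) {0..real K}"
    proof -
      have "((\<lambda>t. scaleC_l2 (exp (\<i> * z * of_real t)) (evolution_l2 V t x)) has_vector_derivative
          scaleC_l2 (- \<i> * exp (\<i> * z * of_real t)) (evolution_l2 V t F)) (at t within {0..real K})" for t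
      proof -
        have e: "((\<lambda>t. exp (\<i> * z * of_real t)) has_vector_derivative \<i> * z * exp (\<i> * z * of_real t)) (at t)"
          by (rule has_vector_derivative_real_field) (auto intro!: derivative_eq_intros)
        have ey: "evolution_l2 V t y = scaleC_l2 (- \<i> * z) (evolution_l2 V t x) + scaleC_l2 (- \<i>) (evolution_l2 V t F)"
          unfolding y_def scaleC_l2_add_right scaleC_l2_scaleC by (rule evolution_l2_combine[OF V])
        have "((\<lambda>t. scaleC_l2 (exp (\<i> * z * of_real t)) (evolution_l2 V t x)) has_vector_derivative
            scaleC_l2 (exp (\<i> * z * of_real t)) (evolution_l2 V t y) +
            scaleC_l2 (\<i> * z * exp (\<i> * z * of_real t)) (evolution_l2 V t x)) (at t)"
          by (rule bounded_bilinear.has_vector_derivative[OF bounded_bilinear_scaleC_l2 e evolution_l2_derivative[OF V xy]])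
        also have "scaleC_l2 (exp (\<i> * z * of_real t)) (evolution_l2 V t y) +
            scaleC_l2 (\<i> * z * exp (\<i> * z * of_real t)) (evolution_l2 V t x) =
            scaleC_l2 (- \<i> * exp (\<i> * z * of_real t)) (evolution_l2 V t F)"
        proof -
          have "scaleC_l2 (exp (\<i> * z * of_real t) * (- \<i> * z)) w + scaleC_l2 (\<i> * z * exp (\<i> * z * of_real t)) w = 0" for w
            unfolding scaleC_l2_add_left[symmetric] by (simp add: algebra_simps scaleC_l2.zero_left)
          then show ?thesis
            unfolding ey scaleC_l2_add_right scaleC_l2_scaleC by (simp add: algebra_simps)
        qed
        finally show ?thesis by (rule has_vector_derivative_at_within)
      qed
      from fundamental_theorem_of_calculus[OF _ this] show ?thesis
        by (simp add: evolution_l2_0[OF V])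
    qed
    have ez: "exp (\<i> * z * of_real t) = complex_of_real (exp (- t / T)) * cis (E * t)" for t
    proof -
      have "\<i> * z * of_real t = complex_of_real (- t / T) + \<i> * complex_of_real (E * t)"
        by (simp add: z_def complex_eq_iff)
      then show ?thesis by (simp only: exp_add cis_conv_exp exp_of_real)
    qed
    have "((\<lambda>t. restrict_l2 S (scaleC_l2 (- \<i> * exp (\<i> * z * of_real t)) (evolution_l2 V t F))) has_integral
        restrict_l2 S (scaleC_l2 (exp (\<i> * z * of_real (real K))) (evolution_l2 V (real K) x) - x)) {0..real K}"
      using has_integral_linear[OF fund bounded_linear_restrict_l2] by (simp add: o_def)
    moreover have "restrict_l2 S (scaleC_l2 (- \<i> * exp (\<i> * z * of_real t)) (evolution_l2 V t F)) =
        scaleC_l2 (- \<i>) (scaleC_l2 (cis (E * t)) (h t))" for t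
      unfolding ez by (simp add: h_def restrict_l2_scaleC mult_ac flip: scaleC_l2_of_real)
    ultimately have "((\<lambda>t. scaleC_l2 (- \<i>) (scaleC_l2 (cis (E * t)) (h t))) has_integral
        restrict_l2 S (scaleC_l2 (exp (\<i> * z * of_real (real K))) (evolution_l2 V (real K) x) - x)) {0..real K}"
      by (simp only:)
    moreover have "((\<lambda>t. scaleC_l2 (- \<i>) (scaleC_l2 (cis (E * t)) (h t))) has_integral
        scaleC_l2 (- \<i>) (integral {0..real K} (\<lambda>t. scaleC_l2 (cis (E * t)) (h t)))) {0..real K}"
    proof -
      have "((\<lambda>t. scaleC_l2 (cis (E * t)) (h t)) has_integral integral {0..real K} (\<lambda>t. scaleC_l2 (cis (E * t)) (h t))) {0..real K}"
        by (intro integrable_integral integrable_continuous_real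
            bounded_bilinear.continuous_on[OF bounded_bilinear_scaleC_l2] hc continuous_on_cis continuous_intros)
      from has_integral_linear[OF this scaleC_l2.bounded_linear_right[of "- \<i>"]] show ?thesis by (simp add: o_def)
    qed
    ultimately have eq: "scaleC_l2 (- \<i>) (integral {0..real K} (\<lambda>t. scaleC_l2 (cis (E * t)) (h t))) =
        restrict_l2 S (scaleC_l2 (exp (\<i> * z * of_real (real K))) (evolution_l2 V (real K) x)) - restrict_l2 S x"
      by (metis has_integral_unique R.diff)
    have nez: "norm (exp (\<i> * z * of_real t)) = exp (- t / T)" for t
      unfolding ez by (simp add: norm_mult)
    have "norm (restrict_l2 S (scaleC_l2 (exp (\<i> * z * of_real (real K))) (evolution_l2 V (real K) x))) \<le>
        norm (scaleC_l2 (exp (\<i> * z * of_real (real K))) (evolution_l2 V (real K) x))"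
      by (rule norm_restrict_l2_le)
    also have "\<dots> = exp (- real K / T) * norm x"
      unfolding norm_scaleC_l2 norm_evolution_l2[OF V] nez ..
    also have "\<dots> \<le> m / 2"
      using K nx by (smt (verit, best) exp_ge_zero mult_left_mono)
    finally have small: "norm (restrict_l2 S (scaleC_l2 (exp (\<i> * z * of_real (real K))) (evolution_l2 V (real K) x))) \<le> m / 2" .
    have "norm (integral {0..real K} (\<lambda>t. scaleC_l2 (cis (E * t)) (h t))) =
        norm (restrict_l2 S (scaleC_l2 (exp (\<i> * z * of_real (real K))) (evolution_l2 V (real K) x)) - restrict_l2 S x)"
      unfolding eq[symmetric] by simp
    also have "\<dots> \<ge> norm (restrict_l2 S x) -
        norm (restrict_l2 S (scaleC_l2 (exp (\<i> * z * of_real (real K))) (evolution_l2 V (real K) x)))"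
      by (metis norm_minus_commute norm_triangle_ineq2)
    finally show ?thesis using small u(3) by (simp add: x_def)
  qed
  obtain \<Phi> where \<Phi>: "continuous_on UNIV \<Phi>"
    "\<And>E. (norm (integral {0..real K} (\<lambda>t. scaleC_l2 (cis (E * t)) (h t))))\<^sup>2 \<le> \<Phi> E"
    "(\<Phi> has_integral 2 * pi * integral {0..real K} (\<lambda>t. (norm (h t))\<^sup>2)) {e - pi..e + pi}"
    using bessel_window[OF hc] by blast
  have h2c: "continuous_on A (\<lambda>t. (norm (h t))\<^sup>2)" for A by (intro continuous_intros hc)
  have nnint: "(\<integral>\<^sup>+ t. ennreal (indicator {a..b} t * g t) \<partial>lebesgue) = ennreal (integral {a..b} g)"
    if g: "continuous_on UNIV g" "\<And>t. g t \<ge> 0" for g :: "real \<Rightarrow> real" and a b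
  proof -
    have ai: "g absolutely_integrable_on {a..b}"
      using locally_integrable_absolutely[OF locally_integrable_continuous[OF g(1)]] .
    have "(\<integral>\<^sup>+ t. ennreal (indicator {a..b} t * g t) \<partial>lebesgue) = ennreal (LINT t|lebesgue. indicator {a..b} t * g t)"
      using ai g(2) by (intro nn_integral_eq_integral) (auto simp: set_integrable_def)
    also have "(LINT t|lebesgue. indicator {a..b} t * g t) = integral {a..b} g"
      using set_lebesgue_integral_eq_integral(2)[OF ai] by (simp add: set_lebesgue_integral_def)
    finally show ?thesis .
  qed
  \<comment> \<open>Comparison with the continuous majorant \<Phi>, so that no measurability in E of
    the resolvent functions enters. The final constant is (m/2)^2 / (2 pi) = m^2 / (8 pi).\<close>
  have "ennreal ((m/2)\<^sup>2) * emeasure lebesgue B = (\<integral>\<^sup>+ E. ennreal ((m/2)\<^sup>2) * indicator B E \<partial>lebesgue)"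
    using B(1) by (simp add: nn_integral_cmult_indicator)
  also have "\<dots> \<le> (\<integral>\<^sup>+ E. ennreal (indicator {e - pi..e + pi} E * \<Phi> E) \<partial>lebesgue)"
  proof (rule nn_integral_mono)
    fix E
    show "ennreal ((m/2)\<^sup>2) * indicator B E \<le> ennreal (indicator {e - pi..e + pi} E * \<Phi> E)"
    proof (cases "E \<in> B")
      case True
      have "(m/2)\<^sup>2 \<le> \<Phi> E"
        using power_mono[OF low[OF True], of 2] \<Phi>(2)[of E] m by linarith
      then show ?thesis using True B(2) by (auto simp: indicator_def intro!: ennreal_leI)
    qed simp
  qed
  also have "\<dots> = ennreal (2 * pi * integral {0..real K} (\<lambda>t. (norm (h t))\<^sup>2))"
    using nnint[OF \<Phi>(1)] order_trans[OF zero_le_power2 \<Phi>(2)] integral_unique[OF \<Phi>(3)] by simp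
  also have "\<dots> = ennreal (2 * pi) * (\<integral>\<^sup>+ t. ennreal (indicator {0..real K} t * (norm (h t))\<^sup>2) \<partial>lebesgue)"
    using nnint[OF h2c[of UNIV]] by (simp add: ennreal_mult' integral_nonneg integrable_continuous_real h2c)
  also have "\<dots> \<le> ennreal (2 * pi) *
    (\<integral>\<^sup>+ t\<in>{0..}. ennreal (exp (- 2 * t / T) * (norm (restrict_l2 S (evolution_l2 V t F)))\<^sup>2) \<partial>lebesgue)"
  proof (intro mult_left_mono nn_integral_mono)
    fix t :: real
    have "(norm (h t))\<^sup>2 = exp (- 2 * t / T) * (norm (restrict_l2 S (evolution_l2 V t F)))\<^sup>2"
      by (simp add: h_def power_mult_distrib flip: exp_double)
    then show "ennreal (indicator {0..real K} t * (norm (h t))\<^sup>2) \<le>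
        ennreal (exp (- 2 * t / T) * (norm (restrict_l2 S (evolution_l2 V t F)))\<^sup>2) * indicator {0..} t"
      by (auto simp: indicator_def)
  qed simp
  finally have "ennreal ((m/2)\<^sup>2) * emeasure lebesgue B \<le> ennreal (2 * pi) *
    (\<integral>\<^sup>+ t\<in>{0..}. ennreal (exp (- 2 * t / T) * (norm (restrict_l2 S (evolution_l2 V t F)))\<^sup>2) \<partial>lebesgue)" .
  from mult_left_mono[OF this, of "ennreal (1 / (2 * pi))"]
  have "ennreal (1 / (2 * pi)) * (ennreal ((m/2)\<^sup>2) * emeasure lebesgue B) \<le>
    ennreal (1 / (2 * pi)) * (ennreal (2 * pi) *
    (\<integral>\<^sup>+ t\<in>{0..}. ennreal (exp (- 2 * t / T) * (norm (restrict_l2 S (evolution_l2 V t F)))\<^sup>2) \<partial>lebesgue))"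
    by simp
  moreover have "ennreal (1 / (2 * pi)) * (ennreal (2 * pi) * X) = X" for X
    by (simp flip: mult.assoc ennreal_mult)
  moreover have "ennreal (1 / (2 * pi)) * (ennreal ((m/2)\<^sup>2) * X) = ennreal (m\<^sup>2 / (8 * pi)) * X" for X
    by (simp add: power_divide flip: mult.assoc ennreal_mult)
  ultimately show ?thesis by (simp only: F_def)
qed


subsection \<open>Transfer matrices\<close>

text \<open>Fundamental matrix at \<open>x\<close> times the inverse of the one at \<open>y\<close>,
  whose determinant is the Wronskian 1. Uniqueness for \<open>THE\<close> comes from testing a
  candidate on the linearly independent data of \<open>c\<close> and \<open>s\<close>.\<close>

lemma transfer_matrix_eq:
  assumes fs: "fundamental_system V z c c' s s'"
  shows "transfer_matrix V x y z =
    vector [vector [c x * s' y - s x * c' y, s x * c y - c x * s y],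
            vector [c' x * s' y - s' x * c' y, s' x * c y - c' x * s y]]" (is "_ = ?M")
  unfolding transfer_matrix_def
proof (rule the_equality)
  note W = fundamental_system_wronskian[OF fs]
  have pc: "schroedinger_pair V (\<lambda>x. z * c x) c c'" and ps: "schroedinger_pair V (\<lambda>x. z * s x) s s'"
    using fs by (auto simp: fundamental_system_def)
  show "\<forall>u. solution V z u \<longrightarrow> ?M *v cauchy_data u y = cauchy_data u x"
  proof (intro allI impI)
    fix u assume "solution V z u"
    then have pu: "schroedinger_pair V (\<lambda>x. z * u x) u (\<lambda>x. vector_derivative u (at x))" (is "schroedinger_pair _ _ _ ?u'")
      unfolding solution_def by (rule schroedinger_eq_pair)
    have \<alpha>: "u x * s' x - ?u' x * s x = u y * s' y - ?u' y * s y"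
      and \<beta>: "c x * ?u' x - c' x * u x = c y * ?u' y - c' y * u y"
      by (rule wronskian_constant[OF pu ps] wronskian_constant[OF pc pu])+
    have "(c x * s' y - s x * c' y) * u y + (s x * c y - c x * s y) * ?u' y =
        c x * (u y * s' y - ?u' y * s y) + s x * (c y * ?u' y - c' y * u y)"
      by (simp add: algebra_simps)
    also have "\<dots> = u x * (c x * s' x - c' x * s x)"
      unfolding \<alpha>[symmetric] \<beta>[symmetric] by (simp add: algebra_simps)
    finally have 1: "(c x * s' y - s x * c' y) * u y + (s x * c y - c x * s y) * ?u' y = u x" by (simp add: W)
    have "(c' x * s' y - s' x * c' y) * u y + (s' x * c y - c' x * s y) * ?u' y =
        c' x * (u y * s' y - ?u' y * s y) + s' x * (c y * ?u' y - c' y * u y)"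
      by (simp add: algebra_simps)
    also have "\<dots> = ?u' x * (c x * s' x - c' x * s x)"
      unfolding \<alpha>[symmetric] \<beta>[symmetric] by (simp add: algebra_simps)
    finally have 2: "(c' x * s' y - s' x * c' y) * u y + (s' x * c y - c' x * s y) * ?u' y = ?u' x" by (simp add: W)
    show "?M *v cauchy_data u y = cauchy_data u x"
      using 1 2 by (simp add: vec_eq_iff forall_2 matrix_vector_mult_def sum_2 cauchy_data_def)
  qed
  fix N :: "complex ^ 2 ^ 2"
  assume N: "\<forall>u. solution V z u \<longrightarrow> N *v cauchy_data u y = cauchy_data u x"
  have Nc: "N *v cauchy_data c y = cauchy_data c x" "N *v cauchy_data s y = cauchy_data s x"
    using N schroedinger_pair_eq[OF pc] schroedinger_pair_eq[OF ps] by (auto simp: solution_def)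
  \<comment> \<open>Cramer's rule for one row of the candidate, again with determinant 1.\<close>
  have solve: "m1 = p * s' y - q * c' y \<and> m2 = q * c y - p * s y"
    if "m1 * c y + m2 * c' y = p" "m1 * s y + m2 * s' y = q" for m1 m2 p q
  proof -
    have "p * s' y - q * c' y = m1 * (c y * s' y - c' y * s y)" "q * c y - p * s y = m2 * (c y * s' y - c' y * s y)"
      unfolding that[symmetric] by (simp_all add: algebra_simps)
    then show ?thesis by (simp add: W)
  qed
  show "N = ?M"
    using Nc solve[of "N $ 1 $ 1" "N $ 1 $ 2" "c x" "s x"] solve[of "N $ 2 $ 1" "N $ 2 $ 2" "c' x" "s' x"]
    by (simp add: vec_eq_iff forall_2 matrix_vector_mult_def sum_2 cauchy_data_def
        schroedinger_pair_derivative[OF pc] schroedinger_pair_derivative[OF ps])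
qed

lemma norm_entry_le_onorm:
  fixes M :: "complex ^ 2 ^ 2"
  shows "norm (M $ i $ j) \<le> onorm ((*v) M)"
proof -
  have "linear ((*v) M)"
  proof (rule linearI)
    show "M *v (x + y) = M *v x + M *v y" for x y by (rule matrix_vector_right_distrib)
    show "M *v (r *\<^sub>R x) = r *\<^sub>R (M *v x)" for r x
      by (simp add: vec_eq_iff matrix_vector_mult_def scaleR_sum_right)
  qed
  then have bl: "bounded_linear ((*v) M)" by (simp add: linear_conv_bounded_linear)
  have "norm (M $ i $ j) = norm ((M *v axis j 1) $ i)"
    by (simp add: matrix_vector_mult_def axis_def if_distrib cong: if_cong)
  also have "\<dots> \<le> norm (M *v axis j 1)" by (rule Finite_Cartesian_Product.norm_nth_le)
  also have "\<dots> \<le> onorm ((*v) M) * norm (axis j (1 :: complex) :: complex ^ 2)" by (rule onorm[OF bl])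
  finally show ?thesis by (simp add: norm_vec_def L2_set_def axis_def if_distrib if_distribR cong: if_cong)
qed

text \<open>The conditions are bounds on the entries of the transfer matrices between points of the interval.\<close>

definition bounded_transfer ::
  "(real \<Rightarrow> complex) \<Rightarrow> (real \<Rightarrow> complex) \<Rightarrow> (real \<Rightarrow> complex) \<Rightarrow> (real \<Rightarrow> complex) \<Rightarrow> real \<Rightarrow> real set \<Rightarrow> bool" where
  "bounded_transfer c c' s s' B J \<longleftrightarrow> (\<forall>x\<in>J. \<forall>y\<in>J.
     norm (c x * s' y - s x * c' y) \<le> B \<and> norm (s x * c y - c x * s y) \<le> B \<and>
     norm (c' x * s' y - s' x * c' y) \<le> B \<and> norm (s' x * c y - c' x * s y) \<le> B)"

lemma P_set_bounded_transfer:
  assumes E: "E \<in> P_set V \<alpha> C N" and fs: "fundamental_system V (complex_of_real E) c c' s s'"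
  shows "bounded_transfer c c' s s' (C * N powr \<alpha>) {-N..N}"
  unfolding bounded_transfer_def
proof (intro ballI)
  fix x y assume xy: "x \<in> {-N..N}" "y \<in> {-N..N}"
  have "norm (transfer_matrix V x y (complex_of_real E) $ i $ j) \<le> C * N powr \<alpha>" for i j
    by (rule order.trans[OF norm_entry_le_onorm]) (use E xy in \<open>auto simp: P_set_def\<close>)
  from this[of 1 1] this[of 1 2] this[of 2 1] this[of 2 2]
  show "norm (c x * s' y - s x * c' y) \<le> C * N powr \<alpha> \<and> norm (s x * c y - c x * s y) \<le> C * N powr \<alpha> \<and>
     norm (c' x * s' y - s' x * c' y) \<le> C * N powr \<alpha> \<and> norm (s' x * c y - c' x * s y) \<le> C * N powr \<alpha>"
    unfolding transfer_matrix_eq[OF fs] by simp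
qed

lemma bounded_transfer_subset: "bounded_transfer c c' s s' B J \<Longrightarrow> J' \<subseteq> J \<Longrightarrow> bounded_transfer c c' s s' B J'"
  unfolding bounded_transfer_def by blast

lemma bounded_transfer_compact:
  assumes fs: "fundamental_system V z c c' s s'"
  shows "\<exists>B\<ge>0. bounded_transfer c c' s s' B {a..b}"
proof -
  have "\<exists>B. \<forall>x\<in>{a..b}. norm (h x) \<le> B" if "continuous_on {a..b} h" for h :: "real \<Rightarrow> complex"
    using compact_imp_bounded[OF compact_continuous_image[OF that]] unfolding bounded_iff by auto
  note bd = this
  have pc: "schroedinger_pair V (\<lambda>x. z * c x) c c'" and ps: "schroedinger_pair V (\<lambda>x. z * s x) s s'"
    using fs by (auto simp: fundamental_system_def)
  obtain b1 where b1: "\<forall>x\<in>{a..b}. norm (c x) \<le> b1" using bd schroedinger_pair_continuous[OF pc] by blast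
  obtain b2 where b2: "\<forall>x\<in>{a..b}. norm (c' x) \<le> b2" using bd schroedinger_pair_continuous[OF pc] by blast
  obtain b3 where b3: "\<forall>x\<in>{a..b}. norm (s x) \<le> b3" using bd schroedinger_pair_continuous[OF ps] by blast
  obtain b4 where b4: "\<forall>x\<in>{a..b}. norm (s' x) \<le> b4" using bd schroedinger_pair_continuous[OF ps] by blast
  define m where "m = \<bar>b1\<bar> + \<bar>b2\<bar> + \<bar>b3\<bar> + \<bar>b4\<bar>"
  have m: "norm (c x) \<le> m" "norm (c' x) \<le> m" "norm (s x) \<le> m" "norm (s' x) \<le> m" if "x \<in> {a..b}" for x
    using b1 b2 b3 b4 that by (fastforce simp: m_def)+
  have prod: "norm (p * q - p' * q') \<le> 2 * m * m" if "norm p \<le> m" "norm q \<le> m" "norm p' \<le> m" "norm q' \<le> m" for p q p' q' :: complex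
  proof -
    have "norm (p * q - p' * q') \<le> norm p * norm q + norm p' * norm q'"
      by (rule order.trans[OF norm_triangle_ineq4]) (simp add: norm_mult)
    also have "\<dots> \<le> m * m + m * m"
      using that by (intro add_mono mult_mono) (auto intro: order.trans[OF norm_ge_zero])
    finally show ?thesis by simp
  qed
  show ?thesis
    by (intro exI[of _ "2 * m * m"] conjI) (auto simp: bounded_transfer_def m_def[symmetric] intro!: prod m)
qed

section \<open>Solutions at nearby energies\<close>

lemma has_ac_derivative_bound:
  assumes F: "has_ac_derivative F f" and w: "locally_integrable w"
    and le: "\<And>r. r \<in> {a..b} \<Longrightarrow> norm (f r) \<le> B * norm (w r)" and xt: "x \<in> {a..b}" "t \<in> {a..b}" and B: "B \<ge> 0"
  shows "norm (F t - F x) \<le> B * integral {a..b} (\<lambda>r. norm (w r))"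
proof -
  note lw = locally_integrable_norm[OF w]
  have main: "norm (F q - F p) \<le> B * integral {a..b} (\<lambda>r. norm (w r))" if pq: "p \<le> q" "p \<in> {a..b}" "q \<in> {a..b}" for p q
  proof -
    have "norm (integral {p..q} f) \<le> integral {p..q} (\<lambda>r. B * norm (w r))"
    proof (rule integral_norm_bound_integral)
      show "f integrable_on {p..q}"
        by (intro locally_integrable_integrable has_ac_derivative_locally_integrable[OF F])
      show "(\<lambda>r. B * norm (w r)) integrable_on {p..q}"
        by (intro integrable_on_mult_right locally_integrable_integrable lw)
    qed (use pq le in auto)
    also have "\<dots> = B * integral {p..q} (\<lambda>r. norm (w r))" by simp
    also have "\<dots> \<le> B * integral {a..b} (\<lambda>r. norm (w r))"
      using pq by (intro mult_left_mono integral_nonneg_mono_interval lw B) auto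
    finally show ?thesis by (simp add: has_ac_derivative_integral[OF F pq(1)])
  qed
  show ?thesis
    using main[of x t] main[of t x] xt by (cases "x \<le> t") (auto simp: norm_minus_commute)
qed

text \<open>Variation of constants relative to the energy \<open>z\<close> of the fundamental system.\<close>

lemma duhamel_bound:
  assumes V: "locally_integrable V" and fs: "fundamental_system V z c c' s s'"
    and u: "schroedinger_pair V \<psi> u u'" and bt: "bounded_transfer c c' s s' B {a..b}" and B: "B \<ge> 0"
    and xt: "x \<in> {a..b}" "t \<in> {a..b}"
  shows "norm (u t) \<le> B * (norm (u x) + norm (u' x)) + B * integral {a..b} (\<lambda>r. norm (\<psi> r - z * u r))" (is ?th1)
    and "norm (u' t) \<le> B * (norm (u x) + norm (u' x)) + B * integral {a..b} (\<lambda>r. norm (\<psi> r - z * u r))" (is ?th2)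
proof -
  note W = fundamental_system_wronskian[OF fs]
  have pc: "schroedinger_pair V (\<lambda>x. z * c x) c c'" and ps: "schroedinger_pair V (\<lambda>x. z * s x) s s'"
    using fs by (auto simp: fundamental_system_def)
  \<comment> \<open>The coordinates of \<open>u\<close> in the fundamental system, u = c \<alpha> -
    s \<beta>, written as Wronskians; their derivatives contain only the defect
    \<open>w\<close>.\<close>
  define \<alpha> where "\<alpha> r = u r * s' r - u' r * s r" for r
  define \<beta> where "\<beta> r = u r * c' r - u' r * c r" for r
  define w where "w r = \<psi> r - z * u r" for r
  have w: "locally_integrable w"
    unfolding w_def
    by (intro locally_integrable_diff schroedinger_pair_locally_integrable[OF u V] locally_integrable_continuous
        continuous_intros schroedinger_pair_continuous[OF u])
  have "has_ac_derivative \<alpha> (\<lambda>r. \<psi> r * s r - u r * (z * s r))" "has_ac_derivative \<beta> (\<lambda>r. \<psi> r * c r - u r * (z * c r))"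
    unfolding \<alpha>_def \<beta>_def by (rule wronskian_ac_derivative[OF u ps] wronskian_ac_derivative[OF u pc])+
  then have \<alpha>: "has_ac_derivative \<alpha> (\<lambda>r. w r * s r)" and \<beta>: "has_ac_derivative \<beta> (\<lambda>r. w r * c r)"
    by (simp_all add: w_def algebra_simps)
  \<comment> \<open>For fixed p and q the function p \<alpha> - q \<beta> is followed from
    \<open>x\<close> to \<open>t\<close>. With (p, q) = (c t, s t) or (c' t, s' t) it ends at
    \<open>u t\<close> or \<open>u' t\<close>, and both hypotheses bound entries of the transfer
    matrix from \<open>r\<close> to \<open>t\<close>.\<close>
  have *: "norm (p * \<alpha> t - q * \<beta> t) \<le> B * (norm (u x) + norm (u' x)) + B * integral {a..b} (\<lambda>r. norm (w r))"
    if b1: "\<And>r. r \<in> {a..b} \<Longrightarrow> norm (p * s' r - q * c' r) \<le> B"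
      and b2: "\<And>r. r \<in> {a..b} \<Longrightarrow> norm (q * c r - p * s r) \<le> B" for p q
  proof -
    have F: "has_ac_derivative (\<lambda>r. p * \<alpha> r - q * \<beta> r) (\<lambda>r. p * (w r * s r) - q * (w r * c r))"
      by (intro has_ac_derivative_diff has_ac_derivative_cmult \<alpha> \<beta>)
    have "norm ((p * \<alpha> t - q * \<beta> t) - (p * \<alpha> x - q * \<beta> x)) \<le> B * integral {a..b} (\<lambda>r. norm (w r))"
    proof (rule has_ac_derivative_bound[OF F w _ xt B])
      fix r assume r: "r \<in> {a..b}"
      have "p * (w r * s r) - q * (w r * c r) = - (q * c r - p * s r) * w r" by (simp add: algebra_simps)
      then show "norm (p * (w r * s r) - q * (w r * c r)) \<le> B * norm (w r)"
        using b2[OF r] by (simp add: norm_mult mult_right_mono norm_minus_commute)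
    qed
    moreover have "norm (p * \<alpha> x - q * \<beta> x) \<le> B * (norm (u x) + norm (u' x))"
    proof -
      have "p * \<alpha> x - q * \<beta> x = (p * s' x - q * c' x) * u x + (q * c x - p * s x) * u' x"
        by (simp add: \<alpha>_def \<beta>_def algebra_simps)
      also have "norm \<dots> \<le> norm (p * s' x - q * c' x) * norm (u x) + norm (q * c x - p * s x) * norm (u' x)"
        by (rule order.trans[OF norm_triangle_ineq]) (simp add: norm_mult)
      also have "\<dots> \<le> B * norm (u x) + B * norm (u' x)"
        using b1[OF xt(1)] b2[OF xt(1)] by (intro add_mono mult_right_mono) auto
      finally show ?thesis by (simp add: distrib_left)
    qed
    ultimately show ?thesis
      using norm_triangle_sub[of "p * \<alpha> t - q * \<beta> t" "p * \<alpha> x - q * \<beta> x"] by linarith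
  qed
  have "c t * \<alpha> t - s t * \<beta> t = u t * (c t * s' t - c' t * s t)" "c' t * \<alpha> t - s' t * \<beta> t = u' t * (c t * s' t - c' t * s t)"
    by (simp_all add: \<alpha>_def \<beta>_def algebra_simps)
  then have e: "c t * \<alpha> t - s t * \<beta> t = u t" "c' t * \<alpha> t - s' t * \<beta> t = u' t" by (simp_all add: W)
  show ?th1 ?th2
    using *[of "c t" "s t"] *[of "c' t" "s' t"] bt xt(2) unfolding e w_def
    by (auto simp: bounded_transfer_def)
qed

lemma continuous_norm_sup:
  assumes "continuous_on {a..b} (u :: real \<Rightarrow> complex)" "a \<le> b"
  obtains x0 where "x0 \<in> {a..b}" "\<And>y. y \<in> {a..b} \<Longrightarrow> norm (u y) \<le> norm (u x0)"
  using continuous_attains_sup[of "{a..b}" "\<lambda>x. norm (u x)", OF _ _ continuous_on_norm[OF assms(1)]] assms(2)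
  by auto

text \<open>The defect in Duhamel's formula is (z - z0) u; by \<open>small\<close> it contributes at
  most a quarter of the maximum of \<open>u\<close>, which is absorbed. The bound serves backwards:
  data at \<open>t\<close> cannot exceed 4 B times the data at \<open>x\<close>, so large data at
  \<open>t\<close> persist at \<open>x\<close>.\<close>

lemma propagation_bound:
  assumes V: "locally_integrable V" and fs: "fundamental_system V z0 c c' s s'"
    and u: "schroedinger_pair V \<psi> u u'" and bt: "bounded_transfer c c' s s' B {a..b}" and B: "B \<ge> 1"
    and hom: "\<And>r. r \<in> {a..b} \<Longrightarrow> \<psi> r = z * u r" and small: "4 * B * norm (z - z0) * (b - a) \<le> 1"
    and xt: "x \<in> {a..b}" "t \<in> {a..b}"
  shows "norm (u t) + norm (u' t) \<le> 4 * B * (norm (u x) + norm (u' x))"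
proof -
  have ab: "a \<le> b" using xt by auto
  note cu = schroedinger_pair_continuous(1)[OF u]
  obtain x0 where x0: "x0 \<in> {a..b}" "\<And>y. y \<in> {a..b} \<Longrightarrow> norm (u y) \<le> norm (u x0)"
    using continuous_norm_sup[OF cu ab] by blast
  define m where "m = norm (u x0)"
  define d where "d = norm (u x) + norm (u' x)"
  have d0: "0 \<le> d" by (simp add: d_def)
  have B0: "0 \<le> B" using B by simp
  have "integral {a..b} (\<lambda>r. norm (\<psi> r - z0 * u r)) \<le> integral {a..b} (\<lambda>r. norm (z - z0) * m)"
  proof (rule integral_le)
    show "(\<lambda>r. norm (\<psi> r - z0 * u r)) integrable_on {a..b}"
      by (intro locally_integrable_integrable locally_integrable_norm locally_integrable_diff
          schroedinger_pair_locally_integrable[OF u V] locally_integrable_continuous continuous_intros cu)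
    fix r assume r: "r \<in> {a..b}"
    have "\<psi> r - z0 * u r = (z - z0) * u r" using hom[OF r] by (simp add: algebra_simps)
    then show "norm (\<psi> r - z0 * u r) \<le> norm (z - z0) * m"
      using x0(2)[OF r] by (simp add: norm_mult m_def mult_left_mono)
  qed (rule integrable_const_ivl)
  also have "\<dots> = norm (z - z0) * (b - a) * m" using ab by simp
  finally have "B * integral {a..b} (\<lambda>r. norm (\<psi> r - z0 * u r)) \<le> B * (norm (z - z0) * (b - a) * m)"
    by (rule mult_left_mono[OF _ B0])
  also have "\<dots> \<le> m / 4"
  proof -
    have "4 * (B * norm (z - z0) * (b - a)) * m \<le> 1 * m"
      using small by (intro mult_right_mono) (auto simp: m_def mult.assoc)
    then show ?thesis by (simp add: mult.assoc)
  qed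
  finally have I: "B * integral {a..b} (\<lambda>r. norm (\<psi> r - z0 * u r)) \<le> m / 4" .
  have "m \<le> B * d + m / 4"
    using duhamel_bound(1)[OF V fs u bt B0 xt(1) x0(1)] I by (simp add: m_def d_def)
  then have m: "m \<le> 4 / 3 * (B * d)" by simp
  have "norm (u t) \<le> B * d + m / 4" "norm (u' t) \<le> B * d + m / 4"
    using duhamel_bound[OF V fs u bt B0 xt] I by (auto simp: d_def)
  moreover have "0 \<le> B * d" using B0 d0 by simp
  ultimately have "norm (u t) + norm (u' t) \<le> 4 * (B * d)" using m by linarith
  then show ?thesis by (simp add: d_def)
qed

text \<open>By Green's formula with a solution \<open>v\<close> at energy \<open>E0\<close> not orthogonal to \<open>f\<close>, the Cauchy data of
  the resolvent applied to \<open>f\<close> cannot be small on both sides of the support of \<open>f\<close>.\<close>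

lemma cauchy_data_lower_bound:
  assumes V: "locally_integrable V" and f: "locally_integrable f" and R: "R > 0"
    and v: "schroedinger_pair V (\<lambda>x. complex_of_real E0 * v x) v v'"
    and nz: "integral {-R..R} (\<lambda>x. f x * v x) \<noteq> 0"
  shows "\<exists>\<delta>>0. \<exists>c0>0. \<forall>z u u'. norm (z - complex_of_real E0) \<le> \<delta> \<longrightarrow> schroedinger_pair V (\<lambda>x. z * u x + f x) u u' \<longrightarrow>
     c0 \<le> norm (u R) + norm (u' R) \<or> c0 \<le> norm (u (- R)) + norm (u' (- R))"
proof -
  let ?e = "complex_of_real E0"
  obtain c c' s s' where fs: "fundamental_system V ?e c c' s s'" using fundamental_system_exists[OF V] by blast
  obtain B where B: "B \<ge> 0" "bounded_transfer c c' s s' B {-R..R}" using bounded_transfer_compact[OF fs] by blast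
  note cv = schroedinger_pair_continuous[OF v]
  obtain xv where xv: "\<And>y. y \<in> {-R..R} \<Longrightarrow> norm (v y) \<le> norm (v xv)"
    using continuous_norm_sup[OF cv(1), of "-R" R] R by (metis neg_le_iff_le neg_le_0_iff_le order_less_imp_le order_trans)
  obtain xv' where xv': "\<And>y. y \<in> {-R..R} \<Longrightarrow> norm (v' y) \<le> norm (v' xv')"
    using continuous_norm_sup[OF cv(2), of "-R" R] R by (metis neg_le_iff_le neg_le_0_iff_le order_less_imp_le order_trans)
  define m where "m = norm (v xv) + norm (v' xv') + 1"
  have "0 \<le> norm (v xv)" "0 \<le> norm (v' xv')" by simp_all
  then have m: "m > 0" "norm (v y) \<le> m" "norm (v' y) \<le> m" if "y \<in> {-R..R}" for y
    using xv[OF that] xv'[OF that] unfolding m_def by linarith+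
  have m0: "m > 0" using m(1)[of 0] R by simp
  define I where "I = integral {-R..R} (\<lambda>x. f x * v x)"
  have I: "norm I > 0" using nz by (simp add: I_def)
  define F where "F = integral {-R..R} (\<lambda>x. norm (f x))"
  have F: "0 \<le> F" unfolding F_def by (intro integral_nonneg locally_integrable_integrable locally_integrable_norm f) auto
  \<comment> \<open>Bounds \<open>u\<close> on {-R..R} once its data at \<open>R\<close> are below
    1; the factor 2 stems from absorbing half of the maximum.\<close>
  define G where "G = 2 * B * (1 + F)"
  have G: "0 \<le> G" using B(1) F by (simp add: G_def)
  \<comment> \<open>Makes each boundary Wronskian at most norm I / 8. With the energy error of at
    most norm I / 4 the total is norm I / 2, too little to equal I.\<close>
  define c0 where "c0 = min 1 (norm I / (8 * m))"
  \<comment> \<open>The first entry permits the absorption behind \<open>G\<close>; the second makes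
    the energy error in Green's formula at most norm I / 4. The summands 1 keep the denominators
    positive.\<close>
  define \<delta> where "\<delta> = min (1 / (4 * R * B + 1)) (norm I / (8 * R * m * G + 1))"
  have c0: "c0 > 0" using I m0 by (simp add: c0_def)
  have p: "4 * R * B + 1 > 0" "8 * R * m * G + 1 > 0" using R B(1) m0 G by (auto intro!: add_nonneg_pos)
  have \<delta>: "\<delta> > 0" using I p by (simp add: \<delta>_def)
  have False if z: "norm (z - ?e) \<le> \<delta>" and u: "schroedinger_pair V (\<lambda>x. z * u x + f x) u u'"
    and d1: "norm (u R) + norm (u' R) < c0" and d2: "norm (u (- R)) + norm (u' (- R)) < c0" for z u u'
  proof -
    note cu = schroedinger_pair_continuous(1)[OF u]
    obtain x0 where x0: "x0 \<in> {-R..R}" "\<And>y. y \<in> {-R..R} \<Longrightarrow> norm (u y) \<le> norm (u x0)"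
      using continuous_norm_sup[OF cu, of "-R" R] R by auto
    define \<mu> where "\<mu> = norm (u x0)"
    have \<mu>0: "0 \<le> \<mu>" by (simp add: \<mu>_def)
    have \<delta>0: "0 \<le> \<delta>" using \<delta> by simp
    have "integral {-R..R} (\<lambda>r. norm (z * u r + f r - ?e * u r)) \<le> integral {-R..R} (\<lambda>r. \<delta> * \<mu> + norm (f r))"
    proof (rule integral_le)
      show "(\<lambda>r. norm (z * u r + f r - ?e * u r)) integrable_on {-R..R}"
        by (intro locally_integrable_integrable locally_integrable_norm locally_integrable_diff locally_integrable_add f
            locally_integrable_continuous continuous_intros cu)
      show "(\<lambda>r. \<delta> * \<mu> + norm (f r)) integrable_on {-R..R}"
        by (intro integrable_add integrable_const_ivl locally_integrable_integrable locally_integrable_norm f)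
      fix r assume r: "r \<in> {-R..R}"
      have "z * u r + f r - ?e * u r = (z - ?e) * u r + f r" by (simp add: algebra_simps)
      also have "norm \<dots> \<le> norm (z - ?e) * norm (u r) + norm (f r)"
        by (rule order.trans[OF norm_triangle_ineq]) (simp add: norm_mult)
      also have "\<dots> \<le> \<delta> * \<mu> + norm (f r)"
        using z x0(2)[OF r] \<delta>0 by (intro add_right_mono mult_mono) (auto simp: \<mu>_def)
      finally show "norm (z * u r + f r - ?e * u r) \<le> \<delta> * \<mu> + norm (f r)" .
    qed
    also have "\<dots> = 2 * R * (\<delta> * \<mu>) + F"
      unfolding F_def using R
      by (subst Henstock_Kurzweil_Integration.integral_add[OF integrable_const_ivl
            locally_integrable_integrable[OF locally_integrable_norm[OF f]]]) simp
    finally have J: "integral {-R..R} (\<lambda>r. norm (z * u r + f r - ?e * u r)) \<le> 2 * R * (\<delta> * \<mu>) + F" .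
    have "\<mu> \<le> B * (norm (u R) + norm (u' R)) + B * integral {-R..R} (\<lambda>r. norm (z * u r + f r - ?e * u r))"
      unfolding \<mu>_def by (rule duhamel_bound(1)[OF V fs u B(2,1) _ x0(1)]) (use R in auto)
    also have "\<dots> \<le> B * 1 + B * (2 * R * (\<delta> * \<mu>) + F)"
      using d1 J B(1) by (intro add_mono mult_left_mono) (auto simp: c0_def)
    also have "\<dots> = B * (1 + F) + (2 * R * B * \<delta>) * \<mu>" by (simp add: algebra_simps)
    also have "(2 * R * B * \<delta>) * \<mu> \<le> (1 / 2) * \<mu>"
    proof (rule mult_right_mono[OF _ \<mu>0])
      have "\<delta> \<le> 1 / (4 * R * B + 1)" by (simp add: \<delta>_def)
      then have "\<delta> * (4 * R * B + 1) \<le> 1" using pos_le_divide_eq[OF p(1)] by blast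
      with \<delta> show "2 * R * B * \<delta> \<le> 1 / 2" by (simp add: algebra_simps)
    qed
    finally have "\<mu> \<le> B * (1 + F) + (1 / 2) * \<mu>" by simp
    then have \<mu>: "\<mu> \<le> G" by (simp add: G_def)
    define w where "w x = u x * v' x - u' x * v x" for x
    have "has_ac_derivative w (\<lambda>x. (z * u x + f x) * v x - u x * (?e * v x))"
      unfolding w_def by (rule wronskian_ac_derivative[OF u v])
    then have h1: "((\<lambda>x. (z * u x + f x) * v x - u x * (?e * v x)) has_integral w R - w (- R)) {-R..R}"
      by (rule has_ac_derivative_has_integral) (use R in simp)
    have eq: "(\<lambda>x. (z * u x + f x) * v x - u x * (?e * v x)) = (\<lambda>x. f x * v x + (z - ?e) * (u x * v x))"
      by (simp add: algebra_simps)
    have uv: "(\<lambda>x. u x * v x) integrable_on {-R..R}"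
      by (intro integrable_continuous_real continuous_intros cu cv)
    have h2: "((\<lambda>x. f x * v x + (z - ?e) * (u x * v x)) has_integral I + (z - ?e) * integral {-R..R} (\<lambda>x. u x * v x)) {-R..R}"
      unfolding I_def
      by (intro has_integral_add has_integral_mult_right integrable_integral uv locally_integrable_integrable
          locally_integrable_mult f cv)
    have "I + (z - ?e) * integral {-R..R} (\<lambda>x. u x * v x) = w R - w (- R)"
      by (rule has_integral_unique[OF h2 h1[unfolded eq]])
    then have "I = w R - w (- R) - (z - ?e) * integral {-R..R} (\<lambda>x. u x * v x)" by (simp add: algebra_simps)
    then have "norm I \<le> norm (w R) + norm (w (- R)) + norm ((z - ?e) * integral {-R..R} (\<lambda>x. u x * v x))"
      using norm_triangle_ineq4[of "w R - w (- R)" "(z - ?e) * integral {-R..R} (\<lambda>x. u x * v x)"]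
        norm_triangle_ineq4[of "w R" "w (- R)"] by simp
    moreover have wle: "norm (w x) \<le> norm I / 8" if x: "x \<in> {-R..R}" "norm (u x) + norm (u' x) < c0" for x
    proof -
      have "norm (w x) \<le> norm (u x) * norm (v' x) + norm (u' x) * norm (v x)"
        unfolding w_def by (rule order.trans[OF norm_triangle_ineq4]) (simp add: norm_mult)
      also have "\<dots> \<le> norm (u x) * m + norm (u' x) * m"
        using m x by (intro add_mono mult_left_mono) auto
      also have "\<dots> = (norm (u x) + norm (u' x)) * m" by (simp add: algebra_simps)
      also have "\<dots> \<le> c0 * m" using x(2) m0 by (intro mult_right_mono) auto
      also have "\<dots> \<le> norm I / (8 * m) * m" using m0 by (intro mult_right_mono) (auto simp: c0_def)
      finally show ?thesis using m0 by simp
    qed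
    moreover have "norm ((z - ?e) * integral {-R..R} (\<lambda>x. u x * v x)) \<le> norm I / 4"
    proof -
      have "norm (integral {-R..R} (\<lambda>x. u x * v x)) \<le> integral {-R..R} (\<lambda>x. G * m)"
      proof (rule integral_norm_bound_integral[OF uv integrable_const_ivl])
        fix x assume x: "x \<in> {-R..R}"
        show "norm (u x * v x) \<le> G * m"
          unfolding norm_mult using x0(2)[OF x] \<mu> m(2)[OF x] G by (intro mult_mono) (auto simp: \<mu>_def)
      qed
      also have "\<dots> = 2 * R * (G * m)" using R by simp
      finally have "norm ((z - ?e) * integral {-R..R} (\<lambda>x. u x * v x)) \<le> \<delta> * (2 * R * (G * m))"
        unfolding norm_mult using z \<delta>0 by (intro mult_mono) auto
      also have "\<dots> \<le> norm I / 4"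
      proof -
        have "\<delta> \<le> norm I / (8 * R * m * G + 1)" by (simp add: \<delta>_def)
        then have "\<delta> * (8 * R * m * G + 1) \<le> norm I" using pos_le_divide_eq[OF p(2)] by blast
        then have "\<delta> * (8 * R * m * G) \<le> norm I" using \<delta>0 by (simp add: distrib_left)
        then show ?thesis by (simp add: algebra_simps)
      qed
      finally show ?thesis .
    qed
    ultimately show False
      using wle[of R] wle[of "- R"] d1 d2 R I by fastforce
  qed
  then show ?thesis using \<delta> c0 by (meson not_le)
qed


section \<open>Mass of the resolvent function on a shell\<close>

lemma unit_intervals_sum_le:
  fixes h :: "real \<Rightarrow> real"
  assumes h: "locally_integrable h" and q: "\<And>j. j < n \<Longrightarrow> q \<le> integral {b + real j..b + real j + 1} h"
  shows "real n * q \<le> integral {b..b + real n} h"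
  using q
proof (induction n)
  case (Suc n)
  have "integral {b..b + real n} h + integral {b + real n..b + real (Suc n)} h = integral {b..b + real (Suc n)} h"
    by (rule Henstock_Kurzweil_Integration.integral_combine) (auto intro: locally_integrable_integrable h)
  moreover have "q \<le> integral {b + real n..b + real (Suc n)} h" using Suc.prems[of n] by (simp add: add_ac)
  moreover have "real n * q \<le> integral {b..b + real n} h" using Suc by simp
  ultimately show ?case by (simp add: algebra_simps)
qed simp

text \<open>By \<open>propagation_bound\<close> the data at the left end of each unit interval are
  at least c0 / (4 B), and \<open>local_estimate_square\<close> converts data into mass. Where
  \<open>g\<close> vanishes the source term is z u, hence the factor 1 + Z^2.\<close>

lemma solution_mass_lower_bound:
  assumes V: "locally_integrable V" and K: "\<And>a. integral {a..a+1} (\<lambda>x. \<bar>V x\<bar>) \<le> K"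
    and g: "g \<in> L2" and u: "u \<in> L2" "schroedinger_pair V (\<lambda>x. z * u x + g x) u u'"
    and fs: "fundamental_system V z0 c c' s s'" and bt: "bounded_transfer c c' s s' B {a0..b0}" and B: "B \<ge> 1"
    and hom: "\<And>r. r \<in> {a0..b0} \<Longrightarrow> g r = 0" and small: "4 * B * norm (z - z0) * (b0 - a0) \<le> 1"
    and y: "y \<in> {a0..b0}" "c0 \<le> norm (u y) + norm (u' y)" and c0: "0 \<le> c0" and Z: "norm z \<le> Z"
    and sub: "{b..b + real n} \<subseteq> {a0..b0}"
  shows "real n * (c0 / (4 * B))\<^sup>2 \<le>
    2 * (4 * (2 + K) * (3 + K) + 1)\<^sup>2 * (1 + Z\<^sup>2) * integral {b..b + real n} (\<lambda>x. (norm (u x))\<^sup>2)"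
proof -
  define D where "D = 2 * (4 * (2 + K) * (3 + K) + 1)\<^sup>2 * (1 + Z\<^sup>2)"
  have D: "0 \<le> D" by (simp add: D_def)
  note lu2 = L2_locally_integrable_sq[OF u(1)]
  have "real n * (c0 / (4 * B))\<^sup>2 \<le> integral {b..b + real n} (\<lambda>x. D * (norm (u x))\<^sup>2)"
  proof (rule unit_intervals_sum_le)
    show "locally_integrable (\<lambda>x. D * (norm (u x))\<^sup>2)" by (intro locally_integrable_cmult lu2)
    fix j assume j: "j < n"
    define a where "a = b + real j"
    have aJ: "{a..a+1} \<subseteq> {a0..b0}"
    proof (rule order.trans[OF _ sub])
      have "real j + 1 \<le> real n" using j by (simp add: of_nat_less_iff[symmetric] del: of_nat_less_iff)
      then show "{a..a+1} \<subseteq> {b..b + real n}" by (auto simp: a_def)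
    qed
    have "c0 \<le> 4 * B * (norm (u a) + norm (u' a))"
    proof -
      have "norm (u y) + norm (u' y) \<le> 4 * B * (norm (u a) + norm (u' a))"
        by (rule propagation_bound[OF V fs u(2) bt B _ small _ y(1)]) (use hom aJ in auto)
      then show ?thesis using y(2) by simp
    qed
    then have "c0 / (4 * B) \<le> norm (u a) + norm (u' a)" using B by (simp add: field_simps)
    then have "(c0 / (4 * B))\<^sup>2 \<le> (norm (u a) + norm (u' a))\<^sup>2"
      using c0 B by (intro power_mono) auto
    also have "\<dots> \<le> 2 * (4 * (2 + K) * (3 + K) + 1)\<^sup>2 *
      (integral {a..a+1} (\<lambda>x. (norm (u x))\<^sup>2) + integral {a..a+1} (\<lambda>x. (norm (z * u x + g x))\<^sup>2))"
      by (rule local_estimate_square[OF u(2) V K _ L2_locally_integrable_sq[OF L2_add[OF L2_cmult[OF u(1)] g]]]) simp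
    finally have est: "(c0 / (4 * B))\<^sup>2 \<le> 2 * (4 * (2 + K) * (3 + K) + 1)\<^sup>2 *
      (integral {a..a+1} (\<lambda>x. (norm (u x))\<^sup>2) + integral {a..a+1} (\<lambda>x. (norm (z * u x + g x))\<^sup>2))" .
    have "integral {a..a+1} (\<lambda>x. (norm (z * u x + g x))\<^sup>2) \<le> integral {a..a+1} (\<lambda>x. Z\<^sup>2 * (norm (u x))\<^sup>2)"
    proof (rule integral_le)
      show "(\<lambda>x. (norm (z * u x + g x))\<^sup>2) integrable_on {a..a+1}"
        by (intro locally_integrable_integrable L2_locally_integrable_sq L2_add L2_cmult u g)
      show "(\<lambda>x. Z\<^sup>2 * (norm (u x))\<^sup>2) integrable_on {a..a+1}"
        by (intro integrable_on_mult_right locally_integrable_integrable lu2)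
      fix x assume "x \<in> {a..a+1}"
      then have "g x = 0" using hom aJ by blast
      moreover have "(norm z)\<^sup>2 \<le> Z\<^sup>2" using Z by (intro power_mono) auto
      ultimately show "(norm (z * u x + g x))\<^sup>2 \<le> Z\<^sup>2 * (norm (u x))\<^sup>2"
        by (simp add: norm_mult power_mult_distrib mult_right_mono)
    qed
    also have "\<dots> = Z\<^sup>2 * integral {a..a+1} (\<lambda>x. (norm (u x))\<^sup>2)" by simp
    finally have "2 * (4 * (2 + K) * (3 + K) + 1)\<^sup>2 *
      (integral {a..a+1} (\<lambda>x. (norm (u x))\<^sup>2) + integral {a..a+1} (\<lambda>x. (norm (z * u x + g x))\<^sup>2)) \<le>
      2 * (4 * (2 + K) * (3 + K) + 1)\<^sup>2 *
      (integral {a..a+1} (\<lambda>x. (norm (u x))\<^sup>2) + Z\<^sup>2 * integral {a..a+1} (\<lambda>x. (norm (u x))\<^sup>2))"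
      by (intro mult_left_mono add_left_mono) auto
    also have "\<dots> = D * integral {a..a+1} (\<lambda>x. (norm (u x))\<^sup>2)"
      unfolding D_def by (simp only: distrib_left distrib_right mult.assoc mult_1_right mult_1_left)
    finally have "(c0 / (4 * B))\<^sup>2 \<le> D * integral {a..a+1} (\<lambda>x. (norm (u x))\<^sup>2)"
      using est by linarith
    then show "(c0 / (4 * B))\<^sup>2 \<le> integral {b + real j..b + real j + 1} (\<lambda>x. D * (norm (u x))\<^sup>2)"
      by (simp add: a_def)
  qed
  then show ?thesis by (simp add: D_def)
qed

text \<open>Green's formula does not tell at which of the points \<open>R\<close> and
  \<open>- R\<close> the data are large. The shell has a part on either side, reached through {R..X}
  or {-X..-R}, where \<open>g\<close> vanishes.\<close>

lemma resolvent_mass_lower_bound: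
  assumes V: "locally_integrable V" and K: "\<And>a. integral {a..a+1} (\<lambda>x. \<bar>V x\<bar>) \<le> K"
    and g: "g \<in> L2" "\<And>r. \<bar>r\<bar> \<ge> R \<Longrightarrow> g r = 0" and R: "R > 0"
    and u: "u \<in> L2" "schroedinger_pair V (\<lambda>x. z * u x + g x) u u'"
    and E: "E \<in> P_set V \<alpha> C N" and small: "4 * (C * N powr \<alpha>) * norm (z - complex_of_real E) * X \<le> 1"
    and c0: "0 \<le> c0" "c0 \<le> norm (u R) + norm (u' R) \<or> c0 \<le> norm (u (- R)) + norm (u' (- R))"
    and Z: "norm z \<le> Z" and X: "X \<le> N" "2 * R \<le> X" "4 \<le> X"
  shows "X / 4 * (c0 / (4 * (C * N powr \<alpha>)))\<^sup>2 \<le> 2 * (4 * (2 + K) * (3 + K) + 1)\<^sup>2 * (1 + Z\<^sup>2) *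
    (norm (restrict_l2 {x. X / 2 \<le> \<bar>x\<bar> \<and> \<bar>x\<bar> \<le> X} (abs_l2 u)))\<^sup>2"
proof -
  let ?B = "C * N powr \<alpha>" and ?S = "{x. X / 2 \<le> \<bar>x\<bar> \<and> \<bar>x\<bar> \<le> X}" and ?z0 = "complex_of_real E"
  define D where "D = 2 * (4 * (2 + K) * (3 + K) + 1)\<^sup>2 * (1 + Z\<^sup>2)"
  have D: "0 \<le> D" by (simp add: D_def)
  obtain c c' s s' where fs: "fundamental_system V ?z0 c c' s s'" using fundamental_system_exists[OF V] by blast
  note bt = P_set_bounded_transfer[OF E fs]
  \<comment> \<open>The transfer matrix from 0 to 0 is the identity; its first entry is the
    Wronskian 1, so the bound cannot be below 1.\<close>
  have "0 \<in> {-N..N}" using X by auto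
  then have B: "?B \<ge> 1"
    using bt fundamental_system_wronskian[OF fs, of 0] unfolding bounded_transfer_def
    by (metis mult.commute norm_one)
  \<comment> \<open>The number of whole unit intervals in one side of the shell, of length X/2;
    since X \<ge> 4, rounding down loses at most half.\<close>
  define n where "n = nat \<lfloor>X / 2\<rfloor>"
  have n: "X / 4 \<le> real n" "real n \<le> X / 2" using X unfolding n_def by linarith+
  have S: "?S \<in> sets lebesgue"
  proof -
    have "closed ?S" by (intro closed_Collect_conj closed_Collect_le continuous_intros)
    then show ?thesis by (intro sets_completionI_sets) simp
  qed
  have len: "4 * ?B * norm (z - ?z0) * l \<le> 1" if "0 \<le> l" "l \<le> X" for l
  proof -
    have "0 \<le> 4 * ?B * norm (z - ?z0)" using B by simp
    from mult_left_mono[OF that(2) this] small show ?thesis by linarith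
  qed
  have mass: "X / 4 * (c0 / (4 * ?B))\<^sup>2 \<le> D * (norm (restrict_l2 ?S (abs_l2 u)))\<^sup>2"
    if main: "real n * (c0 / (4 * ?B))\<^sup>2 \<le> D * integral {b..b + real n} (\<lambda>x. (norm (u x))\<^sup>2)"
      and sub: "{b..b + real n} \<subseteq> ?S" for b
  proof -
    have ai: "(\<lambda>x. (norm (u x))\<^sup>2) absolutely_integrable_on {b..b + real n}"
      by (rule locally_integrable_absolutely[OF L2_locally_integrable_sq[OF u(1)]])
    have "X / 4 * (c0 / (4 * ?B))\<^sup>2 \<le> real n * (c0 / (4 * ?B))\<^sup>2"
      using n by (intro mult_right_mono) auto
    also note main
    also have "integral {b..b + real n} (\<lambda>x. (norm (u x))\<^sup>2) = (LINT x|lebesgue. indicator {b..b + real n} x * (norm (u x))\<^sup>2)"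
      using set_lebesgue_integral_eq_integral(2)[OF ai] by (simp add: set_lebesgue_integral_def)
    also have "\<dots> \<le> (LINT x|lebesgue. indicator ?S x * (norm (u x))\<^sup>2)"
    proof (rule integral_mono)
      show "integrable lebesgue (\<lambda>x. indicator {b..b + real n} x * (norm (u x))\<^sup>2)"
        using ai by (simp add: set_integrable_def)
      show "integrable lebesgue (\<lambda>x. indicator ?S x * (norm (u x))\<^sup>2)"
        using integrable_mult_indicator[OF S L2_integrable[OF u(1)]] by simp
      show "indicator {b..b + real n} x * (norm (u x))\<^sup>2 \<le> indicator ?S x * (norm (u x))\<^sup>2" for x
        using sub by (intro mult_right_mono) (auto simp: indicator_def)
    qed
    also have "\<dots> = (norm (restrict_l2 ?S (abs_l2 u)))\<^sup>2" by (rule norm_restrict_l2_sq[OF u(1) S, symmetric])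
    finally show ?thesis using D by (simp add: mult_left_mono)
  qed
  from c0(2) have "X / 4 * (c0 / (4 * ?B))\<^sup>2 \<le> D * (norm (restrict_l2 ?S (abs_l2 u)))\<^sup>2"
  proof
    assume y: "c0 \<le> norm (u R) + norm (u' R)"
    show ?thesis
    proof (rule mass[of "X / 2"])
      show "real n * (c0 / (4 * ?B))\<^sup>2 \<le> D * integral {X / 2..X / 2 + real n} (\<lambda>x. (norm (u x))\<^sup>2)"
        unfolding D_def
        by (rule solution_mass_lower_bound[OF V K g(1) u fs bounded_transfer_subset[OF bt, of "{R..X}"] B _ len _ y c0(1) Z])
          (use g R X n in auto)
    qed (use n in auto)
  next
    assume y: "c0 \<le> norm (u (- R)) + norm (u' (- R))"
    show ?thesis
    proof (rule mass[of "- X"])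
      show "real n * (c0 / (4 * ?B))\<^sup>2 \<le> D * integral {- X..- X + real n} (\<lambda>x. (norm (u x))\<^sup>2)"
        unfolding D_def
        by (rule solution_mass_lower_bound[OF V K g(1) u fs bounded_transfer_subset[OF bt, of "{-X..-R}"] B _ len _ y c0(1) Z])
          (use g R X n in auto)
    qed (use n X in auto)
  qed
  then show ?thesis by (simp add: D_def)
qed


subsection \<open>The lower bound for the moments\<close>

text \<open>On the shell the weight is at least (X/2)^p, so the moment dominates the time-averaged
  mass there. \<open>res\<close> speaks about all square integrable solutions at each E;
  \<open>resolvent_exists\<close> supplies one for \<open>resolvent_transport\<close>.\<close>

lemma time_averaged_moment_lower_bound:
  assumes V: "uniformly_locally_integrable V" and f: "f \<in> L2" and T: "T > 0" and p: "p > 0" and X: "X > 0"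
    and m: "m > 0" and B: "B \<in> sets lebesgue" "B \<subseteq> {e - pi..e + pi}"
    and res: "\<And>E u. E \<in> B \<Longrightarrow> u \<in> L2 \<Longrightarrow> schroedinger_eq V u (\<lambda>x. Complex E (1 / T) * u x + f x) \<Longrightarrow>
      m \<le> norm (restrict_l2 {x. X / 2 \<le> \<bar>x\<bar> \<and> \<bar>x\<bar> \<le> X} (abs_l2 u))"
  shows "ennreal (2 / T * (X / 2) powr p * (m\<^sup>2 / (8 * pi))) * emeasure lebesgue B \<le> time_averaged_moment V f T p"
proof -
  let ?S = "{x. X / 2 \<le> \<bar>x\<bar> \<and> \<bar>x\<bar> \<le> X}"
  have "closed ?S" by (intro closed_Collect_conj closed_Collect_le continuous_intros)
  then have S: "?S \<in> sets lebesgue" by (intro sets_completionI_sets) simp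
  define N where "N t = (norm (restrict_l2 ?S (evolution_l2 V t (abs_l2 f))))\<^sup>2" for t
  have transport: "ennreal (m\<^sup>2 / (8 * pi)) * emeasure lebesgue B \<le>
      (\<integral>\<^sup>+ t\<in>{0..}. ennreal (exp (- 2 * t / T) * N t) \<partial>lebesgue)"
    unfolding N_def
  proof (rule resolvent_transport[OF V f T S m B])
    fix E assume E: "E \<in> B"
    have "Im (Complex E (1 / T)) \<noteq> 0" using T by simp
    from resolvent_exists[OF V this f] res[OF E]
    show "\<exists>u\<in>L2. schroedinger_eq V u (\<lambda>x. Complex E (1 / T) * u x + f x) \<and> m \<le> norm (restrict_l2 ?S (abs_l2 u))"
      by blast
  qed
  have moment: "ennreal ((X / 2) powr p) * ennreal (N t) \<le>
      l2_norm_sq (\<lambda>x. complex_of_real (\<bar>x\<bar> powr (p / 2)) * evolution V t f x)" for t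
  proof -
    define \<phi> where "\<phi> = evolution V t f"
    have \<phi>: "\<phi> \<in> L2"
      using evolution_unitary_group[OF V] f unfolding unitary_group_generated_by_def \<phi>_def by blast
    have si: "integrable lebesgue (\<lambda>x. indicator ?S x * (norm (\<phi> x))\<^sup>2)"
      using integrable_mult_indicator[OF S L2_integrable[OF \<phi>]] by simp
    have "ennreal ((X / 2) powr p) * ennreal (N t) = ennreal ((X / 2) powr p) * ennreal (LINT x|lebesgue. indicator ?S x * (norm (\<phi> x))\<^sup>2)"
      unfolding N_def abs_l2_evolution[OF V f, symmetric] \<phi>_def[symmetric] norm_restrict_l2_sq[OF \<phi> S] ..
    also have "ennreal (LINT x|lebesgue. indicator ?S x * (norm (\<phi> x))\<^sup>2) = (\<integral>\<^sup>+ x. ennreal (indicator ?S x * (norm (\<phi> x))\<^sup>2) \<partial>lebesgue)"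
      by (rule nn_integral_eq_integral[OF si, symmetric]) auto
    also have "ennreal ((X / 2) powr p) * \<dots> = (\<integral>\<^sup>+ x. ennreal ((X / 2) powr p) * ennreal (indicator ?S x * (norm (\<phi> x))\<^sup>2) \<partial>lebesgue)"
      by (rule nn_integral_cmult[symmetric]) (use si in auto)
    also have "\<dots> \<le> (\<integral>\<^sup>+ x. ennreal ((norm (complex_of_real (\<bar>x\<bar> powr (p / 2)) * \<phi> x))\<^sup>2) \<partial>lebesgue)"
    proof (rule nn_integral_mono)
      fix x :: real
      show "ennreal ((X / 2) powr p) * ennreal (indicator ?S x * (norm (\<phi> x))\<^sup>2) \<le>
          ennreal ((norm (complex_of_real (\<bar>x\<bar> powr (p / 2)) * \<phi> x))\<^sup>2)"
      proof (cases "x \<in> ?S")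
        case True
        have "(X / 2) powr p \<le> \<bar>x\<bar> powr p" using True X p by (intro powr_mono2) auto
        also have "\<bar>x\<bar> powr p = (\<bar>x\<bar> powr (p / 2))\<^sup>2"
          by (simp add: power2_eq_square flip: powr_add)
        finally have "(X / 2) powr p * (norm (\<phi> x))\<^sup>2 \<le> (\<bar>x\<bar> powr (p / 2))\<^sup>2 * (norm (\<phi> x))\<^sup>2"
          by (rule mult_right_mono) simp
        then show ?thesis
          using True by (simp add: norm_mult power_mult_distrib flip: ennreal_mult)
      qed simp
    qed
    finally show ?thesis unfolding l2_norm_sq_def \<phi>_def .
  qed
  have "ennreal (2 / T * (X / 2) powr p * (m\<^sup>2 / (8 * pi))) * emeasure lebesgue B =
      ennreal (2 / T) * (ennreal ((X / 2) powr p) * (ennreal (m\<^sup>2 / (8 * pi)) * emeasure lebesgue B))"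
  proof -
    have assoc: "ennreal (a * b * c) * x = ennreal a * (ennreal b * (ennreal c * x))" if "a \<ge> 0" "b \<ge> 0" "c \<ge> 0" for a b c x
      using that by (simp add: ennreal_mult mult.assoc)
    show ?thesis by (rule assoc) (use T in auto)
  qed
  also have "\<dots> \<le> ennreal (2 / T) * (ennreal ((X / 2) powr p) *
      (\<integral>\<^sup>+ t\<in>{0..}. ennreal (exp (- 2 * t / T) * N t) \<partial>lebesgue))"
    by (intro mult_left_mono transport) auto
  also have "ennreal ((X / 2) powr p) * (\<integral>\<^sup>+ t\<in>{0..}. ennreal (exp (- 2 * t / T) * N t) \<partial>lebesgue) =
      (\<integral>\<^sup>+ t. ennreal ((X / 2) powr p) * (ennreal (exp (- 2 * t / T) * N t) * indicator {0..} t) \<partial>lebesgue)"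
  proof (rule nn_integral_cmult[symmetric])
    interpret R: bounded_linear "restrict_l2 ?S" by (rule bounded_linear_restrict_l2)
    have "continuous_on UNIV (\<lambda>t. exp (- 2 * t / T) * N t)"
      unfolding N_def by (intro continuous_intros R.continuous_on evolution_l2_continuous[OF V]) (use T in auto)
    then have "(\<lambda>t. exp (- 2 * t / T) * N t) \<in> borel_measurable lebesgue"
      by (intro measurable_completion) (simp add: borel_measurable_continuous_onI)
    then show "(\<lambda>t. ennreal (exp (- 2 * t / T) * N t) * indicator {0..} t) \<in> borel_measurable lebesgue"
      by (intro borel_measurable_times_ennreal measurable_compose[OF _ measurable_ennreal] borel_measurable_indicator)
        (auto intro: sets_completionI_sets)
  qed
  also have "\<dots> \<le> (\<integral>\<^sup>+ t\<in>{0..}. ennreal (exp (- 2 * t / T)) *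
        l2_norm_sq (\<lambda>x. complex_of_real (\<bar>x\<bar> powr (p / 2)) * evolution V t f x) \<partial>lebesgue)"
  proof (rule nn_integral_mono)
    fix t
    have "ennreal ((X / 2) powr p) * ennreal (exp (- 2 * t / T) * N t) =
        ennreal (exp (- 2 * t / T)) * (ennreal ((X / 2) powr p) * ennreal (N t))"
      by (simp add: ennreal_mult' N_def mult.left_commute)
    also have "\<dots> \<le> ennreal (exp (- 2 * t / T)) * l2_norm_sq (\<lambda>x. complex_of_real (\<bar>x\<bar> powr (p / 2)) * evolution V t f x)"
      by (intro mult_left_mono moment) simp
    finally show "ennreal ((X / 2) powr p) * (ennreal (exp (- 2 * t / T) * N t) * indicator {0..} t) \<le>
        ennreal (exp (- 2 * t / T)) * l2_norm_sq (\<lambda>x. complex_of_real (\<bar>x\<bar> powr (p / 2)) * evolution V t f x) * indicator {0..} t"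
      by (simp add: indicator_def)
  qed
  finally show ?thesis
    unfolding time_averaged_moment_def by (simp add: mult_left_mono)
qed

theorem theorem2:
  fixes V :: "real \<Rightarrow> real" and E0 C \<alpha> p :: real
    and A :: "real \<Rightarrow> real set" and f :: "real \<Rightarrow> complex"
  assumes V: "uniformly_locally_integrable V"
    and C: "C > 0" and \<alpha>: "\<alpha> > 0"
    and E0: "\<forall>\<^sub>F N in at_top. E0 \<in> P_set V \<alpha> C N"
    and A: "\<forall>\<^sub>F N in at_top. A N \<subseteq> P_set V \<alpha> C N \<and> E0 \<in> A N"
    and diam: "((\<lambda>N. ediameter (A N)) \<longlongrightarrow> 0) at_top"
    and p: "p > 0"
    and f: "f \<in> L2" "compactly_supported f"
    and u: "\<exists>u. solution V (complex_of_real E0) u \<and> L2_inner u f \<noteq> 0"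
  shows "\<exists>C'>0. \<forall>\<^sub>F T in at_top.
           time_averaged_moment V f T p \<ge>
             ennreal (C' * T powr ((p - 3 * \<alpha>) / (1 + \<alpha>))) *
             emeasure lebesgue (neighborhood (1 / T) (A (T powr (1 / (1 + \<alpha>)))))"
proof -
  note lV = uniformly_locally_integrable_bound(1)[OF V]
  obtain K where K: "K \<ge> 0" "\<And>a. integral {a..a+1} (\<lambda>x. \<bar>V x\<bar>) \<le> K"
    using uniformly_locally_integrable_bound(2)[OF V] by blast
  obtain u0 where u0: "solution V (complex_of_real E0) u0" "L2_inner u0 f \<noteq> 0" using u by blast
  \<comment> \<open>The pairing conjugates \<open>f\<close>, while Green's formula integrates f v
    without conjugation. Since V and E0 are real, the conjugate of \<open>u0\<close> is again a
    solution, and the two integrals are conjugate.\<close>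
  define v v' where "v x = cnj (u0 x)" and "v' x = cnj (vector_derivative u0 (at x))" for x
  have v: "schroedinger_pair V (\<lambda>x. complex_of_real E0 * v x) v v'"
    using schroedinger_pair_cnj[OF schroedinger_eq_pair[OF u0(1)[unfolded solution_def]]]
    by (simp add: v_def[abs_def] v'_def[abs_def])
  obtain R0 where R0: "AE x in lebesgue. \<bar>x\<bar> > R0 \<longrightarrow> f x = 0"
    using f(2) by (auto simp: compactly_supported_def)
  \<comment> \<open>The added 1 makes \<open>R\<close> positive. \<open>g\<close> is a
    representative of \<open>f\<close> that vanishes at every point with \<bar>x\<bar> \<ge> R, so
    that the source is zero there pointwise.\<close>
  define R where "R = max R0 0 + 1"
  have R: "R > 0" by (simp add: R_def)
  define g where "g x = (if \<bar>x\<bar> < R then f x else 0)" for x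
  have fg: "AE x in lebesgue. f x = g x"
    using R0 by eventually_elim (auto simp: g_def R_def)
  have g: "g \<in> L2" by (rule L2_AE_cong[OF f(1) borel_measurable_AE[OF L2_measurable[OF f(1)] fg] fg])
  have gR: "g r = 0" if "\<bar>r\<bar> \<ge> R" for r using that by (simp add: g_def)
  have lg: "locally_integrable g" by (rule L2_locally_integrable[OF g])
  have gv: "locally_integrable (\<lambda>x. g x * v x)"
    by (rule locally_integrable_mult[OF lg schroedinger_pair_continuous(1)[OF v]])
  have nz: "integral {-R..R} (\<lambda>x. g x * v x) \<noteq> 0"
  proof
    assume z: "integral {-R..R} (\<lambda>x. g x * v x) = 0"
    have "L2_inner u0 f = (LINT x|lebesgue. indicator {-R..R} x *\<^sub>R cnj (g x * v x))"
      unfolding L2_inner_def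
    proof (rule integral_cong_AE)
      have mu: "u0 \<in> borel_measurable lebesgue"
        using schroedinger_pair_continuous(1)[OF schroedinger_eq_pair[OF u0(1)[unfolded solution_def]], of UNIV]
        by (intro measurable_completion) (simp add: borel_measurable_continuous_onI)
      show "(\<lambda>t. u0 t * cnj (f t)) \<in> borel_measurable lebesgue"
        by (intro borel_measurable_times measurable_compose[OF _ borel_measurable_continuous_onI[of cnj]]
            L2_measurable continuous_intros f mu)
      have "(\<lambda>x. cnj (g x * v x)) absolutely_integrable_on {-R..R}"
        using locally_integrable_absolutely[OF locally_integrable_linear[OF gv bounded_linear_cnj]] .
      then show "(\<lambda>x. indicator {-R..R} x *\<^sub>R cnj (g x * v x)) \<in> borel_measurable lebesgue"
        unfolding set_integrable_def by (rule borel_measurable_integrable)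
      show "AE x in lebesgue. u0 x * cnj (f x) = indicator {-R..R} x *\<^sub>R cnj (g x * v x)"
        using fg by eventually_elim (auto simp: v_def g_def indicator_def split: if_splits)
    qed
    also have "\<dots> = integral {-R..R} (\<lambda>x. cnj (g x * v x))"
      using set_lebesgue_integral_eq_integral(2)[OF locally_integrable_absolutely[OF
            locally_integrable_linear[OF gv bounded_linear_cnj]]]
      by (simp add: set_lebesgue_integral_def)
    also have "\<dots> = cnj (integral {-R..R} (\<lambda>x. g x * v x))"
      using integral_linear[OF locally_integrable_integrable[OF gv] bounded_linear_cnj] by (simp add: o_def)
    finally show False using u0(2) z by simp
  qed
  obtain \<delta>' c0 where \<delta>': "\<delta>' > 0" and c0: "c0 > 0" and data: "\<And>z u u'. norm (z - complex_of_real E0) \<le> \<delta>' \<Longrightarrow>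
      schroedinger_pair V (\<lambda>x. z * u x + g x) u u' \<Longrightarrow>
      c0 \<le> norm (u R) + norm (u' R) \<or> c0 \<le> norm (u (- R)) + norm (u' (- R))"
    using cauchy_data_lower_bound[OF lV lg R v nz] by blast
  \<comment> \<open>The distance from z to E0 has three parts of at most \<eta> each: from E to a
    nearby \<open>a\<close> in A(N), from \<open>a\<close> to E0, and the imaginary part 1/T.
    Moreover 3 \<eta> \<le> 1 gives norm z \<le> Z.\<close>
  define \<eta> where "\<eta> = min \<delta>' 1 / 3"
  have \<eta>: "\<eta> > 0" "3 * \<eta> \<le> \<delta>'" "3 * \<eta> \<le> 1" using \<delta>' by (auto simp: \<eta>_def)
  define Z where "Z = \<bar>E0\<bar> + 1"
  \<comment> \<open>With N^(1+\<alpha>) = T this yields 4 (C N^\<alpha>) (2/T) (\<kappa> N) = 8 C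
    \<kappa> \<le> 1, the smallness needed for propagation; the minimum with 1 keeps the shell
    inside {-N..N}.\<close>
  define \<kappa> where "\<kappa> = min 1 (1 / (8 * C))"
  have \<kappa>: "\<kappa> > 0" "\<kappa> \<le> 1" "8 * C * \<kappa> \<le> 1"
    using C by (auto simp: \<kappa>_def min_def field_simps)
  define D where "D = 2 * (4 * (2 + K) * (3 + K) + 1)\<^sup>2 * (1 + Z\<^sup>2)"
  have D: "D > 0"
  proof -
    have "4 * (2 + K) * (3 + K) + 1 > 0" using K(1) by (intro add_nonneg_pos mult_nonneg_nonneg) auto
    then have "2 * (4 * (2 + K) * (3 + K) + 1)\<^sup>2 > 0" by (metis mult_pos_pos zero_less_numeral zero_less_power)
    moreover have "1 + Z\<^sup>2 > 0" by (simp add: add_pos_nonneg)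
    ultimately show ?thesis unfolding D_def by (rule mult_pos_pos)
  qed
  \<comment> \<open>Solves X/4 (c0 / (4 C N^\<alpha>))^2 = D m^2 for X = \<kappa> N and m^2 = q
    N^(1-2\<alpha>); 64 is 4 times 4^2.\<close>
  define q where "q = \<kappa> * c0\<^sup>2 / (64 * C\<^sup>2 * D)"
  have q: "q > 0" using \<kappa> c0 C D by (simp add: q_def)
  \<comment> \<open>What is left of 2/T (X/2)^p m^2 / (8 pi) when T and the powers of N are split
    off.\<close>
  define C' where "C' = 2 * (\<kappa> / 2) powr p * q / (8 * pi)"
  have C': "C' > 0" using \<kappa> q by (simp add: C'_def)
  define NT where "NT T = T powr (1 / (1 + \<alpha>))" for T :: real
  have NT: "filterlim NT at_top at_top"
    unfolding filterlim_at_top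
  proof
    fix y :: real
    show "\<forall>\<^sub>F T in at_top. y \<le> NT T"
      using eventually_ge_at_top[of "(\<bar>y\<bar> + 1) powr (1 + \<alpha>)"]
    proof eventually_elim
      case (elim T)
      have "((\<bar>y\<bar> + 1) powr (1 + \<alpha>)) powr (1 / (1 + \<alpha>)) \<le> NT T"
        unfolding NT_def using elim \<alpha> by (intro powr_mono2) auto
      then show ?case using \<alpha> by (simp add: powr_powr)
    qed
  qed
  have ev_A: "\<forall>\<^sub>F T in at_top. A (NT T) \<subseteq> P_set V \<alpha> C (NT T) \<and> E0 \<in> A (NT T)"
    using filterlim_iff[THEN iffD1, OF NT] A by blast
  have "\<forall>\<^sub>F N in at_top. ediameter (A N) < ennreal \<eta>"
    using diam \<eta>(1) by (intro order_tendstoD(2)[OF diam]) simp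
  then have ev_d: "\<forall>\<^sub>F T in at_top. ediameter (A (NT T)) < ennreal \<eta>"
    using filterlim_iff[THEN iffD1, OF NT] by blast
  \<comment> \<open>Amounts to X = \<kappa> N \<ge> 4 + 2 R: the shell starts beyond the support of
    \<open>g\<close> and has room for unit intervals.\<close>
  have ev_N: "\<forall>\<^sub>F T in at_top. NT T \<ge> (4 + 2 * R) / \<kappa>"
    using NT by (simp add: filterlim_at_top)
  have ev_T: "\<forall>\<^sub>F T in at_top. T \<ge> max 1 (1 / \<eta>)" by (rule eventually_ge_at_top)
  have "\<forall>\<^sub>F T in at_top. time_averaged_moment V f T p \<ge>
             ennreal (C' * T powr ((p - 3 * \<alpha>) / (1 + \<alpha>))) *
             emeasure lebesgue (neighborhood (1 / T) (A (T powr (1 / (1 + \<alpha>)))))"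
    using ev_A ev_d ev_N ev_T
  proof eventually_elim
    case (elim T)
    define N where "N = NT T"
    define X where "X = \<kappa> * N"
    define B where "B = neighborhood (1 / T) (A N)"
    have T: "T \<ge> 1" "1 / T \<le> \<eta>"
      using elim(4) \<eta>(1) by (auto simp: field_simps)
    have X4: "4 + 2 * R \<le> X" using elim(3) \<kappa>(1) by (simp add: X_def N_def field_simps)
    then have X: "X > 0" "4 \<le> X" "2 * R \<le> X" using R by auto
    then have N0: "N > 0" using \<kappa>(1) by (simp add: X_def zero_less_mult_iff)
    have XN: "X \<le> N" using \<kappa>(2) N0 by (simp add: X_def)
    have TN: "T = N powr (1 + \<alpha>)" using T \<alpha> by (simp add: N_def NT_def powr_powr)
    \<comment> \<open>Ties each E in B(T) to an energy \<open>a\<close> with good transfer matrices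
      and, through the diameter, to E0, where the non-orthogonal solution lives.\<close>
    have near: "\<exists>a\<in>A N. \<bar>a - E\<bar> < 1 / T \<and> \<bar>a - E0\<bar> \<le> \<eta>" if "E \<in> B" for E
    proof -
      obtain a where a: "a \<in> A N" "dist a E < 1 / T" using \<open>E \<in> B\<close> by (auto simp: B_def neighborhood_def)
      have "ennreal (dist a E0) \<le> ediameter (A N)"
      proof -
        have "E0 \<in> A N" using elim(1) by (simp add: N_def)
        then have "ennreal (dist a E0) \<le> (SUP y\<in>A N. ennreal (dist a y))" by (rule SUP_upper)
        also have "\<dots> \<le> ediameter (A N)" unfolding ediameter_def by (rule SUP_upper) (rule a(1))
        finally show ?thesis .
      qed
      also have "\<dots> < ennreal \<eta>" using elim(2) by (simp add: N_def)
      finally have "dist a E0 < \<eta>" using \<eta>(1) by (simp add: ennreal_less_iff)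
      then show ?thesis using a by (auto simp: dist_real_def)
    qed
    define m where "m = sqrt (q * N powr (1 - 2 * \<alpha>))"
    have m: "m > 0" using q N0 by (simp add: m_def)
    have m2: "m\<^sup>2 = q * N powr (1 - 2 * \<alpha>)" using q by (simp add: m_def)
    have "open B" unfolding B_def neighborhood_def by auto
    then have Bs: "B \<in> sets lebesgue" by (intro sets_completionI_sets) simp
    have Bpi: "B \<subseteq> {E0 - pi..E0 + pi}"
    proof
      fix E assume "E \<in> B"
      from near[OF this] T \<eta>(3) have "\<bar>E - E0\<bar> \<le> 1" by auto
      then show "E \<in> {E0 - pi..E0 + pi}" using pi_gt3 by auto
    qed
    have low: "m \<le> norm (restrict_l2 {x. X / 2 \<le> \<bar>x\<bar> \<and> \<bar>x\<bar> \<le> X} (abs_l2 w))"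
      if E: "E \<in> B" and w: "w \<in> L2" "schroedinger_eq V w (\<lambda>x. Complex E (1 / T) * w x + f x)" for E w
    proof -
      define z where "z = Complex E (1 / T)"
      obtain w0 where w0: "schroedinger_pair V (\<lambda>x. z * w x + g x) w w0"
        using schroedinger_eq_pair[OF schroedinger_eq_cong[OF w(2), of "\<lambda>x. z * w x + g x"]] fg by (auto simp: z_def)
      obtain a where a: "a \<in> A N" "\<bar>a - E\<bar> < 1 / T" "\<bar>a - E0\<bar> \<le> \<eta>" using near[OF E] by blast
      have zd: "norm (z - complex_of_real r) \<le> \<bar>E - r\<bar> + 1 / T" for r
        using cmod_le[of "z - complex_of_real r"] T by (simp add: z_def)
      have zE0: "norm (z - complex_of_real E0) \<le> 3 * \<eta>"
        using zd[of E0] a T by linarith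
      have za: "norm (z - complex_of_real a) \<le> 2 / T" using zd[of a] a by (simp add: abs_minus_commute)
      have zZ: "norm z \<le> Z"
        using norm_triangle_sub[of z "complex_of_real E0"] zE0 \<eta>(3) by (simp add: Z_def)
      have "4 * (C * N powr \<alpha>) * norm (z - complex_of_real a) * X \<le> 4 * (C * N powr \<alpha>) * (2 / T) * X"
        using za C X by (intro mult_right_mono mult_left_mono) auto
      also have "\<dots> = 8 * C * \<kappa> * (N powr \<alpha> * N / T)" by (simp add: X_def)
      also have "N powr \<alpha> * N / T = 1"
        using N0 by (simp add: TN powr_add)
      finally have small: "4 * (C * N powr \<alpha>) * norm (z - complex_of_real a) * X \<le> 1" using \<kappa>(3) by linarith
      have aP: "a \<in> P_set V \<alpha> C N" using a(1) elim(1) by (auto simp: N_def)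
      have "X / 4 * (c0 / (4 * (C * N powr \<alpha>)))\<^sup>2 \<le> D * (norm (restrict_l2 {x. X / 2 \<le> \<bar>x\<bar> \<and> \<bar>x\<bar> \<le> X} (abs_l2 w)))\<^sup>2"
        unfolding D_def
        by (rule resolvent_mass_lower_bound[OF lV K(2) g gR R w(1) w0 aP small _ data[OF _ w0] zZ XN X(3,2)])
          (use c0 zE0 \<eta> in auto)
      moreover have "X / 4 * (c0 / (4 * (C * N powr \<alpha>)))\<^sup>2 = D * m\<^sup>2"
      proof -
        have "N powr (1 - 2 * \<alpha>) = N / (N powr \<alpha>)\<^sup>2"
          using N0 by (simp add: powr_diff power2_eq_square flip: powr_add)
        then show ?thesis
          unfolding m2 q_def X_def using C D N0 by (simp add: power_mult_distrib power_divide field_simps)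
      qed
      ultimately have "m\<^sup>2 \<le> (norm (restrict_l2 {x. X / 2 \<le> \<bar>x\<bar> \<and> \<bar>x\<bar> \<le> X} (abs_l2 w)))\<^sup>2"
        using D by simp
      then show ?thesis by (rule power2_le_imp_le) simp
    qed
    have "ennreal (2 / T * (X / 2) powr p * (m\<^sup>2 / (8 * pi))) * emeasure lebesgue B \<le> time_averaged_moment V f T p"
      by (rule time_averaged_moment_lower_bound[OF V f(1) _ p X(1) m Bs Bpi low]) (use T in auto)
    moreover have "2 / T * (X / 2) powr p * (m\<^sup>2 / (8 * pi)) = C' * T powr ((p - 3 * \<alpha>) / (1 + \<alpha>))"
    proof -
      have "T powr ((p - 3 * \<alpha>) / (1 + \<alpha>)) = N powr (p - 3 * \<alpha>)"
        unfolding N_def NT_def by (simp add: powr_powr)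
      also have "\<dots> = N powr (p + (1 - 2 * \<alpha>) - (1 + \<alpha>))" by (simp add: algebra_simps)
      also have "\<dots> = N powr p * N powr (1 - 2 * \<alpha>) / T" by (subst TN, subst powr_diff, subst powr_add) (rule refl)
      finally have e: "T powr ((p - 3 * \<alpha>) / (1 + \<alpha>)) = N powr p * N powr (1 - 2 * \<alpha>) / T" .
      have "(X / 2) powr p = (\<kappa> / 2) powr p * N powr p"
        using \<kappa> N0 powr_mult[of "\<kappa> / 2" N p] by (simp add: X_def)
      then show ?thesis unfolding e m2 C'_def by (simp add: mult_ac)
    qed
    ultimately show ?case by (simp add: B_def N_def NT_def)
  qed
  then show ?thesis using C' by blast
qed

end
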